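(* Let $X_1,\ldots,X_N$ be i.i.d. real random variables, let $h_m:\mathbb R^m\to\mathbb R$ be permutation-symmetric, centered, square-integrable, non-degenerate kernels, and let $$U_{N,m}=\frac1{\binom Nm}\sum_{J\in\mathcal A_N^{(m)}}h_m\left(\frac{X_i}{\sqrt m},\ i\in J\right).$$ For $2\le j\le m$ let $f_j(x_1,\ldots,x_j)=\mathbb E\,h_m\left(\frac{x_1}{\sqrt m},\ldots,\frac{x_j}{\sqrt m},\frac{X_{j+1}}{\sqrt m},\ldots,\frac{X_m}{\sqrt m}\right)$. Suppose that (i) for all $2\le j\le j_{\max}$, $\left\|\partial_{x_1}\cdots\partial_{x_j}f_j\right\|_\infty\le\left(\frac{C_1(P)}{m}\right)^{j/2}j^{j/2}$, and $\left(\mathbb E|X_1-\mathbb EX_1|^k\right)^{1/k}\le k^{\gamma_2}M$ for all integers $k\ge2$ and some $\gamma_2\ge0$, $M>0$; (ii) the kernels $h_m$ are uniformly bounded, $\sup_m\|h_m\|_\infty<\infty$; (iii) $\liminf_{m\to\infty}\mathrm{Var}\left(\sqrt m\,h_m^{(1)}(X_1)\right)>0$; (iv) $mM^2=o\left(N^{1-\delta}\right)$ for some $\delta>0$. Moreover, let $q(N,m)$ be an increasing function such that $$q(N,m)=o\left(\min\left(\left(\frac{N}{mM^2}\right)^{\frac{1}{1+2\gamma_2}},\ j_{\max}\log(N/m)\right)\right)\quad\text{as }N/m\to\infty.$$ Then for all $2\le t\le q(N,m)$, $$\mathbb P\left(|U_{N,m}|\ge\sqrt{\frac{tm}{N}}\right)\le2\exp\left(-\frac{t}{2(1+o(1))\,\mathrm{Var}\left(\sqrt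 m\,h_m^{(1)}(X_1)\right)}\right),$$ where $o(1)\to0$ as $N/m\to\infty$ uniformly over $2\le t\le q(N,m)$. If $m=o\left(\frac{N^{1/2}}{\log(N)}\right)$, the same conclusion holds when $q(N,m)$ is instead chosen such that $$q(N,m)=o\left(\min\left(\left(\frac{N}{mM^2}\right)^{\frac1{1+2\gamma_2}},\ \frac{Nj_{\max}}{m^2}\right)\right).$$
   Context: $\mathcal A_N^{(m)}=\{J\subseteq\{1,\ldots,N\}:|J|=m\}$; $P$ is the law of $X_1$. The kernel $h_m$ is invariant under permutations of its arguments and satisfies $\mathbb E h_m\left(\frac{X_1}{\sqrt m},\ldots,\frac{X_m}{\sqrt m}\right)=0$ and $\mathbb E h_m^2\left(\frac{X_1}{\sqrt m},\ldots,\frac{X_m}{\sqrt m}\right)<\infty$. The first Hoeffding projection is $$h_m^{(1)}(x)=\mathbb E\,h_m\left(\frac{x}{\sqrt m},\frac{X_2}{\sqrt m},\ldots,\frac{X_m}{\sqrt m}\right),$$ and non-degenerate means $\mathbb P\left(h_m^{(1)}(X_1)\ne0\right)>0$. $\|\cdot\|_\infty$ is the sup-norm; assumption (i) includes the existence of the mixed partial derivatives. The integer $j_{\max}\in[2,m]$ and the quantity $M$ (and the law $P$) are allowed to depend on $m$ and $N$, while $C_1(P)$, $\gamma_2$, $\delta$ are fixed constants. $m=m_N\le N$ may grow with $N$. *)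

theory Defs
  imports "HOL-Probability.Probability" "HOL-Library.Landau_Symbols" "HOL-Combinatorics.Permutations"
begin

text \<open>
  Points of \<open>\<real>\<^sup>m\<close> are extensional functions on \<open>{1..m}\<close>, i.e. elements of
  \<open>{1..m} \<rightarrow>\<^sub>E UNIV\<close>, with the Borel structure of \<open>Pi\<^sub>M {1..m} (\<lambda>_. borel)\<close>.
\<close>

definition symmetric_kernel :: "nat \<Rightarrow> ((nat \<Rightarrow> real) \<Rightarrow> real) \<Rightarrow> bool" where
  "symmetric_kernel m h \<longleftrightarrow>
     h \<in> borel_measurable (Pi\<^sub>M {1..m} (\<lambda>_. borel)) \<and>
     (\<forall>p x. p permutes {1..m} \<longrightarrow> x \<in> {1..m} \<rightarrow>\<^sub>E UNIV \<longrightarrow> h (\<lambda>i. x (p i)) = h x)"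

definition scaled_kernel :: "nat \<Rightarrow> ((nat \<Rightarrow> real) \<Rightarrow> real) \<Rightarrow> (nat \<Rightarrow> real) \<Rightarrow> real" where
  "scaled_kernel m h x = h (\<lambda>i\<in>{1..m}. x i / sqrt (real m))"

text \<open>The elements of \<open>J\<close> are fed to the kernel in increasing order; lists are indexed from 0.\<close>

definition U_stat ::
  "nat \<Rightarrow> nat \<Rightarrow> ((nat \<Rightarrow> real) \<Rightarrow> real) \<Rightarrow> (nat \<Rightarrow> 'a \<Rightarrow> real) \<Rightarrow> 'a \<Rightarrow> real" where
  "U_stat N m h X \<omega> =
     (\<Sum>J | J \<subseteq> {1..N} \<and> card J = m.
        scaled_kernel m h (\<lambda>i. X (sorted_list_of_set J ! (i - 1)) \<omega>)) / real (N choose m)"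

text \<open>\<open>kernel_mean \<Omega> m h X j\<close> is \<open>f\<^sub>j\<close>; it depends only on the coordinates \<open>1..j\<close> of its last argument.\<close>

definition kernel_mean ::
  "'a measure \<Rightarrow> nat \<Rightarrow> ((nat \<Rightarrow> real) \<Rightarrow> real) \<Rightarrow> (nat \<Rightarrow> 'a \<Rightarrow> real) \<Rightarrow> nat \<Rightarrow> (nat \<Rightarrow> real) \<Rightarrow> real" where
  "kernel_mean \<Omega> m h X j x =
     prob_space.expectation \<Omega> (\<lambda>\<omega>. scaled_kernel m h (\<lambda>i. if i \<le> j then x i else X i \<omega>))"

definition hoeffding_proj1 ::
  "'a measure \<Rightarrow> nat \<Rightarrow> ((nat \<Rightarrow> real) \<Rightarrow> real) \<Rightarrow> (nat \<Rightarrow> 'a \<Rightarrow> real) \<Rightarrow> real \<Rightarrow> real" where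
  "hoeffding_proj1 \<Omega> m h X x =
     prob_space.expectation \<Omega> (\<lambda>\<omega>. scaled_kernel m h (\<lambda>i. if i = 1 then x else X i \<omega>))"

definition proj1_variance ::
  "'a measure \<Rightarrow> nat \<Rightarrow> ((nat \<Rightarrow> real) \<Rightarrow> real) \<Rightarrow> (nat \<Rightarrow> 'a \<Rightarrow> real) \<Rightarrow> real" where
  "proj1_variance \<Omega> m h X =
     prob_space.variance \<Omega> (\<lambda>\<omega>. sqrt (real m) * hoeffding_proj1 \<Omega> m h X (X 1 \<omega>))"

definition partial_deriv :: "nat \<Rightarrow> ((nat \<Rightarrow> real) \<Rightarrow> real) \<Rightarrow> (nat \<Rightarrow> real) \<Rightarrow> real" where
  "partial_deriv i f x = deriv (\<lambda>s. f (x(i := s))) (x i)"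

text \<open>
  \<open>mixed_partial i j f\<close> is \<open>\<partial>\<^sub>i \<partial>\<^sub>i\<^sub>+\<^sub>1 \<dots> \<partial>\<^sub>j f\<close>, with \<open>\<partial>\<^sub>j\<close> taken first; it is \<open>f\<close> if \<open>i > j\<close>.
  Since \<open>deriv\<close> is total, existence at every stage is a separate predicate.
\<close>

definition mixed_partial :: "nat \<Rightarrow> nat \<Rightarrow> ((nat \<Rightarrow> real) \<Rightarrow> real) \<Rightarrow> (nat \<Rightarrow> real) \<Rightarrow> real" where
  "mixed_partial i j f = foldr partial_deriv [i..<Suc j] f"

definition mixed_partials_exist :: "nat \<Rightarrow> ((nat \<Rightarrow> real) \<Rightarrow> real) \<Rightarrow> bool" where
  "mixed_partials_exist j f \<longleftrightarrow>
     (\<forall>i\<in>{1..j}. \<forall>x. (\<lambda>s. mixed_partial (Suc i) j f (x(i := s))) field_differentiable at (x i))"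

text \<open>
  \<open>R\<close> is the set of pairs \<open>(N, m)\<close> under consideration, e.g. the graph of a sequence \<open>N \<mapsto> m\<^sub>N\<close> or all
  pairs with \<open>2 \<le> m \<le> N\<close>. The filter expresses \<open>N/m \<rightarrow> \<infinity>\<close> within \<open>R\<close>. If \<open>R\<close> is the graph of a
  sequence with \<open>N/m\<^sub>N \<rightarrow> \<infinity>\<close>, limits along it are limits as \<open>N \<rightarrow> \<infinity>\<close>.
\<close>

definition ratio_at_top :: "(nat \<times> nat) set \<Rightarrow> (nat \<times> nat) filter" where
  "ratio_at_top R = inf (filtercomap (\<lambda>(N, m). real N / real m) at_top) (principal R)"

text \<open>Uniformity of the \<open>o(1)\<close> term over \<open>t\<close> is expressed by \<open>\<epsilon>\<close> not depending on \<open>t\<close>.\<close>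

definition deviation_bound ::
  "(nat \<times> nat) set \<Rightarrow> (nat \<Rightarrow> nat \<Rightarrow> 'a measure) \<Rightarrow> (nat \<Rightarrow> nat \<Rightarrow> nat \<Rightarrow> 'a \<Rightarrow> real) \<Rightarrow>
   (nat \<Rightarrow> (nat \<Rightarrow> real) \<Rightarrow> real) \<Rightarrow> (nat \<Rightarrow> nat \<Rightarrow> real) \<Rightarrow> bool" where
  "deviation_bound R \<Omega> X h q \<longleftrightarrow>
     (\<exists>\<epsilon> :: nat \<Rightarrow> nat \<Rightarrow> real.
        ((\<lambda>(N, m). \<epsilon> N m) \<longlongrightarrow> 0) (ratio_at_top R) \<and>
        (\<forall>(N, m)\<in>R. - 1 < \<epsilon> N m) \<and>
        (\<forall>(N, m)\<in>R. \<forall>t. 2 \<le> t \<and> t \<le> q N m \<longrightarrow>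
           measure (\<Omega> N m) {\<omega> \<in> space (\<Omega> N m).
               \<bar>U_stat N m (h m) (X N m) \<omega>\<bar> \<ge> sqrt (t * real m / real N)}
           \<le> 2 * exp (- t / (2 * (1 + \<epsilon> N m) * proj1_variance (\<Omega> N m) m (h m) (X N m)))))"

end

theory Submission
  imports Defs
begin

text \<open>
  Write \<open>U = \<Sum>\<^sub>j U\<^sub>j\<close> for the Hoeffding decomposition. The linear part \<open>U\<^sub>1\<close> obeys a Chernoff bound with
  its exact variance as long as \<open>h\<^sup>(\<^sup>1\<^sup>)\<close> is rarely large compared to 1. This is automatic if \<open>t m/N\<close> is
  small; otherwise the bound on \<open>q\<close> forces \<open>M \<rightarrow> 0\<close> and \<open>jmax \<rightarrow> \<infinity>\<close>, so that all components of degree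
  between 2 and \<open>jmax\<close> are negligible, and a bounded kernel with such a gap in its spectrum cannot have
  a projection with large values: tilting the law of the sample towards these values would make the
  mean of the kernel exceed its supremum.

  For \<open>j \<ge> 2\<close> the moments of \<open>U\<^sub>j\<close> of order \<open>2 k \<approx> 2 K t\<close>, with \<open>K\<close> a large constant, are estimated by
  symmetrization with an independent copy, the hypercontractive inequality for Rademacher chaos, and a
  Rosenthal inequality for the resulting U-statistic of squares, which Hoeffding's representation as a
  mean of averages over disjoint blocks reduces to sums of independent variables. The symmetrized kernel
  is a mixed difference of \<open>f\<^sub>j\<close> and hence controlled by the mixed derivative and the moments of \<open>X\<^sub>1\<close>;
  its variance is also bounded by Bessel's inequality. Components of degree beyond \<open>jmax\<close> are bounded
  either in \<open>L\<^sup>2\<close>, by \<open>(m/N)\<^sup>j\<close>, or by moments with the trivial bound on the kernel.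
\<close>

section \<open>Moment inequalities for sums and Rademacher chaos\<close>

text \<open>The conclusion keeps the factor 2 and the sharp variance from t = 2 on, so error terms
  never become negligible through large t; they have to fit into the slack between the rates for
  \<eta> and e, and this is why K must be large depending on e. No constant may depend on N, m or
  the law. For smooth degrees everything is governed by r = 2k ((2k)^\<gamma> M)^2 m/N: the factor
  j^j in the squared derivative bound is cancelled by the estimate (3m/j)^j of the binomial
  coefficient. With k of order t, r is of order t^(1+2\<gamma>) m M^2/N, whence the exponent
  1/(1+2\<gamma>) in the condition on q. The Rosenthal step leaves a prefactor that may be as large
  as N. For smooth degrees r^k pays for it, by exp(-k) if k \<ge> ln N and by the power saving in
  assumption (iv) otherwise. Beyond jmax there is no such saving, and the prefactor is absorbed into
  the variance term instead.\<close>

lemma binomial_even_le: "real ((2 * k) choose (2 * i)) \<le> (2 * real k - 1) ^ i * real (k choose i)"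
proof (induction i)
  case 0 then show ?case by simp
next
  case (Suc i)
  show ?case
  proof (cases "Suc i \<le> k")
    case False
    then show ?thesis by (simp add: binomial_eq_0)
  next
    case True
    have a: "real (Suc n) * real (m choose Suc n) = (real m - real n) * real (m choose n)" for m n
    proof (cases "n \<le> m")
      case True
      have "Suc n * (m choose Suc n) = (m - n) * (m choose n)"
        by (metis Suc_times_binomial_eq binomial_absorb_comp mult.commute Suc_times_binomial binomial_absorption times_binomial_minus1_eq)
      then have "real (Suc n * (m choose Suc n)) = real ((m - n) * (m choose n))" by presburger
      then show ?thesis using True by (simp only: of_nat_mult of_nat_diff)
    next
      case False then show ?thesis by (simp add: binomial_eq_0)
    qed
    \<comment> \<open>From i to i+1 the left side gains (2k-2i)(2k-2i-1)/((2i+2)(2i+1)) and the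
      binomial coefficient on the right (k-i)/(i+1); the quotient is (2k-2i-1)/(2i+1), which is at
      most 2k-1.\<close>
    have 1: "(2 * real i + 2) * real ((2*k) choose (2 * Suc i)) = (2 * real k - 2 * real i - 1) * real ((2*k) choose (2*i+1))"
      using a[of "2*i+1" "2*k"] by (simp add: algebra_simps)
    have 2: "(2 * real i + 1) * real ((2*k) choose (2*i+1)) = (2 * real k - 2 * real i) * real ((2*k) choose (2*i))"
      using a[of "2*i" "2*k"] by (simp add: algebra_simps)
    have 3: "(real i + 1) * real (k choose Suc i) = (real k - real i) * real (k choose i)"
      using a[of "i" "k"] by (simp add: algebra_simps)
    have ki: "real k \<ge> real i + 1" using True by linarith
    have "(2 * real i + 2) * (2 * real i + 1) * real ((2*k) choose (2 * Suc i))
      = (2 * real k - 2 * real i - 1) * (2 * (real k - real i)) * real ((2*k) choose (2*i))"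
    proof -
      have "(2 * real i + 2) * (2 * real i + 1) * real ((2*k) choose (2 * Suc i))
        = (2 * real i + 1) * ((2 * real k - 2 * real i - 1) * real ((2*k) choose (2*i+1)))"
        unfolding 1[symmetric] by simp
      also have "\<dots> = (2 * real k - 2 * real i - 1) * ((2 * real i + 1) * real ((2*k) choose (2*i+1)))"
        by simp
      also have "\<dots> = (2 * real k - 2 * real i - 1) * ((2 * real k - 2 * real i) * real ((2*k) choose (2*i)))"
        unfolding 2 ..
      finally have *: "(2 * real i + 2) * (2 * real i + 1) * real ((2*k) choose (2 * Suc i))
        = (2 * real k - 2 * real i - 1) * ((2 * real k - 2 * real i) * real ((2*k) choose (2*i)))" .
      have "2 * real k - 2 * real i = 2 * (real k - real i)" by simp
      then show ?thesis unfolding * by (simp only: mult.assoc)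
    qed
    also have "\<dots> \<le> (2 * real k - 2 * real i - 1) * (2 * (real k - real i)) * ((2 * real k - 1) ^ i * real (k choose i))"
      using ki Suc.IH by (intro mult_left_mono) auto
    also have "\<dots> = (2 * real k - 2 * real i - 1) * 2 * (2 * real k - 1) ^ i * ((real k - real i) * real (k choose i))"
      by (simp only: mult_ac)
    also have "\<dots> = (2 * real k - 2 * real i - 1) * 2 * (2 * real k - 1) ^ i * ((real i + 1) * real (k choose Suc i))"
      using 3 by simp
    also have "\<dots> \<le> ((2 * real i + 1) * (2 * real k - 1)) * 2 * (2 * real k - 1) ^ i * ((real i + 1) * real (k choose Suc i))"
    proof (intro mult_right_mono)
      have "0 \<le> real i * real k" by simp
      then show "2 * real k - 2 * real i - 1 \<le> (2 * real i + 1) * (2 * real k - 1)"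
        using ki by (simp add: algebra_simps)
    qed (use ki in auto)
    also have "\<dots> = (2 * real i + 2) * (2 * real i + 1) * ((2 * real k - 1) ^ Suc i * real (k choose Suc i))"
      by (simp add: algebra_simps)
    finally have "(2 * real i + 2) * (2 * real i + 1) * real ((2*k) choose (2 * Suc i)) \<le>
       (2 * real i + 2) * (2 * real i + 1) * ((2 * real k - 1) ^ Suc i * real (k choose Suc i))" .
    moreover have "(2 * real i + 2) * (2 * real i + 1) > 0" by (intro mult_pos_pos) auto
    ultimately show ?thesis by (metis mult_le_cancel_left_pos)
  qed
qed

text \<open>Bonami's two-point inequality for the exponent 2k. Odd powers of b cancel, and the even
  terms are compared one by one with the expansion of the right-hand side.\<close>

lemma two_point_inequality:
  fixes a b :: real
  shows "((a + b) ^ (2 * k) + (a - b) ^ (2 * k)) / 2 \<le> (a\<^sup>2 + (2 * real k - 1) * b\<^sup>2) ^ k"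
proof -
  let ?t = "\<lambda>i. real ((2*k) choose i) * b ^ i * a ^ (2*k - i)"
  have "(a + b) ^ (2 * k) + (a - b) ^ (2 * k) = (b + a) ^ (2 * k) + (- b + a) ^ (2 * k)" by (simp add: add.commute)
  also have "\<dots> = (\<Sum>i\<le>2*k. ?t i + real ((2*k) choose i) * (-b) ^ i * a ^ (2*k - i))"
    by (simp only: binomial_ring sum.distrib)
  also have "\<dots> = (\<Sum>i\<le>2*k. if even i then 2 * ?t i else 0)"
    by (intro sum.cong) (auto simp: uminus_power_if)
  also have "\<dots> = (\<Sum>i\<in>{i. i \<le> 2*k \<and> even i}. 2 * ?t i)"
    by (subst sum.inter_filter[symmetric]) (auto intro!: sum.cong)
  also have "\<dots> = (\<Sum>i\<le>k. 2 * ?t (2*i))"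
    by (rule sum.reindex_bij_witness[of _ "\<lambda>i. 2*i" "\<lambda>i. i div 2"]) auto
  finally have "((a + b) ^ (2 * k) + (a - b) ^ (2 * k)) / 2 = (\<Sum>i\<le>k. ?t (2*i))"
    by (simp add: sum_distrib_left[symmetric])
  also have "\<dots> \<le> (\<Sum>i\<le>k. ((2 * real k - 1) ^ i * real (k choose i)) * (b\<^sup>2)^i * (a\<^sup>2) ^ (k - i))"
  proof (rule sum_mono)
    fix i assume "i \<in> {..k}"
    then have "2 * k - 2 * i = 2 * (k - i)" by simp
    then have "?t (2*i) = real ((2*k) choose (2*i)) * ((b\<^sup>2)^i * (a\<^sup>2) ^ (k - i))"
      by (simp add: power_mult)
    also have "\<dots> \<le> ((2 * real k - 1) ^ i * real (k choose i)) * ((b\<^sup>2)^i * (a\<^sup>2) ^ (k - i))"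
      by (intro mult_right_mono binomial_even_le) auto
    finally show "?t (2*i) \<le> ((2 * real k - 1) ^ i * real (k choose i)) * (b\<^sup>2)^i * (a\<^sup>2) ^ (k - i)"
      by (simp only: mult.assoc)
  qed
  also have "\<dots> = ((2 * real k - 1) * b\<^sup>2 + a\<^sup>2) ^ k"
    unfolding binomial_ring[of "(2 * real k - 1) * b\<^sup>2"]
    by (intro sum.cong) (auto simp: power_mult_distrib)
  finally show ?thesis by (simp add: add.commute)
qed

text \<open>Convexity of the k-th power: (u + w)/(s + t) is the mean of u/s and w/t with weights
  proportional to s and t.\<close>

lemma power_add_le_weighted:
  fixes u w :: real
  assumes "0 \<le> u" "0 \<le> w" "0 < s" "0 < t"
  shows "(u + w) ^ k \<le> (s + t) ^ k * (s / (s + t) * (u / s) ^ k + t / (s + t) * (w / t) ^ k)"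
proof -
  have c: "convex_on {0..} (\<lambda>x::real. x ^ k)"
    by (cases "even k") (auto intro: convex_power_odd convex_on_subset[OF convex_power_even])
  have "(s / (s + t)) *\<^sub>R (u / s) + (t / (s + t)) *\<^sub>R (w / t) = (u + w) / (s + t)"
    using assms by (simp add: divide_simps)
  moreover have "((s / (s + t)) *\<^sub>R (u / s) + (t / (s + t)) *\<^sub>R (w / t)) ^ k \<le> s / (s + t) * (u / s) ^ k + t / (s + t) * (w / t) ^ k"
    using assms by (intro conjunct2[OF c[unfolded convex_on_def], rule_format])
      (auto simp: add_divide_distrib[symmetric])
  ultimately have "((u + w) / (s + t)) ^ k \<le> s / (s + t) * (u / s) ^ k + t / (s + t) * (w / t) ^ k" by simp
  then have "(u + w) ^ k / (s + t) ^ k \<le> s / (s + t) * (u / s) ^ k + t / (s + t) * (w / t) ^ k"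
    by (simp only: power_divide)
  then show ?thesis using assms by (subst (asm) pos_divide_le_eq) (auto simp: mult.commute)
qed

text \<open>Minkowski's inequality in l^k without roots: up to the common factor c, s and t bound
  the two norms, and they are the right weights in the convexity bound.\<close>

lemma sum_power_add_le:
  fixes u w :: "'a \<Rightarrow> real"
  assumes fin: "finite I" and u: "\<And>i. i \<in> I \<Longrightarrow> 0 \<le> u i" and w: "\<And>i. i \<in> I \<Longrightarrow> 0 \<le> w i"
    and s: "0 \<le> s" "(\<Sum>i\<in>I. u i ^ k) \<le> c * s ^ k" and t: "0 \<le> t" "(\<Sum>i\<in>I. w i ^ k) \<le> c * t ^ k" and k: "k > 0"
  shows "(\<Sum>i\<in>I. (u i + w i) ^ k) \<le> c * (s + t) ^ k"
proof -
  have zero: "f i = 0" if "(\<Sum>i\<in>I. f i ^ k) \<le> c * 0 ^ k" "i \<in> I" "\<And>i. i \<in> I \<Longrightarrow> 0 \<le> f i" for f :: "'a \<Rightarrow> real" and i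
  proof -
    have "(\<Sum>i\<in>I. f i ^ k) = 0" using that k by (intro antisym sum_nonneg) (simp_all add: zero_power)
    then have "f i ^ k = 0" using fin that by (subst (asm) sum_nonneg_eq_0_iff) auto
    then show ?thesis using k by simp
  qed
  consider "s = 0" | "t = 0" | "s > 0" "t > 0" using s t by fastforce
  then show ?thesis
  proof cases
    case 1
    then have "(\<Sum>i\<in>I. (u i + w i) ^ k) = (\<Sum>i\<in>I. w i ^ k)" using zero[of u] s(2) u by (intro sum.cong) auto
    then show ?thesis using t 1 by simp
  next
    case 2
    then have "(\<Sum>i\<in>I. (u i + w i) ^ k) = (\<Sum>i\<in>I. u i ^ k)" using zero[of w] t(2) w by (intro sum.cong) auto
    then show ?thesis using s 2 by simp
  next
    case 3
    have "(\<Sum>i\<in>I. (u i + w i) ^ k) \<le> (\<Sum>i\<in>I. (s + t) ^ k * (s / (s + t) * (u i / s) ^ k + t / (s + t) * (w i / t) ^ k))"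
      using u w 3 by (intro sum_mono power_add_le_weighted) auto
    also have "\<dots> = (s + t) ^ k * (s / (s + t) * ((\<Sum>i\<in>I. u i ^ k) / s ^ k) + t / (s + t) * ((\<Sum>i\<in>I. w i ^ k) / t ^ k))"
      by (simp add: sum_distrib_left[symmetric] sum.distrib power_divide sum_divide_distrib[symmetric])
    also have "\<dots> \<le> (s + t) ^ k * (s / (s + t) * c + t / (s + t) * c)"
      using s t 3 by (intro mult_left_mono add_mono mult_left_mono) (auto simp: divide_simps mult.commute)
    also have "s / (s + t) * c + t / (s + t) * c = c"
      using 3 by (simp add: distrib_right[symmetric] add_divide_distrib[symmetric])
    finally show ?thesis by (simp add: mult.commute)
  qed
qed

text \<open>\<open>\<epsilon>\<close> ranges over sign vectors, encoded as the set of coordinates with sign \<open>- 1\<close>.\<close>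

lemma rademacher_chaos_moment:
  fixes a :: "nat set \<Rightarrow> real"
  assumes "finite I" "k > 0"
  shows "(\<Sum>\<epsilon>\<in>Pow I. (\<Sum>J\<in>Pow I. (- 1) ^ card (J \<inter> \<epsilon>) * a J) ^ (2 * k))
    \<le> 2 ^ card I * (\<Sum>J\<in>Pow I. (2 * real k - 1) ^ card J * (a J)\<^sup>2) ^ k"
  using assms(1)
proof (induction I arbitrary: a rule: finite_induct)
  case empty
  then show ?case by (simp add: power_mult)
next
  case (insert i I)
  \<comment> \<open>A collects the index sets without i and B those containing i; flipping the sign
    of i turns A + B into A - B.\<close>
  define A where "A \<epsilon> = (\<Sum>J\<in>Pow I. (- 1) ^ card (J \<inter> \<epsilon>) * a J)" for \<epsilon>
  define B where "B \<epsilon> = (\<Sum>J\<in>Pow I. (- 1) ^ card (J \<inter> \<epsilon>) * a (insert i J))" for \<epsilon>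
  define s where "s = (\<Sum>J\<in>Pow I. (2 * real k - 1) ^ card J * (a J)\<^sup>2)"
  define t where "t = (\<Sum>J\<in>Pow I. (2 * real k - 1) ^ card J * (a (insert i J))\<^sup>2)"
  have k1: "2 * real k - 1 \<ge> 0" using assms(2) by linarith
  have inj: "inj_on (insert i) (Pow I)" using insert(2) by (auto intro!: inj_onI)
  have disj: "Pow I \<inter> insert i ` Pow I = {}" using insert(2) by auto
  have fin: "finite (Pow I)" using insert by simp
  have split: "sum g (Pow (insert i I)) = sum g (Pow I) + (\<Sum>J\<in>Pow I. g (insert i J))" for g :: "nat set \<Rightarrow> real"
    unfolding Pow_insert using inj disj fin
    by (subst sum.union_disjoint) (auto simp: sum.reindex)
  have card_ins: "card (insert i J) = Suc (card J)" if "J \<in> Pow I" for J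
    using that insert by (subst card_insert_disjoint) (auto intro: finite_subset)
  have e1: "(\<Sum>J\<in>Pow (insert i I). (- 1) ^ card (J \<inter> \<epsilon>) * a J) = A \<epsilon> + B \<epsilon>" if "\<epsilon> \<in> Pow I" for \<epsilon>
  proof -
    have "insert i J \<inter> \<epsilon> = J \<inter> \<epsilon>" for J using that insert(2) by auto
    then show ?thesis unfolding split A_def B_def by simp
  qed
  have e2: "(\<Sum>J\<in>Pow (insert i I). (- 1) ^ card (J \<inter> insert i \<epsilon>) * a J) = A \<epsilon> - B \<epsilon>" if "\<epsilon> \<in> Pow I" for \<epsilon>
  proof -
    have 1: "J \<inter> insert i \<epsilon> = J \<inter> \<epsilon>" if "J \<in> Pow I" for J using that insert(2) by auto
    have 2: "card (insert i J \<inter> insert i \<epsilon>) = Suc (card (J \<inter> \<epsilon>))" if "J \<in> Pow I" for J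
    proof -
      have "insert i J \<inter> insert i \<epsilon> = insert i (J \<inter> \<epsilon>)" by auto
      then show ?thesis using card_ins[of "J \<inter> \<epsilon>"] that by auto
    qed
    have 3: "(- 1) ^ card (insert i J \<inter> insert i \<epsilon>) * a (insert i J) = - ((- 1) ^ card (J \<inter> \<epsilon>) * a (insert i J))"
      if "J \<in> Pow I" for J using 2[OF that] by (simp only: power_Suc)
    show ?thesis unfolding split A_def B_def
      by (simp only: 1 3 sum_negf diff_conv_add_uminus cong: sum.cong)
  qed
  have "(\<Sum>\<epsilon>\<in>Pow (insert i I). (\<Sum>J\<in>Pow (insert i I). (- 1) ^ card (J \<inter> \<epsilon>) * a J) ^ (2 * k))
    = (\<Sum>\<epsilon>\<in>Pow I. (A \<epsilon> + B \<epsilon>) ^ (2 * k) + (A \<epsilon> - B \<epsilon>) ^ (2*k))"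
    unfolding split[of "\<lambda>\<epsilon>. (\<Sum>J\<in>Pow (insert i I). (- 1) ^ card (J \<inter> \<epsilon>) * a J) ^ (2 * k)"] sum.distrib
    by (intro arg_cong2[where f="(+)"] sum.cong refl) (simp_all only: e1 e2)
  also have "\<dots> \<le> (\<Sum>\<epsilon>\<in>Pow I. 2 * ((A \<epsilon>)\<^sup>2 + (2 * real k - 1) * (B \<epsilon>)\<^sup>2) ^ k)"
    using two_point_inequality by (intro sum_mono) (auto simp: field_simps)
  also have "\<dots> = 2 * (\<Sum>\<epsilon>\<in>Pow I. ((A \<epsilon>)\<^sup>2 + (2 * real k - 1) * (B \<epsilon>)\<^sup>2) ^ k)"
    by (simp add: sum_distrib_left)
  \<comment> \<open>The induction hypothesis bounds the k-th moments of A^2 and B^2; Minkowski adds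
    these bounds without loss, so 2k-1 enters once per index.\<close>
  also have "\<dots> \<le> 2 * (2 ^ card I * (s + (2 * real k - 1) * t) ^ k)"
  proof (intro mult_left_mono sum_power_add_le)
    show "(\<Sum>\<epsilon>\<in>Pow I. ((A \<epsilon>)\<^sup>2) ^ k) \<le> 2 ^ card I * s ^ k"
      using insert.IH[of a] by (simp add: A_def s_def power_mult)
    have "(\<Sum>\<epsilon>\<in>Pow I. ((B \<epsilon>)\<^sup>2) ^ k) \<le> 2 ^ card I * t ^ k"
      using insert.IH[of "\<lambda>J. a (insert i J)"] by (simp add: B_def t_def power_mult)
    then have "(2 * real k - 1) ^ k * (\<Sum>\<epsilon>\<in>Pow I. ((B \<epsilon>)\<^sup>2) ^ k) \<le> (2 * real k - 1) ^ k * (2 ^ card I * t ^ k)"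
      using k1 by (intro mult_left_mono) auto
    then show "(\<Sum>\<epsilon>\<in>Pow I. ((2 * real k - 1) * (B \<epsilon>)\<^sup>2) ^ k) \<le> 2 ^ card I * ((2 * real k - 1) * t) ^ k"
      by (simp add: power_mult_distrib sum_distrib_left mult_ac)
  qed (use insert assms k1 in \<open>auto simp: s_def t_def intro!: sum_nonneg mult_nonneg_nonneg\<close>)
  also have "s + (2 * real k - 1) * t = (\<Sum>J\<in>Pow (insert i I). (2 * real k - 1) ^ card J * (a J)\<^sup>2)"
    unfolding split s_def t_def sum_distrib_left
    by (intro arg_cong2[where f="(+)"] sum.cong refl) (simp add: card_ins)
  finally show ?case using insert by simp
qed

text \<open>The factor of a must stay bounded in k, which plain convexity does not give. If b \<le>
  a/(k-1), then (1 + 1/(k-1))^(k-1) \<le> e \<le> 3; otherwise a + b \<le> k b.\<close>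

lemma power_add_le_split:
  fixes a b :: real
  assumes "0 \<le> a" "0 \<le> b" "k > 0"
  shows "(a + b) ^ (k - 1) \<le> 3 * a ^ (k - 1) + real k ^ (k - 1) * b ^ (k - 1)"
proof (cases "k = 1")
  case True then show ?thesis by simp
next
  case False
  then have k: "real k - 1 > 0" "k \<ge> 2" using assms by auto
  show ?thesis
  proof (cases "(real k - 1) * b \<le> a")
    case True
    then have "b \<le> a / (real k - 1)" using k by (simp add: pos_le_divide_eq mult.commute)
    then have "a + b \<le> a * (1 + 1 / (real k - 1))" by (simp add: distrib_left)
    then have "(a + b) ^ (k - 1) \<le> (a * (1 + 1 / (real k - 1))) ^ (k - 1)"
      using assms by (intro power_mono) auto
    also have "\<dots> = a ^ (k - 1) * (1 + 1 / (real k - 1)) ^ (k - 1)" by (simp add: power_mult_distrib)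
    also have "(1 + 1 / (real k - 1)) ^ (k - 1) \<le> exp 1"
      using exp_ge_one_plus_x_over_n_power_n[of "k - 1" 1] k by (simp add: of_nat_diff)
    also have "exp (1::real) \<le> 3" by (rule exp_le)
    finally have "(a + b) ^ (k - 1) \<le> a ^ (k - 1) * 3" using assms by (simp add: mult_left_mono)
    then show ?thesis using assms by (simp add: add_increasing2)
  next
    case False
    then have "a + b \<le> real k * b" by (simp add: algebra_simps)
    then have "(a + b) ^ (k - 1) \<le> (real k * b) ^ (k - 1)" using assms by (intro power_mono) auto
    then show ?thesis using assms by (simp add: power_mult_distrib add_increasing)
  qed
qed

text \<open>Rosenthal's inequality for nonnegative variables. One factor of S^k is expanded; in each
  term S = T + V, where V factors out against the powers of T, and T \<le> S yields a recursion from
  the moment of order k to that of order k-1.\<close>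

lemma (in prob_space) sum_nonneg_moment:
  fixes V :: "nat \<Rightarrow> 'a \<Rightarrow> real"
  assumes V: "\<And>l x. 0 \<le> V l x" "\<And>l x. V l x \<le> b" "\<And>l. l < n \<Longrightarrow> V l \<in> borel_measurable M" and k: "k > 0"
    and indep: "\<And>l. l < n \<Longrightarrow> expectation (\<lambda>x. V l x * (\<Sum>i\<in>{..<n} - {l}. V i x) ^ (k - 1))
        = v * expectation (\<lambda>x. (\<Sum>i\<in>{..<n} - {l}. V i x) ^ (k - 1))"
    and v: "0 \<le> v" and w: "\<And>l. l < n \<Longrightarrow> expectation (\<lambda>x. V l x ^ k) \<le> w"
  shows "expectation (\<lambda>x. (\<Sum>l<n. V l x) ^ k) \<le> (6 * real n * v) ^ k + 2 * real k ^ (k - 1) * real n * w"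
proof -
  define S where "S x = (\<Sum>l<n. V l x)" for x
  define T where "T l x = (\<Sum>i\<in>{..<n} - {l}. V i x)" for l x
  define c where "c = 3 * real n * v"
  have b: "0 \<le> b" using V(1)[of 0 undefined] V(2)[of 0 undefined] by linarith
  have [measurable]: "V l \<in> borel_measurable M" if "l < n" for l by (rule V) fact
  have sub_int: "integrable M (\<lambda>x. V l x ^ p * (\<Sum>i\<in>A. V i x) ^ q)" if "A \<subseteq> {..<n}" "l < n" for A p q l
  proof (rule integrable_const_bound[where B="b ^ p * (real (card A) * b) ^ q"])
    show "AE x in M. norm (V l x ^ p * (\<Sum>i\<in>A. V i x) ^ q) \<le> b ^ p * (real (card A) * b) ^ q"
    proof (rule AE_I2)
      fix x
      have "(\<Sum>i\<in>A. V i x) \<le> real (card A) * b" using V(2) by (intro sum_bounded_above) auto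
      then show "norm (V l x ^ p * (\<Sum>i\<in>A. V i x) ^ q) \<le> b ^ p * (real (card A) * b) ^ q"
        using V b by (auto simp: abs_mult power_abs sum_nonneg intro!: mult_mono power_mono)
    qed
    have [measurable]: "(\<lambda>x. \<Sum>i\<in>A. V i x) \<in> borel_measurable M"
      using that by (intro borel_measurable_sum) auto
    show "(\<lambda>x. V l x ^ p * (\<Sum>i\<in>A. V i x) ^ q) \<in> borel_measurable M" using that by measurable
  qed
  show ?thesis
  proof (cases "n = 0")
    case True then show ?thesis using k by (simp add: zero_power)
  next
    case False
    have T_int: "integrable M (\<lambda>x. T l x ^ q)" if "l < n" for l q
      using sub_int[of "{..<n} - {l}" l 0 q] that by (simp add: T_def)
    have VT_int: "integrable M (\<lambda>x. V l x * T l x ^ q)" if "l < n" for l q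
      using sub_int[of "{..<n} - {l}" l 1 q] that by (simp add: T_def)
    have V_int: "integrable M (\<lambda>x. V l x ^ p)" if "l < n" for l p
      using sub_int[of "{}" l p 0] that by simp
    have S_int: "integrable M (\<lambda>x. S x ^ q)" for q
      using sub_int[of "{..<n}" 0 0 q] False by (simp add: S_def)
    have VS_int: "integrable M (\<lambda>x. V l x * S x ^ q)" if "l < n" for l q
      using sub_int[of "{..<n}" l 1 q] that by (simp add: S_def)
    have S0: "0 \<le> S x" and T0: "0 \<le> T l x" for x l unfolding S_def T_def using V by (auto intro!: sum_nonneg)
    have ST: "S x = T l x + V l x" if "l < n" for x l
      unfolding S_def T_def using that by (subst sum.remove[of _ l]) auto
    have k1: "x ^ k = x * x ^ (k - 1)" for x :: real using k by (metis power_eq_if not_gr_zero)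
    have "expectation (\<lambda>x. S x ^ k) = expectation (\<lambda>x. \<Sum>l<n. V l x * S x ^ (k - 1))"
      by (simp add: k1 S_def sum_distrib_right)
    also have "\<dots> = (\<Sum>l<n. expectation (\<lambda>x. V l x * S x ^ (k - 1)))"
      using VS_int by (intro Bochner_Integration.integral_sum) auto
    also have "\<dots> \<le> (\<Sum>l<n. c / real n * expectation (\<lambda>x. S x ^ (k - 1)) + real k ^ (k - 1) * w)"
    proof (rule sum_mono)
      fix l assume "l \<in> {..<n}" then have l: "l < n" by simp
      have "expectation (\<lambda>x. V l x * S x ^ (k - 1)) \<le> expectation (\<lambda>x. 3 * (V l x * T l x ^ (k - 1)) + real k ^ (k - 1) * V l x ^ k)"
      proof (rule integral_mono)
        fix x
        have "V l x * S x ^ (k - 1) \<le> V l x * (3 * T l x ^ (k - 1) + real k ^ (k - 1) * V l x ^ (k - 1))"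
          unfolding ST[OF l] using V T0 k by (intro mult_left_mono power_add_le_split) auto
        then show "V l x * S x ^ (k - 1) \<le> 3 * (V l x * T l x ^ (k - 1)) + real k ^ (k - 1) * V l x ^ k"
          by (simp add: k1 algebra_simps)
      qed (use VS_int VT_int V_int l in auto)
      also have "\<dots> = 3 * (v * expectation (\<lambda>x. T l x ^ (k - 1))) + real k ^ (k - 1) * expectation (\<lambda>x. V l x ^ k)"
        using VT_int[OF l] V_int[OF l] indep[OF l] by (simp add: T_def)
      also have "\<dots> \<le> 3 * (v * expectation (\<lambda>x. S x ^ (k - 1))) + real k ^ (k - 1) * w"
      proof (intro add_mono mult_left_mono w l)
        show "expectation (\<lambda>x. T l x ^ (k - 1)) \<le> expectation (\<lambda>x. S x ^ (k - 1))"
          using T_int[OF l] S_int T0 V by (intro integral_mono power_mono) (auto simp: ST[OF l])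
      qed (use v in auto)
      also have "\<dots> = c / real n * expectation (\<lambda>x. S x ^ (k - 1)) + real k ^ (k - 1) * w"
        using False by (simp add: c_def)
      finally show "expectation (\<lambda>x. V l x * S x ^ (k - 1)) \<le> c / real n * expectation (\<lambda>x. S x ^ (k - 1)) + real k ^ (k - 1) * w" .
    qed
    also have "\<dots> = c * expectation (\<lambda>x. S x ^ (k - 1)) + real k ^ (k - 1) * real n * w"
      using False by (simp add: algebra_simps)
    also have "c * expectation (\<lambda>x. S x ^ (k - 1)) = expectation (\<lambda>x. c * S x ^ (k - 1))" by simp
    \<comment> \<open>Where S \<ge> 2c, half of S^k dominates; elsewhere S^(k-1) is at most
      (2c)^(k-1). The half moment is then absorbed on the left, which doubles both
      constants.\<close>
    also have "\<dots> \<le> expectation (\<lambda>x. S x ^ k / 2 + (2 * c) ^ k / 2)"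
    proof (rule integral_mono)
      fix x
      have c0: "0 \<le> c" using v by (simp add: c_def)
      show "c * S x ^ (k - 1) \<le> S x ^ k / 2 + (2 * c) ^ k / 2"
      proof (cases "2 * c \<le> S x")
        case True
        have "c * S x ^ (k - 1) \<le> S x / 2 * S x ^ (k - 1)" using True S0 by (intro mult_right_mono) auto
        also have "\<dots> = S x ^ k / 2" by (simp add: k1)
        finally show ?thesis using c0 by (simp add: add_increasing2)
      next
        case False
        have "c * S x ^ (k - 1) \<le> c * (2 * c) ^ (k - 1)" using False S0 c0 by (intro mult_left_mono power_mono) auto
        also have "\<dots> = (2 * c) ^ k / 2" by (simp add: k1)
        finally show ?thesis using S0 by (simp add: add_increasing)
      qed
    qed (use S_int in auto)
    also have "\<dots> = expectation (\<lambda>x. S x ^ k) / 2 + (2 * c) ^ k / 2"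
      using S_int by (simp add: prob_space)
    finally have "expectation (\<lambda>x. S x ^ k) \<le> (2 * c) ^ k + 2 * real k ^ (k - 1) * real n * w"
      by simp
    then show ?thesis by (simp add: S_def c_def mult.assoc)
  qed
qed

section \<open>Averages over permutations\<close>

lemma power_mean_le:
  fixes f :: "'a \<Rightarrow> real"
  assumes "finite I" "I \<noteq> {}" "\<And>i. i \<in> I \<Longrightarrow> 0 \<le> f i"
  shows "((\<Sum>i\<in>I. f i) / real (card I)) ^ k \<le> (\<Sum>i\<in>I. f i ^ k) / real (card I)"
proof -
  have c: "convex_on {0..} (\<lambda>x::real. x ^ k)"
    by (cases "even k") (auto intro: convex_power_odd convex_on_subset[OF convex_power_even])
  have "(\<Sum>i\<in>I. (1 / real (card I)) *\<^sub>R f i) ^ k \<le> (\<Sum>i\<in>I. 1 / real (card I) * f i ^ k)"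
    using assms by (intro convex_on_sum[OF _ _ c]) auto
  then show ?thesis by (simp add: sum_divide_distrib)
qed

lemma card_image_permutes:
  assumes "p permutes A" shows "card (p ` J) = card J"
  by (rule card_image) (use permutes_inj_on[OF assms] in auto)

text \<open>A bijection from B onto J is completed by one between the complements in A, which have
  equal size.\<close>

lemma ex_permutes_image:
  assumes A: "finite A" and B: "B \<subseteq> A" and J: "J \<subseteq> A" "card J = card B"
  obtains t where "t permutes A" "t ` B = J"
proof -
  have fin: "finite J" "finite B" using J A B by (auto intro: finite_subset)
  obtain f where f: "bij_betw f B J" using J(2) fin by (metis finite_same_card_bij)
  have "card (A - B) = card (A - J)" using J A B fin by (auto simp: card_Diff_subset)
  then obtain g where g: "bij_betw g (A - B) (A - J)" using A by (metis finite_Diff finite_same_card_bij)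
  define t where "t x = (if x \<in> B then f x else if x \<in> A then g x else x)" for x
  have tB: "bij_betw t B J" using f by (rule bij_betw_cong[THEN iffD1, rotated]) (simp add: t_def)
  have tAB: "bij_betw t (A - B) (A - J)" using g by (rule bij_betw_cong[THEN iffD1, rotated]) (simp add: t_def)
  have "bij_betw t (B \<union> (A - B)) (J \<union> (A - J))" by (rule bij_betw_combine[OF tB tAB]) auto
  then have "bij_betw t A A" using B J by (simp add: Un_absorb1)
  then have t: "t permutes A" by (rule bij_imp_permutes) (use B in \<open>auto simp: t_def\<close>)
  with tB show ?thesis by (intro that[of t]) (auto simp: bij_betw_def)
qed

text \<open>The images of B hit every set of that size equally often: the sum over p does not change
  when B is replaced by another J, and each p permutes the sets J. This is the counting behind
  Hoeffding's block representation.\<close>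

lemma sum_permutes_image:
  fixes G :: "'a set \<Rightarrow> real"
  assumes A: "finite A" and B: "B \<subseteq> A"
  shows "real (card A choose card B) * (\<Sum>p | p permutes A. G (p ` B))
    = fact (card A) * (\<Sum>J | J \<subseteq> A \<and> card J = card B. G J)"
proof -
  let ?K = "{J. J \<subseteq> A \<and> card J = card B}"
  have same: "(\<Sum>p | p permutes A. G (p ` J)) = (\<Sum>p | p permutes A. G (p ` B))" if J: "J \<in> ?K" for J
  proof -
    obtain t where t: "t permutes A" and tJ: "t ` B = J"
      using ex_permutes_image[OF A B] J by auto
    have "(\<Sum>p | p permutes A. G (p ` J)) = (\<Sum>p | p permutes A. G ((p \<circ> t) ` B))"
      by (simp only: image_comp[symmetric] tJ)
    also have "\<dots> = (\<Sum>p | p permutes A. G (p ` B))"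
      by (rule sum_permutations_compose_right[OF t, symmetric])
    finally show ?thesis .
  qed
  have "real (card A choose card B) * (\<Sum>p | p permutes A. G (p ` B)) = (\<Sum>J\<in>?K. \<Sum>p | p permutes A. G (p ` B))"
    by (simp add: n_subsets[OF A])
  also have "\<dots> = (\<Sum>J\<in>?K. \<Sum>p | p permutes A. G (p ` J))" by (rule sum.cong[OF refl]) (simp only: same)
  also have "\<dots> = (\<Sum>p | p permutes A. \<Sum>J\<in>?K. G (p ` J))" by (rule sum.swap)
  also have "\<dots> = (\<Sum>p | p permutes A. \<Sum>J\<in>?K. G J)"
  proof (rule sum.cong[OF refl])
    fix p assume "p \<in> {p. p permutes A}"
    then have p: "p permutes A" by simp
    show "(\<Sum>J\<in>?K. G (p ` J)) = (\<Sum>J\<in>?K. G J)"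
    proof (rule sum.reindex_bij_witness[of _ "\<lambda>J. inv p ` J" "\<lambda>J. p ` J"])
      fix J assume J: "J \<in> ?K"
      show "inv p ` p ` J = J" "p ` inv p ` J = J"
        using permutes_inverses[OF p] by (auto simp: image_image)
      show "p ` J \<in> ?K" using J permutes_image[OF p] card_image_permutes[OF p] by auto
      show "inv p ` J \<in> ?K"
        using J permutes_image[OF permutes_inv[OF p]] card_image_permutes[OF permutes_inv[OF p]] by auto
    qed simp
  qed
  also have "\<dots> = fact (card A) * (\<Sum>J\<in>?K. G J)" using card_permutations[OF refl A] by simp
  finally show ?thesis .
qed

section \<open>Infinite i.i.d. sequences and independent copies\<close>

definition glue :: "nat set \<Rightarrow> (nat \<Rightarrow> 'b) \<Rightarrow> (nat \<Rightarrow> 'b) \<Rightarrow> nat \<Rightarrow> 'b" where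
  "glue D x y i = (if i \<in> D then x i else y i)"

lemma glue_UNIV [simp]: "glue UNIV x y = x"
  by (simp add: glue_def fun_eq_iff)

definition depends_on :: "nat set \<Rightarrow> ((nat \<Rightarrow> 'b) \<Rightarrow> 'c) \<Rightarrow> bool" where
  "depends_on D f \<longleftrightarrow> (\<forall>x y. (\<forall>i\<in>D. x i = y i) \<longrightarrow> f x = f y)"

lemma depends_onD: "depends_on D f \<Longrightarrow> (\<And>i. i \<in> D \<Longrightarrow> x i = y i) \<Longrightarrow> f x = f y"
  by (auto simp: depends_on_def)

lemma depends_onI: "(\<And>x y. (\<And>i. i \<in> D \<Longrightarrow> x i = y i) \<Longrightarrow> f x = f y) \<Longrightarrow> depends_on D f"
  unfolding depends_on_def by blast

text \<open>In an infinite product, fresh independent coordinates are always available by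
  relabelling, so conditional means, second copies and blocks are all functions on the one space
  \<open>S\<close>. A full \<open>space P\<close> removes membership conditions.\<close>

locale iid_seq = sequence_space P for P :: "'b measure" +
  assumes space_P [simp]: "space P = UNIV"
begin

lemma space_S [simp]: "space S = UNIV"
  by (simp add: space_PiM)

lemma prob_S [simp]: "P.prob UNIV = 1"
  using P.prob_space by simp

lemma measurable_glue [measurable]:
  "(\<lambda>(y, w). glue D (y \<circ> e) w) \<in> S \<Otimes>\<^sub>M S \<rightarrow>\<^sub>M S"
proof -
  have "(\<lambda>z. if i \<in> D then (fst z \<circ> e) i else snd z i) \<in> S \<Otimes>\<^sub>M S \<rightarrow>\<^sub>M P" for i
    by (cases "i \<in> D") auto
  then show ?thesis
    unfolding glue_def case_prod_beta' by (intro measurable_PiM_single') (auto simp: space_pair_measure)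
qed

lemma measurable_glue' [measurable (raw)]:
  assumes "f \<in> N \<rightarrow>\<^sub>M S" "g \<in> N \<rightarrow>\<^sub>M S"
  shows "(\<lambda>z. glue D (f z \<circ> e) (g z)) \<in> N \<rightarrow>\<^sub>M S"
  using measurable_compose[OF measurable_Pair[OF assms] measurable_glue] by simp

lemma measurable_glue'' [measurable (raw)]:
  assumes "f \<in> N \<rightarrow>\<^sub>M S" "g \<in> N \<rightarrow>\<^sub>M S"
  shows "(\<lambda>z. glue D (f z) (g z)) \<in> N \<rightarrow>\<^sub>M S"
  using measurable_glue'[OF assms, of D id] by simp

lemma measurable_reindex [measurable (raw)]:
  assumes "f \<in> N \<rightarrow>\<^sub>M S"
  shows "(\<lambda>z. f z \<circ> e) \<in> N \<rightarrow>\<^sub>M S"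
  using measurable_glue'[OF assms assms, of UNIV e] by simp

lemma distr_glue:
  assumes e: "inj_on e D"
  shows "distr (S \<Otimes>\<^sub>M S) S (\<lambda>(y, w). glue D (y \<circ> e) w) = S"
proof (rule PiM_eq)
  fix J F assume J: "finite J" "J \<subseteq> (UNIV::nat set)" "\<And>j. j \<in> J \<Longrightarrow> F j \<in> sets P"
  let ?f = "\<lambda>(y, w). glue D (y \<circ> e) w"
  let ?X = "prod_emb UNIV (\<lambda>n. P) J (\<Pi>\<^sub>E j\<in>J. F j)"
  have eJ: "inj_on e (J \<inter> D)" using e by (rule inj_on_subset) auto
  define g where "g = the_inv_into (J \<inter> D) e"
  have g: "g (e j) = j" if "j \<in> J \<inter> D" for j
    unfolding g_def using eJ that by (rule the_inv_into_f_f)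
  let ?A = "{x \<in> space S. \<forall>j\<in>e ` (J \<inter> D). x j \<in> F (g j)}"
  let ?B = "{x \<in> space S. \<forall>j\<in>J - D. x j \<in> F j}"
  have X: "?X \<in> sets S" using J by (intro sets_PiM_I) auto
  have gF: "\<And>j. j \<in> e ` (J \<inter> D) \<Longrightarrow> F (g j) \<in> sets P" using J g by auto
  have coord: "{x \<in> space S. x j \<in> C} \<in> sets S" if "C \<in> sets P" for j C
    using that by (rule sets_Collect_single[OF UNIV_I])
  have A: "?A \<in> sets S" using J gF by (intro sets.sets_Collect_finite_All coord) auto
  have B: "?B \<in> sets S" using J by (intro sets.sets_Collect_finite_All coord) auto
  have "(\<forall>j\<in>J. glue D (y \<circ> e) w j \<in> F j) \<longleftrightarrow> (\<forall>j\<in>J \<inter> D. y (e j) \<in> F j) \<and> (\<forall>j\<in>J - D. w j \<in> F j)" for y w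
    by (auto simp: glue_def)
  moreover have "(\<forall>j\<in>J \<inter> D. y (e j) \<in> F j) \<longleftrightarrow> (\<forall>j\<in>e ` (J \<inter> D). y j \<in> F (g j))" for y
    using g by simp
  ultimately have *: "(\<forall>j\<in>J. glue D (y \<circ> e) w j \<in> F j) \<longleftrightarrow>
    (\<forall>j\<in>e ` (J \<inter> D). y j \<in> F (g j)) \<and> (\<forall>j\<in>J - D. w j \<in> F j)" for y w
    by simp
  have "?f -` ?X \<inter> space (S \<Otimes>\<^sub>M S) = {(y, w). \<forall>j\<in>J. glue D (y \<circ> e) w j \<in> F j}"
  proof -
    have "?X = {x. \<forall>j\<in>J. x j \<in> F j}" by (auto simp: prod_emb_def PiE_iff)
    then show ?thesis by (auto simp: space_pair_measure)
  qed
  also have "\<dots> = ?A \<times> ?B"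
    unfolding * by auto
  finally have "emeasure (distr (S \<Otimes>\<^sub>M S) S ?f) ?X = emeasure (S \<Otimes>\<^sub>M S) (?A \<times> ?B)"
    by (subst emeasure_distr[OF measurable_glue X]) simp
  also have "\<dots> = emeasure S ?A * emeasure S ?B"
    using A B by (rule P.emeasure_pair_measure_Times)
  also have "emeasure S ?A = (\<Prod>j\<in>e ` (J \<inter> D). emeasure P (F (g j)))"
    using J gF by (intro emeasure_PiM_Collect) auto
  also have "\<dots> = (\<Prod>j\<in>J \<inter> D. emeasure P (F j))"
    unfolding prod.reindex[OF eJ] by (intro prod.cong) (simp_all add: g)
  also have "emeasure S ?B = (\<Prod>j\<in>J - D. emeasure P (F j))"
    using J by (intro emeasure_PiM_Collect) auto
  also have "(\<Prod>j\<in>J \<inter> D. emeasure P (F j)) * (\<Prod>j\<in>J - D. emeasure P (F j)) = (\<Prod>j\<in>J. emeasure P (F j))"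
    by (rule prod.Int_Diff[OF J(1), symmetric])
  finally show "emeasure (distr (S \<Otimes>\<^sub>M S) S ?f) ?X = (\<Prod>j\<in>J. emeasure P (F j))" .
qed simp

sublocale SS: pair_prob_space S S ..

abbreviation E :: "((nat \<Rightarrow> 'b) \<Rightarrow> real) \<Rightarrow> real" where "E f \<equiv> integral\<^sup>L S f"

lemma integrable_glue:
  fixes f :: "(nat \<Rightarrow> 'b) \<Rightarrow> real"
  assumes e: "inj_on e D" and f [measurable]: "integrable S f"
  shows "integrable (S \<Otimes>\<^sub>M S) (\<lambda>(y, w). f (glue D (y \<circ> e) w))"
proof -
  have "integrable (distr (S \<Otimes>\<^sub>M S) S (\<lambda>(y, w). glue D (y \<circ> e) w)) f"
    using f by (simp add: distr_glue[OF e])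
  then show ?thesis by (subst (asm) integrable_distr_eq) (auto simp: case_prod_beta')
qed

text \<open>Conditioning on the coordinates in D; the inner integral is the conditional mean. D =
  UNIV gives invariance under injective relabelling.\<close>

lemma E_glue:
  fixes f :: "(nat \<Rightarrow> 'b) \<Rightarrow> real"
  assumes e: "inj_on e D" and f [measurable]: "integrable S f"
  shows "E f = E (\<lambda>y. E (\<lambda>w. f (glue D (y \<circ> e) w)))"
proof -
  have "E f = integral\<^sup>L (distr (S \<Otimes>\<^sub>M S) S (\<lambda>(y, w). glue D (y \<circ> e) w)) f"
    by (simp add: distr_glue[OF e])
  also have "\<dots> = integral\<^sup>L (S \<Otimes>\<^sub>M S) (\<lambda>(y, w). f (glue D (y \<circ> e) w))"
    using f by (subst integral_distr) (auto simp: case_prod_beta')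
  also have "\<dots> = E (\<lambda>y. E (\<lambda>w. f (glue D (y \<circ> e) w)))"
    using SS.integral_fst'[OF integrable_glue[OF e f]] by simp
  finally show ?thesis .
qed

lemma E_reindex:
  fixes f :: "(nat \<Rightarrow> 'b) \<Rightarrow> real"
  assumes e: "inj e" and f: "integrable S f"
  shows "E (\<lambda>x. f (x \<circ> e)) = E f"
  using E_glue[of e UNIV f] e f by simp

lemma integrable_reindex:
  fixes f :: "(nat \<Rightarrow> 'b) \<Rightarrow> real"
  assumes e: "inj e" and f: "integrable S f"
  shows "integrable S (\<lambda>x. f (x \<circ> e))"
proof -
  have "distr S S (\<lambda>x. x \<circ> e) = S"
    using distr_PiM_reindex[of UNIV "\<lambda>_. P" e UNIV] e by (simp add: M.prob_space_axioms comp_def restrict_def)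
  then have "integrable (distr S S (\<lambda>x. x \<circ> e)) f" using f by simp
  then show ?thesis using f by (subst (asm) integrable_distr_eq) simp_all
qed

lemma integrable_bounded:
  fixes f :: "(nat \<Rightarrow> 'b) \<Rightarrow> real"
  assumes "f \<in> borel_measurable S" "\<And>x. \<bar>f x\<bar> \<le> c"
  shows "integrable S f"
  using assms by (intro P.integrable_const_bound[of _ c]) simp_all

lemma E_bounded:
  fixes f :: "(nat \<Rightarrow> 'b) \<Rightarrow> real"
  assumes "f \<in> borel_measurable S" "\<And>x. \<bar>f x\<bar> \<le> c"
  shows "\<bar>E f\<bar> \<le> c"
proof -
  have "\<bar>E f\<bar> \<le> E (\<lambda>x. \<bar>f x\<bar>)" by (rule integral_abs_bound)
  also have "\<dots> \<le> E (\<lambda>x. c)"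
    using assms(2) integrable_bounded[OF assms] by (intro integral_mono) simp_all
  finally show ?thesis by simp
qed

text \<open>Gluing at D hands the first copy to f and the second to g, so the double integral
  factorizes.\<close>

lemma
  fixes f g :: "(nat \<Rightarrow> 'b) \<Rightarrow> real"
  assumes f: "integrable S f" "depends_on D f" and g: "integrable S g" "depends_on D' g" and D: "D \<inter> D' = {}"
  shows E_mult_indep: "E (\<lambda>x. f x * g x) = E f * E g"
    and integrable_mult_indep: "integrable S (\<lambda>x. f x * g x)"
proof -
  have [measurable]: "f \<in> borel_measurable S" "g \<in> borel_measurable S" using f g by auto
  have eq: "f (glue D y w) = f y" "g (glue D y w) = g w" for y w
    using D by (auto intro!: depends_onD[OF f(2)] depends_onD[OF g(2)] simp: glue_def)
  have d: "distr (S \<Otimes>\<^sub>M S) S (\<lambda>(y, w). glue D y w) = S"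
    using distr_glue[of id D] by simp
  have m: "(\<lambda>(y, w). glue D y w) \<in> S \<Otimes>\<^sub>M S \<rightarrow>\<^sub>M S" using measurable_glue[of D id] by simp
  have "integrable (S \<Otimes>\<^sub>M S) (\<lambda>(y, w). f y * g w)"
  proof (rule SS.Fubini_integrable)
    show "(\<lambda>(y, w). f y * g w) \<in> borel_measurable (S \<Otimes>\<^sub>M S)" by measurable
    show "integrable S (\<lambda>x. E (\<lambda>y. norm (case (x, y) of (y, w) \<Rightarrow> f y * g w)))"
      using f(1) by (simp add: abs_mult)
    show "AE x in S. integrable S (\<lambda>y. case (x, y) of (y, w) \<Rightarrow> f y * g w)"
      using g(1) by simp
  qed
  then have "integrable (distr (S \<Otimes>\<^sub>M S) S (\<lambda>(y, w). glue D y w)) (\<lambda>x. f x * g x)"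
    by (subst integrable_distr_eq[OF m]) (simp_all add: eq case_prod_beta')
  then show i: "integrable S (\<lambda>x. f x * g x)" by (simp add: d)
  show "E (\<lambda>x. f x * g x) = E f * E g"
    using E_glue[of id D, OF inj_on_id i] by (simp add: eq)
qed

lemma distr_coordinate: "distr S P (\<lambda>x. x i) = P"
  by (rule PiM_component) simp

lemma E_coordinate:
  fixes f :: "'b \<Rightarrow> real"
  assumes "integrable P f"
  shows "E (\<lambda>x. f (x i)) = integral\<^sup>L P f" "integrable S (\<lambda>x. f (x i))"
proof -
  have [measurable]: "f \<in> borel_measurable P" using assms by auto
  show "E (\<lambda>x. f (x i)) = integral\<^sup>L P f"
    by (subst distr_coordinate[of i, symmetric], subst integral_distr) auto
  have "integrable (distr S P (\<lambda>x. x i)) f" using assms by (simp add: distr_coordinate)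
  then show "integrable S (\<lambda>x. f (x i))" by (subst (asm) integrable_distr_eq) auto
qed

lemma
  fixes f :: "nat \<Rightarrow> 'b \<Rightarrow> real"
  assumes "finite A" "\<And>i. i \<in> A \<Longrightarrow> integrable P (f i)"
  shows E_prod_coordinates: "E (\<lambda>x. \<Prod>i\<in>A. f i (x i)) = (\<Prod>i\<in>A. integral\<^sup>L P (f i))"
    and integrable_prod_coordinates: "integrable S (\<lambda>x. \<Prod>i\<in>A. f i (x i))"
proof -
  have "E (\<lambda>x. \<Prod>i\<in>A. f i (x i)) = (\<Prod>i\<in>A. integral\<^sup>L P (f i)) \<and> integrable S (\<lambda>x. \<Prod>i\<in>A. f i (x i))"
    using assms
  proof (induction A rule: finite_induct)
    case empty
    then show ?case by simp
  next
    case (insert a A)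
    have d: "depends_on {a} (\<lambda>x. f a (x a))" "depends_on A (\<lambda>x. \<Prod>i\<in>A. f i (x i))"
      by (auto simp: depends_on_def intro!: prod.cong)
    note c = E_coordinate[OF insert.prems[OF insertI1]]
    have IH: "E (\<lambda>x. \<Prod>i\<in>A. f i (x i)) = (\<Prod>i\<in>A. integral\<^sup>L P (f i))" "integrable S (\<lambda>x. \<Prod>i\<in>A. f i (x i))"
      using insert by auto
    show ?case
      using E_mult_indep[OF c(2) d(1) IH(2) d(2)] integrable_mult_indep[OF c(2) d(1) IH(2) d(2)] insert(1,2)
      by (auto simp: c IH)
  qed
  then show "E (\<lambda>x. \<Prod>i\<in>A. f i (x i)) = (\<Prod>i\<in>A. integral\<^sup>L P (f i))"
    "integrable S (\<lambda>x. \<Prod>i\<in>A. f i (x i))" by auto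
qed

end

section \<open>Alternating sums and mixed differences\<close>

definition alt_sum :: "nat set \<Rightarrow> (nat set \<Rightarrow> real) \<Rightarrow> real" where
  "alt_sum A G = (\<Sum>C\<in>Pow A. (- 1) ^ card (A - C) * G C)"

lemma alt_sum_empty [simp]: "alt_sum {} G = G {}"
  by (simp add: alt_sum_def)

text \<open>Each new index takes one more difference. Thus \<open>alt_sum\<close> is at the same
  time Moebius inversion over subsets and an iterated difference operator.\<close>

lemma alt_sum_insert:
  assumes "finite A" "a \<notin> A"
  shows "alt_sum (insert a A) G = alt_sum A (\<lambda>C. G (insert a C)) - alt_sum A G"
proof -
  have inj: "inj_on (insert a) (Pow A)" using assms(2) by (auto intro!: inj_onI)
  have disj: "Pow A \<inter> insert a ` Pow A = {}" using assms(2) by auto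
  have 1: "(- 1) ^ card (insert a A - C) * G C = - ((- 1) ^ card (A - C) * G C)" if "C \<in> Pow A" for C
  proof -
    have "insert a A - C = insert a (A - C)" using that assms(2) by auto
    then show ?thesis using assms by simp
  qed
  have 2: "insert a A - insert a C = A - C" for C using assms(2) by auto
  have "alt_sum (insert a A) G = (\<Sum>C\<in>Pow A. (- 1) ^ card (insert a A - C) * G C)
      + (\<Sum>C\<in>Pow A. (- 1) ^ card (A - C) * G (insert a C))"
    unfolding alt_sum_def Pow_insert using inj disj assms
    by (subst sum.union_disjoint) (auto simp: sum.reindex 2)
  also have "(\<Sum>C\<in>Pow A. (- 1) ^ card (insert a A - C) * G C) = - alt_sum A G"
    unfolding alt_sum_def sum_negf[symmetric] by (intro sum.cong refl 1)
  finally show ?thesis by (simp add: alt_sum_def)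
qed

lemma alt_sum_cong: "(\<And>C. C \<subseteq> A \<Longrightarrow> G C = H C) \<Longrightarrow> alt_sum A G = alt_sum A H"
  unfolding alt_sum_def by (intro sum.cong) auto

lemma mixed_partial_Suc:
  "i \<le> j \<Longrightarrow> mixed_partial i j f = partial_deriv i (mixed_partial (Suc i) j f)"
  unfolding mixed_partial_def by (subst upt_conv_Cons) auto

lemma mixed_partial_empty: "j < i \<Longrightarrow> mixed_partial i j f = f"
  by (simp add: mixed_partial_def)

text \<open>Derivatives are traded for differences one variable at a time: the function is already
  differentiated in the variables i+1 to j, and each new difference becomes one further derivative
  times the increment.\<close>

lemma alt_sum_mixed_partial_le:
  assumes ex: "mixed_partials_exist j f" and D: "\<And>x. \<bar>mixed_partial 1 j f x\<bar> \<le> D" and "i \<le> j"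
  shows "\<bar>alt_sum {1..i} (\<lambda>C. mixed_partial (Suc i) j f (glue C x y))\<bar> \<le> D * (\<Prod>l=1..i. \<bar>x l - y l\<bar>)"
  using \<open>i \<le> j\<close>
proof (induction i arbitrary: x y)
  case 0
  then show ?case using D by simp
next
  case (Suc i)
  let ?a = "Suc i" and ?g = "mixed_partial (Suc (Suc i)) j f"
  \<comment> \<open>The other i differences are frozen while variable i+1 runs from y to x; the mean
    value inequality is applied to this function.\<close>
  define \<phi> where "\<phi> s = alt_sum {1..i} (\<lambda>C. ?g ((glue C x y)(?a := s)))" for s
  define B where "B = D * (\<Prod>l=1..i. \<bar>x l - y l\<bar>)"
  have ins: "{1..Suc i} = insert ?a {1..i}" by auto
  have eq: "alt_sum {1..Suc i} (\<lambda>C. ?g (glue C x y)) = \<phi> (x ?a) - \<phi> (y ?a)"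
    unfolding ins \<phi>_def
    by (subst alt_sum_insert)
       (auto intro!: arg_cong2[where f="(-)"] alt_sum_cong arg_cong[where f="?g"] simp: glue_def fun_eq_iff)
  have der: "(\<phi> has_field_derivative alt_sum {1..i} (\<lambda>C. mixed_partial ?a j f ((glue C x y)(?a := s)))) (at s)" for s
    unfolding \<phi>_def alt_sum_def
  proof (intro DERIV_sum DERIV_cmult)
    fix C
    let ?p = "(glue C x y)(?a := s)"
    have "(\<lambda>s. ?g (?p(?a := s))) field_differentiable at (?p ?a)"
      using Suc.prems by (intro ex[unfolded mixed_partials_exist_def, rule_format]) simp
    then have "((\<lambda>s. ?g (?p(?a := s))) has_field_derivative deriv (\<lambda>s. ?g (?p(?a := s))) (?p ?a)) (at (?p ?a))"
      by (simp add: DERIV_deriv_iff_field_differentiable)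
    moreover have "deriv (\<lambda>s. ?g (?p(?a := s))) (?p ?a) = mixed_partial ?a j f ?p"
      unfolding mixed_partial_Suc[OF Suc.prems] partial_deriv_def ..
    ultimately show "((\<lambda>s. ?g ((glue C x y)(?a := s))) has_field_derivative mixed_partial ?a j f ?p) (at s)"
      by simp
  qed
  have bound: "norm (alt_sum {1..i} (\<lambda>C. mixed_partial ?a j f ((glue C x y)(?a := s)))) \<le> B" for s
  proof -
    have "(glue C x y)(?a := s) = glue C (x(?a := s)) (y(?a := s))" for C
      by (auto simp: glue_def fun_eq_iff)
    moreover have "(\<Prod>l=1..i. \<bar>(x(?a := s)) l - (y(?a := s)) l\<bar>) = (\<Prod>l=1..i. \<bar>x l - y l\<bar>)"
      by (intro prod.cong) auto
    ultimately show ?thesis using Suc.IH[of "x(?a := s)" "y(?a := s)"] Suc.prems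
      by (simp only: B_def real_norm_def Suc_leD)
  qed
  have "norm (\<phi> (x ?a) - \<phi> (y ?a)) \<le> B * norm (x ?a - y ?a)"
    by (rule field_differentiable_bound[of UNIV \<phi>, OF _ der bound]) auto
  then show ?case unfolding eq by (simp add: B_def prod.nat_ivl_Suc' mult_ac)
qed

lemma alt_sum_diff_le:
  assumes "mixed_partials_exist j f" "\<And>x. \<bar>mixed_partial 1 j f x\<bar> \<le> D"
  shows "\<bar>alt_sum {1..j} (\<lambda>C. f (glue C x y))\<bar> \<le> D * (\<Prod>l=1..j. \<bar>x l - y l\<bar>)"
  using alt_sum_mixed_partial_le[OF assms order_refl] by (simp add: mixed_partial_empty)

section \<open>Hoeffding projections and their symmetrization\<close>

text \<open>Moebius inversion on the subset lattice; it yields the Hoeffding decomposition.\<close>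

lemma sum_alt_sum: "finite J \<Longrightarrow> (\<Sum>I\<in>Pow J. alt_sum I G) = G J"
proof (induction J arbitrary: G rule: finite_induct)
  case empty then show ?case by simp
next
  case (insert a J)
  have inj: "inj_on (insert a) (Pow J)" using insert(2) by (auto intro!: inj_onI)
  have disj: "Pow J \<inter> insert a ` Pow J = {}" using insert(2) by auto
  have "(\<Sum>I\<in>Pow (insert a J). alt_sum I G) = (\<Sum>I\<in>Pow J. alt_sum I G) + (\<Sum>I\<in>Pow J. alt_sum (insert a I) G)"
    unfolding Pow_insert using inj disj insert by (subst sum.union_disjoint) (auto simp: sum.reindex)
  also have "(\<Sum>I\<in>Pow J. alt_sum (insert a I) G) = (\<Sum>I\<in>Pow J. alt_sum I (\<lambda>C. G (insert a C)) - alt_sum I G)"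
    using insert by (intro sum.cong alt_sum_insert) (auto intro: finite_subset)
  also have "\<dots> = G (insert a J) - G J" by (simp add: sum_subtractf insert.IH)
  finally show ?case by (simp add: insert.IH)
qed

text \<open>The sets with and without a cancel in pairs.\<close>

lemma alt_sum_eq_0:
  assumes "finite A" "a \<in> A" "\<And>C. C \<subseteq> A - {a} \<Longrightarrow> G (insert a C) = G C"
  shows "alt_sum A G = 0"
proof -
  have A: "A = insert a (A - {a})" using assms by auto
  have "alt_sum (A - {a}) (\<lambda>C. G (insert a C)) = alt_sum (A - {a}) G"
    by (rule alt_sum_cong) (rule assms)
  then show ?thesis using assms(1) by (subst A, subst alt_sum_insert) auto
qed

lemma alt_sum_image:
  assumes "inj_on e A" shows "alt_sum (e ` A) G = alt_sum A (\<lambda>C. G (e ` C))"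
proof -
  have "bij_betw ((`) e) (Pow A) (Pow (e ` A))"
    by (rule bij_betw_Pow) (use assms in \<open>simp add: bij_betw_def\<close>)
  then have "alt_sum (e ` A) G = (\<Sum>C\<in>Pow A. (- 1) ^ card (e ` A - e ` C) * G (e ` C))"
    unfolding alt_sum_def by (rule sum.reindex_bij_betw[symmetric])
  also have "\<dots> = (\<Sum>C\<in>Pow A. (- 1) ^ card (A - C) * G (e ` C))"
  proof (intro sum.cong refl)
    fix C assume C: "C \<in> Pow A"
    have "e ` A - e ` C = e ` (A - C)" using inj_on_image_set_diff[OF assms, of A C] C by auto
    then have "card (e ` A - e ` C) = card (A - C)"
      using assms by (simp add: card_image inj_on_diff)
    then show "(- 1) ^ card (e ` A - e ` C) * G (e ` C) = (- 1) ^ card (A - C) * G (e ` C)" by simp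
  qed
  finally show ?thesis by (simp add: alt_sum_def)
qed

lemma abs_alt_sum_le:
  assumes "finite A" "\<And>C. C \<subseteq> A \<Longrightarrow> \<bar>G C\<bar> \<le> B"
  shows "\<bar>alt_sum A G\<bar> \<le> 2 ^ card A * B"
proof -
  have "\<bar>alt_sum A G\<bar> \<le> (\<Sum>C\<in>Pow A. \<bar>(- 1) ^ card (A - C) * G C\<bar>)"
    unfolding alt_sum_def by (rule sum_abs)
  also have "\<dots> \<le> (\<Sum>C\<in>Pow A. B)" using assms by (intro sum_mono) (auto simp: abs_mult)
  finally show ?thesis using assms(1) by (simp add: card_Pow)
qed

lemma alt_sum_add: "alt_sum A (\<lambda>C. \<Sum>i\<in>I. G i C) = (\<Sum>i\<in>I. alt_sum A (G i))"
  unfolding alt_sum_def sum_distrib_left by (rule sum.swap)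

lemma alt_sum_square_le:
  assumes "finite A"
  shows "(alt_sum A G)\<^sup>2 \<le> 2 ^ card A * (\<Sum>C\<in>Pow A. (G C)\<^sup>2)"
proof -
  have "(alt_sum A G)\<^sup>2 \<le> (\<Sum>C\<in>Pow A. ((- 1) ^ card (A - C))\<^sup>2) * (\<Sum>C\<in>Pow A. (G C)\<^sup>2)"
    unfolding alt_sum_def by (rule Cauchy_Schwarz_ineq_sum)
  moreover have "((- 1 :: real) ^ n)\<^sup>2 = 1" for n
    by (simp add: power2_eq_square power_mult_distrib[symmetric])
  ultimately show ?thesis using assms by (simp add: card_Pow)
qed

text \<open>Two independent samples are interleaved in one sequence, so that exchanging or mixing
  them becomes a relabelling of coordinates, under which \<open>S\<close> is invariant.\<close>

definition even_part :: "(nat \<Rightarrow> 'b) \<Rightarrow> nat \<Rightarrow> 'b" where "even_part z i = z (2 * i)"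
definition odd_part :: "(nat \<Rightarrow> 'b) \<Rightarrow> nat \<Rightarrow> 'b" where "odd_part z i = z (2 * i + 1)"

context iid_seq
begin

lemma measurable_even_odd [measurable (raw)]:
  assumes "f \<in> N \<rightarrow>\<^sub>M S"
  shows "(\<lambda>z. even_part (f z)) \<in> N \<rightarrow>\<^sub>M S" "(\<lambda>z. odd_part (f z)) \<in> N \<rightarrow>\<^sub>M S"
  using measurable_reindex[OF assms, of "\<lambda>i. 2 * i"] measurable_reindex[OF assms, of "\<lambda>i. 2 * i + 1"]
  by (simp_all add: even_part_def[abs_def] odd_part_def[abs_def] comp_def)

lemma pair_as_single:
  fixes f :: "(nat \<Rightarrow> 'b) \<Rightarrow> (nat \<Rightarrow> 'b) \<Rightarrow> real"
  assumes f: "(\<lambda>(x, y). f x y) \<in> borel_measurable (S \<Otimes>\<^sub>M S)" "\<And>x y. \<bar>f x y\<bar> \<le> b"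
  shows "E (\<lambda>x. E (\<lambda>y. f x y)) = E (\<lambda>z. f (even_part z) (odd_part z))"
proof -
  let ?D = "{i::nat. even i}"
  have m [measurable]: "(\<lambda>z. f (g z) (h z)) \<in> borel_measurable N" if "g \<in> N \<rightarrow>\<^sub>M S" "h \<in> N \<rightarrow>\<^sub>M S" for g h N
    using measurable_compose[OF measurable_Pair[OF that] f(1)] by simp
  have ev: "even_part (glue ?D x w) = even_part x" and od: "odd_part (glue ?D x w) = odd_part w" for x w :: "nat \<Rightarrow> 'b"
    by (auto simp: even_part_def odd_part_def glue_def fun_eq_iff)
  have "E (\<lambda>z. f (even_part z) (odd_part z)) = E (\<lambda>x. E (\<lambda>w. f (even_part x) (odd_part w)))"
    using E_glue[of id ?D "\<lambda>z. f (even_part z) (odd_part z)"] f(2)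
    by (simp add: ev od integrable_bounded[of _ b])
  also have "\<dots> = E (\<lambda>x. E (\<lambda>y. f (even_part x) y))"
  proof (rule Bochner_Integration.integral_cong[OF refl])
    fix x
    have o: "odd_part w = w \<circ> (\<lambda>i. 2 * i + 1)" for w :: "nat \<Rightarrow> 'b" by (auto simp: odd_part_def fun_eq_iff)
    show "E (\<lambda>w. f (even_part x) (odd_part w)) = E (\<lambda>y. f (even_part x) y)"
      unfolding o using f(2) by (intro E_reindex integrable_bounded[of _ b]) (auto simp: inj_def)
  qed
  also have "\<dots> = E (\<lambda>x. E (\<lambda>y. f x y))"
  proof -
    have e: "even_part = (\<lambda>w :: nat \<Rightarrow> 'b. w \<circ> (\<lambda>i. 2 * i))" by (auto simp: even_part_def fun_eq_iff)
    have "\<bar>E (\<lambda>y. f x y)\<bar> \<le> b" for x by (rule E_bounded) (use f in auto)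
    moreover have "(\<lambda>x. E (\<lambda>y. f x y)) \<in> borel_measurable S"
      using f(1) by (rule P.borel_measurable_lebesgue_integral)
    ultimately show ?thesis unfolding e
      by (intro E_reindex) (auto simp: inj_def intro: integrable_bounded[of _ b])
  qed
  finally show ?thesis ..
qed

text \<open>Integrating coordinate a first leaves g untouched and annihilates f.\<close>

lemma E_degenerate_mult:
  fixes f g :: "(nat \<Rightarrow> 'b) \<Rightarrow> real"
  assumes f: "f \<in> borel_measurable S" "\<And>x. \<bar>f x\<bar> \<le> b" and g: "g \<in> borel_measurable S" "\<And>x. \<bar>g x\<bar> \<le> c"
    and deg: "\<And>x. E (\<lambda>y. f (x(a := y a))) = 0" and dep: "depends_on (- {a}) g"
  shows "E (\<lambda>x. f x * g x) = 0"
proof -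
  have gl: "glue (- {a}) x y = x(a := y a)" for x y :: "nat \<Rightarrow> 'b" by (auto simp: glue_def fun_eq_iff)
  have eq: "g (x(a := y a)) = g x" for x y by (rule depends_onD[OF dep]) auto
  have "\<bar>f x * g x\<bar> \<le> b * c" for x
    unfolding abs_mult using f(2)[of x] g(2)[of x] by (intro mult_mono) auto
  then have "integrable S (\<lambda>x. f x * g x)" using f(1) g(1) by (intro integrable_bounded[of _ "b * c"]) auto
  from E_glue[OF inj_on_id this, of "- {a}"] show ?thesis
    by (simp add: gl eq deg)
qed

end

text \<open>F A stands for the conditional mean of a bounded kernel given the coordinates in A.
  \<open>F_reindex\<close> expresses symmetry, \<open>F_average\<close> the tower property and
  \<open>F_empty\<close> the centring.\<close>

locale sym_kernel = iid_seq P for P :: "'b measure" +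
  fixes F :: "nat set \<Rightarrow> (nat \<Rightarrow> 'b) \<Rightarrow> real" and m :: nat and B :: real
  assumes F_measurable: "finite A \<Longrightarrow> card A \<le> m \<Longrightarrow> F A \<in> borel_measurable S"
    and F_bounded: "finite A \<Longrightarrow> card A \<le> m \<Longrightarrow> \<bar>F A x\<bar> \<le> B"
    and F_depends: "finite A \<Longrightarrow> card A \<le> m \<Longrightarrow> depends_on A (F A)"
    and F_reindex: "finite A \<Longrightarrow> card A \<le> m \<Longrightarrow> inj_on e A \<Longrightarrow> F (e ` A) x = F A (x \<circ> e)"
    and F_average: "finite A \<Longrightarrow> card A \<le> m \<Longrightarrow> C \<subseteq> A \<Longrightarrow> E (\<lambda>y. F A (glue C x y)) = F C x"
    and F_empty: "F {} x = 0"
begin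

lemma B_nonneg: "0 \<le> B"
  using F_bounded[of "{}"] by (metis abs_ge_zero card.empty finite.emptyI le0 order_trans)

text \<open>Hoeffding's projection of degree |A|, as the Moebius inverse of the conditional
  means.\<close>

definition proj :: "nat set \<Rightarrow> (nat \<Rightarrow> 'b) \<Rightarrow> real" where
  "proj A x = alt_sum A (\<lambda>C. F C x)"

text \<open>The kernel symmetrized by an independent copy. It changes sign when the two samples are
  exchanged in one coordinate of A, and a bound on the mixed derivative controls it.\<close>

definition symd :: "nat set \<Rightarrow> (nat \<Rightarrow> 'b) \<Rightarrow> (nat \<Rightarrow> 'b) \<Rightarrow> real" where
  "symd A x y = alt_sum A (\<lambda>C. F A (glue C x y))"

context
  fixes A :: "nat set" assumes A: "finite A" "card A \<le> m"
begin

lemma sub: "C \<subseteq> A \<Longrightarrow> finite C" "C \<subseteq> A \<Longrightarrow> card C \<le> m"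
  using A card_mono[OF A(1)] by (auto intro: finite_subset le_trans)

lemma proj_measurable: "proj A \<in> borel_measurable S"
  unfolding proj_def[abs_def] alt_sum_def
  using F_measurable sub by (intro borel_measurable_sum borel_measurable_times) auto

lemma symd_measurable:
  assumes [measurable]: "g \<in> N \<rightarrow>\<^sub>M S" "h \<in> N \<rightarrow>\<^sub>M S"
  shows "(\<lambda>z. symd A (g z) (h z)) \<in> borel_measurable N"
  unfolding symd_def alt_sum_def
  using measurable_compose[OF measurable_glue''[OF assms] F_measurable[OF A]]
  by (intro borel_measurable_sum borel_measurable_times) auto

lemma proj_bounded: "\<bar>proj A x\<bar> \<le> 2 ^ card A * B"
  unfolding proj_def using F_bounded sub by (intro abs_alt_sum_le A) auto

lemma symd_bounded: "\<bar>symd A x y\<bar> \<le> 2 ^ card A * B"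
  unfolding symd_def using F_bounded A by (intro abs_alt_sum_le A) auto

lemma proj_depends: "depends_on A (proj A)"
proof (rule depends_onI)
  fix x y :: "nat \<Rightarrow> 'b" assume "\<And>i. i \<in> A \<Longrightarrow> x i = y i"
  then show "proj A x = proj A y" unfolding proj_def
    by (intro alt_sum_cong depends_onD[OF F_depends]) (auto simp: sub)
qed

lemma symd_cong:
  assumes "\<And>i. i \<in> A \<Longrightarrow> x i = x' i" "\<And>i. i \<in> A \<Longrightarrow> y i = y' i"
  shows "symd A x y = symd A x' y'"
  unfolding symd_def using assms
  by (intro alt_sum_cong depends_onD[OF F_depends] A) (auto simp: glue_def)

lemma proj_reindex: "inj_on e A \<Longrightarrow> proj (e ` A) x = proj A (x \<circ> e)"
  unfolding proj_def
  by (subst alt_sum_image) (auto intro!: alt_sum_cong F_reindex sub intro: inj_on_subset)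

lemma symd_reindex: "inj e \<Longrightarrow> symd (e ` A) x y = symd A (x \<circ> e) (y \<circ> e)"
proof -
  assume e: "inj e"
  then have eA: "inj_on e A" by (rule inj_on_subset) simp
  have "glue (e ` C) x y \<circ> e = glue C (x \<circ> e) (y \<circ> e)" for C
    using e by (auto simp: glue_def fun_eq_iff inj_image_mem_iff)
  then show ?thesis unfolding symd_def alt_sum_image[OF eA] by (simp add: F_reindex[OF A eA])
qed

text \<open>By the tower property, integrating a turns F (insert a C) into F C, so the sets with and
  without a cancel.\<close>

lemma proj_degenerate:
  assumes a: "a \<in> A"
  shows "E (\<lambda>y. proj A (x(a := y a))) = 0"
proof -
  let ?A = "A - {a}"
  have A': "A = insert a ?A" using a by auto
  have int: "integrable S (\<lambda>y. F C (x(a := y a)))" if "C \<subseteq> A" for C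
  proof -
    have "(\<lambda>y. glue (- {a}) x y) \<in> S \<rightarrow>\<^sub>M S" by (intro measurable_glue'') auto
    moreover have "glue (- {a}) x y = x(a := y a)" for y :: "nat \<Rightarrow> 'b" by (auto simp: glue_def fun_eq_iff)
    ultimately have "(\<lambda>y. x(a := y a)) \<in> S \<rightarrow>\<^sub>M S" by simp
    from measurable_compose[OF this F_measurable[OF sub[OF that]]] show ?thesis
      using F_bounded[OF sub[OF that]] by (intro integrable_bounded[of _ B]) auto
  qed
  have 1: "E (\<lambda>y. F (insert a C) (x(a := y a))) = F C x" if "C \<subseteq> ?A" for C
  proof -
    have s: "insert a C \<subseteq> A" using that a by auto
    have "F (insert a C) (x(a := y a)) = F (insert a C) (glue C x y)" for y
      by (rule depends_onD[OF F_depends[OF sub[OF s]]]) (use that in \<open>auto simp: glue_def\<close>)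
    then show ?thesis using F_average[OF sub[OF s], of C x] by auto
  qed
  have 2: "F C (x(a := y a)) = F C x" if "C \<subseteq> ?A" for C y
    by (rule depends_onD[OF F_depends[OF sub]]) (use that in auto)
  have "proj A (x(a := y a)) = (\<Sum>C\<in>Pow ?A. (- 1) ^ card (?A - C) * (F (insert a C) (x(a := y a)) - F C x))" for y
    unfolding proj_def
    by (subst A', subst alt_sum_insert)
       (use A 2 in \<open>auto simp: alt_sum_def sum_subtractf right_diff_distrib intro!: sum.cong\<close>)
  then have "E (\<lambda>y. proj A (x(a := y a))) = E (\<lambda>y. \<Sum>C\<in>Pow ?A. (- 1) ^ card (?A - C) * (F (insert a C) (x(a := y a)) - F C x))"
    by simp
  also have "\<dots> = (\<Sum>C\<in>Pow ?A. E (\<lambda>y. (- 1) ^ card (?A - C) * (F (insert a C) (x(a := y a)) - F C x)))"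
    using a by (intro Bochner_Integration.integral_sum integrable_mult_right Bochner_Integration.integrable_diff int) auto
  also have "\<dots> = 0"
  proof (rule sum.neutral, rule ballI)
    fix C assume "C \<in> Pow ?A"
    then have C: "C \<subseteq> ?A" "insert a C \<subseteq> A" using a by auto
    show "E (\<lambda>y. (- 1) ^ card (?A - C) * (F (insert a C) (x(a := y a)) - F C x)) = 0"
      using int[OF C(2)] by (simp add: 1[OF C(1)] Bochner_Integration.integral_diff)
  qed
  finally show ?thesis .
qed

lemma F_eq_sum_proj: "F A x = (\<Sum>I\<in>Pow A. proj I x)"
  unfolding proj_def using sum_alt_sum[OF A(1), of "\<lambda>C. F C x"] by simp

text \<open>Averaging over the second sample replaces F A at a glued point by F C, again by the
  tower property.\<close>

lemma proj_eq_E_symd: "proj A x = E (\<lambda>y. symd A x y)"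
proof -
  have "integrable S (\<lambda>y. F A (glue C x y))" for C
  proof -
    have "(\<lambda>y. glue C x y) \<in> S \<rightarrow>\<^sub>M S" by (intro measurable_glue'') auto
    from measurable_compose[OF this F_measurable[OF A]] show ?thesis
      using F_bounded[OF A] by (intro integrable_bounded[of _ B]) auto
  qed
  then have "E (\<lambda>y. symd A x y) = (\<Sum>C\<in>Pow A. (- 1) ^ card (A - C) * E (\<lambda>y. F A (glue C x y)))"
    unfolding symd_def alt_sum_def by (subst Bochner_Integration.integral_sum) auto
  also have "\<dots> = (\<Sum>C\<in>Pow A. (- 1) ^ card (A - C) * F C x)"
    by (intro sum.cong) (auto simp: F_average A)
  finally show ?thesis by (simp add: proj_def alt_sum_def)
qed

text \<open>Projections of smaller sets ignore some index of A, so their mixed differences vanish.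
  Hence the size of the symmetrized kernel is that of the top projection, not of F A.\<close>

lemma symd_eq_proj: "symd A x y = alt_sum A (\<lambda>C. proj A (glue C x y))"
proof -
  have "alt_sum A (\<lambda>C. proj I (glue C x y)) = 0" if I: "I \<in> Pow A - {A}" for I
  proof -
    obtain a where a: "a \<in> A" "a \<notin> I" using I by auto
    have fI: "finite I" "card I \<le> m" using I sub[of I] by auto
    have "proj I (glue (insert a C) x y) = proj I (glue C x y)" for C
    proof -
      have "proj I = (\<lambda>x. alt_sum I (\<lambda>C. F C x))" by (simp add: proj_def fun_eq_iff)
      moreover have "alt_sum I (\<lambda>C'. F C' (glue (insert a C) x y)) = alt_sum I (\<lambda>C'. F C' (glue C x y))"
        by (intro alt_sum_cong depends_onD[OF F_depends] sub)
           (use I a in \<open>auto simp: glue_def\<close>)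
      ultimately show ?thesis by simp
    qed
    then show ?thesis using A(1) a by (intro alt_sum_eq_0[of A a]) auto
  qed
  moreover have "symd A x y = (\<Sum>I\<in>Pow A. alt_sum A (\<lambda>C. proj I (glue C x y)))"
    unfolding symd_def F_eq_sum_proj by (rule alt_sum_add)
  ultimately show ?thesis using A(1)
    by (subst (asm) sum.remove[of _ A]) (auto simp: sum.neutral)
qed

text \<open>Exchanging the samples on \<epsilon> replaces C by its symmetric difference with A
  \<inter> \<epsilon>, an involution that changes the parity of |A - C| by that of |A \<inter>
  \<epsilon>|.\<close>

lemma symd_swap: "symd A (glue \<epsilon> y x) (glue \<epsilon> x y) = (- 1) ^ card (A \<inter> \<epsilon>) * symd A x y"
proof -
  define G where "G C = F A (glue C x y)" for C
  have "symd A (glue \<epsilon> y x) (glue \<epsilon> x y) = alt_sum A (\<lambda>C. G ((C - \<epsilon>) \<union> (A \<inter> \<epsilon> - C)))"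
    unfolding symd_def G_def
    by (intro alt_sum_cong depends_onD[OF F_depends] A) (auto simp: glue_def)
  also have "\<dots> = (\<Sum>C\<in>Pow A. (- 1) ^ card (A - ((C - \<epsilon>) \<union> (A \<inter> \<epsilon> - C))) * G C)"
    unfolding alt_sum_def
    by (rule sum.reindex_bij_witness[of _ "\<lambda>C. (C - \<epsilon>) \<union> (A \<inter> \<epsilon> - C)" "\<lambda>C. (C - \<epsilon>) \<union> (A \<inter> \<epsilon> - C)"])
      (auto intro!: arg_cong2[where f="(*)"] arg_cong[where f=card] arg_cong[where f=G] arg_cong2[where f="(^)"])
  also have "\<dots> = (\<Sum>C\<in>Pow A. (- 1) ^ card (A \<inter> \<epsilon>) * ((- 1) ^ card (A - C) * G C))"
  proof (intro sum.cong refl)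
    fix C assume C: "C \<in> Pow A"
    have f: "finite (A - C - \<epsilon>)" "finite (A \<inter> \<epsilon> \<inter> C)" "finite (A \<inter> \<epsilon> - C)" using A by auto
    have 1: "A - ((C - \<epsilon>) \<union> (A \<inter> \<epsilon> - C)) = (A - C - \<epsilon>) \<union> (A \<inter> \<epsilon> \<inter> C)" by auto
    have 2: "A - C = (A - C - \<epsilon>) \<union> (A \<inter> \<epsilon> - C)" by auto
    have 3: "A \<inter> \<epsilon> = (A \<inter> \<epsilon> \<inter> C) \<union> (A \<inter> \<epsilon> - C)" by auto
    have c1: "card (A - ((C - \<epsilon>) \<union> (A \<inter> \<epsilon> - C))) = card (A - C - \<epsilon>) + card (A \<inter> \<epsilon> \<inter> C)"
      unfolding 1 using f by (intro card_Un_disjoint) auto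
    have c2: "card (A - C) = card (A - C - \<epsilon>) + card (A \<inter> \<epsilon> - C)"
      by (subst 2) (use f in \<open>intro card_Un_disjoint; auto\<close>)
    have c3: "card (A \<inter> \<epsilon>) = card (A \<inter> \<epsilon> \<inter> C) + card (A \<inter> \<epsilon> - C)"
      by (subst 3) (use f in \<open>intro card_Un_disjoint; auto\<close>)
    have "(- 1 :: real) ^ card (A \<inter> \<epsilon> - C) * (- 1) ^ card (A \<inter> \<epsilon> - C) = 1"
      by (simp add: power_mult_distrib[symmetric])
    then show "(- 1) ^ card (A - ((C - \<epsilon>) \<union> (A \<inter> \<epsilon> - C))) * G C = (- 1) ^ card (A \<inter> \<epsilon>) * ((- 1) ^ card (A - C) * G C)"
      unfolding c1 c2 c3 power_add by (simp add: mult_ac)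
  qed
  finally show ?thesis by (simp add: symd_def alt_sum_def G_def sum_distrib_left)
qed

end

end

section \<open>Orthogonality and the Hoeffding decomposition\<close>

text \<open>Each step multiplies the ratio by (m-j)/(N-j), which is at most m/N.\<close>

lemma binomial_ratio_le:
  assumes "m \<le> N" "N > 0"
  shows "real (m choose j) / real (N choose j) \<le> (real m / real N) ^ j"
proof (induction j)
  case 0 then show ?case by simp
next
  case (Suc j)
  have step: "real (n choose Suc j) = real (n choose j) * (real n - real j) / (real j + 1)" if "j \<le> n" for n
  proof -
    have "real (Suc j * (n choose Suc j)) = real ((n - j) * (n choose j))"
      using binomial_absorb_comp[of n j] binomial_absorption[of j n]
      by (metis Suc_times_binomial_eq Suc_times_binomial binomial_absorb_comp mult.commute times_binomial_minus1_eq)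
    then show ?thesis using that by (simp add: of_nat_diff field_simps)
  qed
  show ?case
  proof (cases "j < m")
    case True
    then have "real (m choose Suc j) / real (N choose Suc j)
      = (real (m choose j) / real (N choose j)) * ((real m - real j) / (real N - real j))"
      using assms by (simp add: step)
    also have "\<dots> \<le> (real m / real N) ^ j * (real m / real N)"
    proof (intro mult_mono Suc.IH)
      show "(real m - real j) / (real N - real j) \<le> real m / real N"
        using True assms by (auto simp: divide_simps algebra_simps intro: mult_left_mono[of "real m" "real N" "real j", simplified mult.commute])
    qed (use True assms in auto)
    finally show ?thesis by (simp add: mult.commute)
  qed (simp add: binomial_eq_0)
qed

lemma card_supersets:
  assumes "finite A" "I \<subseteq> A" "card I \<le> m"
  shows "card {J. I \<subseteq> J \<and> J \<subseteq> A \<and> card J = m} = (card A - card I) choose (m - card I)"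
proof -
  have fI: "finite I" using assms by (auto intro: finite_subset)
  have "bij_betw (\<lambda>J. J - I) {J. I \<subseteq> J \<and> J \<subseteq> A \<and> card J = m} {J. J \<subseteq> A - I \<and> card J = m - card I}"
  proof (rule bij_betwI[where g="\<lambda>J. J \<union> I"])
    show "(\<lambda>J. J - I) \<in> {J. I \<subseteq> J \<and> J \<subseteq> A \<and> card J = m} \<rightarrow> {J. J \<subseteq> A - I \<and> card J = m - card I}"
      using fI by (auto simp: card_Diff_subset)
    show "(\<lambda>J. J \<union> I) \<in> {J. J \<subseteq> A - I \<and> card J = m - card I} \<rightarrow> {J. I \<subseteq> J \<and> J \<subseteq> A \<and> card J = m}"
    proof
      fix J assume J: "J \<in> {J. J \<subseteq> A - I \<and> card J = m - card I}"
      then have "finite J" using assms(1) by (auto intro: finite_subset)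
      then have "card (J \<union> I) = card J + card I" using J fI by (intro card_Un_disjoint) auto
      then show "J \<union> I \<in> {J. I \<subseteq> J \<and> J \<subseteq> A \<and> card J = m}" using J assms by auto
    qed
  qed auto
  then have "card {J. I \<subseteq> J \<and> J \<subseteq> A \<and> card J = m} = card {J. J \<subseteq> A - I \<and> card J = m - card I}"
    by (rule bij_betw_same_card)
  also have "\<dots> = card (A - I) choose (m - card I)" using assms by (intro n_subsets) auto
  finally show ?thesis using assms fI by (simp add: card_Diff_subset)
qed

lemma sum_by_card:
  fixes g :: "nat set \<Rightarrow> real"
  assumes "finite A" "K \<subseteq> {..m}"
  shows "(\<Sum>I | I \<subseteq> A \<and> card I \<in> K. g I) = (\<Sum>j\<in>K. \<Sum>I | I \<subseteq> A \<and> card I = j. g I)"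
proof -
  have "finite K" using assms(2) by (rule finite_subset) simp
  then have "(\<Sum>j\<in>K. sum g {I \<in> {I. I \<subseteq> A \<and> card I \<in> K}. card I = j}) = sum g {I. I \<subseteq> A \<and> card I \<in> K}"
    using assms by (intro sum.group) auto
  moreover have "{I \<in> {I. I \<subseteq> A \<and> card I \<in> K}. card I = j} = {I. I \<subseteq> A \<and> card I = j}" if "j \<in> K" for j
    using that by auto
  ultimately show ?thesis by (simp cong: sum.cong)
qed

context sym_kernel
begin

text \<open>By symmetry the second moment depends only on the size of the set, and {1..j} is the
  representative.\<close>

definition msq :: "nat \<Rightarrow> real" where
  "msq j = E (\<lambda>x. (proj {1..j} x)\<^sup>2)"

lemma msq_nonneg: "0 \<le> msq j"
  unfolding msq_def by (intro integral_nonneg_AE) auto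

lemma proj_mult_integrable:
  assumes A: "finite A" "card A \<le> m" and C: "finite C" "card C \<le> m"
  shows "integrable S (\<lambda>x. proj A x * proj C x)"
proof (rule integrable_bounded)
  show "\<bar>proj A x * proj C x\<bar> \<le> (2 ^ card A * B) * (2 ^ card C * B)" for x
    unfolding abs_mult using proj_bounded[OF A, of x] proj_bounded[OF C, of x] B_nonneg
    by (intro mult_mono) auto
qed (use proj_measurable[OF A] proj_measurable[OF C] in measurable)

text \<open>Some index lies in only one of the two sets; integrating it out annihilates that
  projection.\<close>

lemma proj_orthogonal:
  assumes A: "finite A" "card A \<le> m" and C: "finite C" "card C \<le> m" and AC: "A \<noteq> C"
  shows "E (\<lambda>x. proj A x * proj C x) = 0"
proof -
  have *: "E (\<lambda>x. proj A x * proj C x) = 0"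
    if A: "finite A" "card A \<le> m" and C: "finite C" "card C \<le> m" and a: "a \<in> A" "a \<notin> C" for A C a
  proof (rule E_degenerate_mult[OF proj_measurable[OF A] proj_bounded[OF A] proj_measurable[OF C] proj_bounded[OF C]
          proj_degenerate[OF A a(1)]])
    show "depends_on (- {a}) (proj C)" using proj_depends[OF C] a(2) by (auto simp: depends_on_def)
  qed
  consider a where "a \<in> A" "a \<notin> C" | a where "a \<in> C" "a \<notin> A" using AC by auto
  then show ?thesis
  proof cases
    case 1 then show ?thesis using *[OF A C] by simp
  next
    case 2
    then show ?thesis using *[OF C A] by (simp add: mult.commute)
  qed
qed

lemma E_proj_square:
  assumes A: "finite A" "card A \<le> m"
  shows "E (\<lambda>x. (proj A x)\<^sup>2) = msq (card A)"
proof -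
  let ?I = "{1..card A}"
  obtain t where t: "t permutes (?I \<union> A)" "t ` ?I = A"
    using ex_permutes_image[of "?I \<union> A" ?I A] A by auto
  have inj: "inj t" using t(1) by (rule permutes_inj)
  have "proj A x = proj ?I (x \<circ> t)" for x
    using proj_reindex[of ?I t x] A t(2) inj_on_subset[OF inj, of ?I] by simp
  moreover have "integrable S (\<lambda>x. (proj ?I x)\<^sup>2)"
    using proj_mult_integrable[of ?I ?I] A by (simp add: power2_eq_square)
  ultimately show ?thesis
    using E_reindex[OF inj, of "\<lambda>x. (proj ?I x)\<^sup>2"] by (simp add: msq_def)
qed

lemma E_sum_proj_square:
  assumes K: "finite K" "\<And>A. A \<in> K \<Longrightarrow> finite A \<and> card A \<le> m"
  shows "E (\<lambda>x. (\<Sum>A\<in>K. c A * proj A x)\<^sup>2) = (\<Sum>A\<in>K. (c A)\<^sup>2 * msq (card A))"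
proof -
  have int: "integrable S (\<lambda>x. proj A x * proj C x)" if "A \<in> K" "C \<in> K" for A C
    using K(2) that by (intro proj_mult_integrable) auto
  have "E (\<lambda>x. (\<Sum>A\<in>K. c A * proj A x)\<^sup>2) = E (\<lambda>x. \<Sum>A\<in>K. \<Sum>C\<in>K. (c A * c C) * (proj A x * proj C x))"
    by (simp add: power2_eq_square sum_product mult_ac)
  also have "\<dots> = (\<Sum>A\<in>K. E (\<lambda>x. \<Sum>C\<in>K. (c A * c C) * (proj A x * proj C x)))"
    using int by (intro Bochner_Integration.integral_sum Bochner_Integration.integrable_sum integrable_mult_right) auto
  also have "\<dots> = (\<Sum>A\<in>K. \<Sum>C\<in>K. (c A * c C) * E (\<lambda>x. proj A x * proj C x))"
    using int by (intro sum.cong refl) (subst Bochner_Integration.integral_sum, auto)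
  also have "\<dots> = (\<Sum>A\<in>K. \<Sum>C\<in>K. if C = A then (c A)\<^sup>2 * msq (card A) else 0)"
    using K proj_orthogonal E_proj_square
    by (intro sum.cong refl) (auto simp: power2_eq_square)
  also have "\<dots> = (\<Sum>A\<in>K. (c A)\<^sup>2 * msq (card A))" using K(1) by (simp add: sum.delta)
  finally show ?thesis .
qed

text \<open>Parseval for the single kernel on {1..m}. The binomial weight matters: it makes
  \<open>msq j\<close> as small as B^2 divided by (m choose j).\<close>

lemma bessel: "(\<Sum>j\<le>m. real (m choose j) * msq j) \<le> B\<^sup>2"
proof -
  let ?J = "{1..m}"
  have "(\<Sum>j\<le>m. real (m choose j) * msq j) = (\<Sum>j\<le>m. \<Sum>I | I \<subseteq> ?J \<and> card I = j. msq (card I))"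
    by (simp add: n_subsets)
  also have "\<dots> = (\<Sum>I | I \<subseteq> ?J \<and> card I \<in> {..m}. msq (card I))"
    by (rule sum_by_card[symmetric]) auto
  also have "{I. I \<subseteq> ?J \<and> card I \<in> {..m}} = Pow ?J"
    using card_mono[of ?J] by auto
  also have "(\<Sum>I\<in>Pow ?J. msq (card I)) = E (\<lambda>x. (\<Sum>I\<in>Pow ?J. 1 * proj I x)\<^sup>2)"
    using card_mono[of ?J] by (subst E_sum_proj_square) (auto intro: finite_subset)
  also have "\<dots> = E (\<lambda>x. (F ?J x)\<^sup>2)" by (simp add: F_eq_sum_proj)
  also have "\<dots> \<le> B\<^sup>2"
  proof -
    have "\<bar>(F ?J x)\<^sup>2\<bar> \<le> B\<^sup>2" for x using F_bounded[of ?J x] by (simp add: abs_le_square_iff[symmetric] B_nonneg)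
    then have "\<bar>E (\<lambda>x. (F ?J x)\<^sup>2)\<bar> \<le> B\<^sup>2" using F_measurable[of ?J] by (intro E_bounded) auto
    then show ?thesis by simp
  qed
  finally show ?thesis .
qed

lemma bessel_le: "j \<le> m \<Longrightarrow> real (m choose j) * msq j \<le> B\<^sup>2"
  using bessel member_le_sum[of j "{..m}" "\<lambda>j. real (m choose j) * msq j"] msq_nonneg by auto

definition chaos :: "nat \<Rightarrow> nat \<Rightarrow> (nat \<Rightarrow> 'b) \<Rightarrow> real" where
  "chaos N j x = (\<Sum>I | I \<subseteq> {1..N} \<and> card I = j. proj I x)"

text \<open>The weight is the share of m-subsets that contain a given j-subset, (N-j choose m-j)/(N
  choose m).\<close>

definition component :: "nat \<Rightarrow> nat \<Rightarrow> (nat \<Rightarrow> 'b) \<Rightarrow> real" where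
  "component N j x = real (m choose j) / real (N choose j) * chaos N j x"

definition ustat :: "nat \<Rightarrow> (nat \<Rightarrow> 'b) \<Rightarrow> real" where
  "ustat N x = (\<Sum>J | J \<subseteq> {1..N} \<and> card J = m. F J x) / real (N choose m)"

lemma finite_subsets [simp]: "finite {I. I \<subseteq> {1..N::nat} \<and> Q I}"
  by (rule finite_subset[of _ "Pow {1..N}"]) auto

lemma subset_bounds: "I \<subseteq> {1..N::nat} \<Longrightarrow> finite I" "I \<subseteq> {Suc 0..N} \<Longrightarrow> finite I"
  by (auto intro: finite_subset)

lemma chaos_measurable: "j \<le> m \<Longrightarrow> chaos N j \<in> borel_measurable S"
  unfolding chaos_def[abs_def] using proj_measurable subset_bounds by (intro borel_measurable_sum) auto

lemma component_measurable: "j \<le> m \<Longrightarrow> component N j \<in> borel_measurable S"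
  unfolding component_def[abs_def] using chaos_measurable by auto

text \<open>Each projection is counted once for every m-set containing its index set; degree 0 drops
  out by centring.\<close>

lemma ustat_eq_sum_component:
  assumes "m \<le> N"
  shows "ustat N x = (\<Sum>j=1..m. component N j x)"
proof -
  let ?K = "{J. J \<subseteq> {1..N} \<and> card J = m}" and ?L = "{I. I \<subseteq> {1..N} \<and> card I \<in> {..m}}"
  have "(\<Sum>J\<in>?K. F J x) = (\<Sum>J\<in>?K. \<Sum>I\<in>Pow J. proj I x)"
    by (intro sum.cong refl F_eq_sum_proj) (auto intro: subset_bounds)
  also have "\<dots> = (\<Sum>J\<in>?K. \<Sum>I\<in>{I \<in> ?L. I \<subseteq> J}. proj I x)"
    by (intro sum.cong refl) (auto intro!: card_mono intro: subset_bounds)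
  also have "\<dots> = (\<Sum>I\<in>?L. \<Sum>J\<in>{J \<in> ?K. I \<subseteq> J}. proj I x)"
    by (rule sum.swap_restrict) auto
  also have "\<dots> = (\<Sum>I\<in>?L. real ((N - card I) choose (m - card I)) * proj I x)"
  proof (intro sum.cong refl)
    fix I assume I: "I \<in> ?L"
    have "{J \<in> ?K. I \<subseteq> J} = {J. I \<subseteq> J \<and> J \<subseteq> {1..N} \<and> card J = m}" by auto
    then show "(\<Sum>J\<in>{J \<in> ?K. I \<subseteq> J}. proj I x) = real ((N - card I) choose (m - card I)) * proj I x"
      using card_supersets[of "{1..N}" I m] I by simp
  qed
  also have "\<dots> = (\<Sum>j\<le>m. \<Sum>I | I \<subseteq> {1..N} \<and> card I = j. real ((N - card I) choose (m - card I)) * proj I x)"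
    by (rule sum_by_card) auto
  also have "\<dots> = (\<Sum>j\<le>m. real ((N - j) choose (m - j)) * chaos N j x)"
    unfolding chaos_def sum_distrib_left by (intro sum.cong) auto
  finally have "ustat N x = (\<Sum>j\<le>m. real ((N - j) choose (m - j)) / real (N choose m) * chaos N j x)"
    by (simp add: ustat_def sum_divide_distrib)
  also have "\<dots> = (\<Sum>j\<le>m. component N j x)"
  proof (intro sum.cong refl)
    fix j assume "j \<in> {..m}"
    then have j: "j \<le> m" by simp
    have "real (N choose m) * real (m choose j) = real (N choose j) * real ((N - j) choose (m - j))"
      using choose_mult[OF j assms] by (metis of_nat_mult)
    moreover have "real (N choose m) \<noteq> 0" "real (N choose j) \<noteq> 0" using assms j by auto
    ultimately show "real ((N - j) choose (m - j)) / real (N choose m) * chaos N j x = component N j x"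
      unfolding component_def by (simp add: field_simps)
  qed
  also have "\<dots> = (\<Sum>j=1..m. component N j x) + component N 0 x"
  proof -
    have "{..m} = insert 0 {1..m}" by auto
    then show ?thesis by simp
  qed
  also have "component N 0 x = 0"
  proof -
    have "{I. I \<subseteq> {1..N} \<and> card I = 0} = {{}}" by (auto simp: card_eq_0_iff dest: subset_bounds)
    then show ?thesis by (simp add: component_def chaos_def proj_def F_empty)
  qed
  finally show ?thesis by simp
qed

lemma markov_E:
  assumes f: "integrable S f" "\<And>x. 0 \<le> f x" and c: "c > 0" and sub: "\<And>x. Q x \<Longrightarrow> c \<le> f x"
  shows "P.prob {x. Q x} \<le> E f / c"
proof -
  have [measurable]: "f \<in> borel_measurable S" using f(1) by simp
  have "{x \<in> space S. c \<le> f x} \<in> P.events" by measurable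
  then have "P.prob {x. Q x} \<le> P.prob {x \<in> space S. c \<le> f x}"
    using sub by (intro P.finite_measure_mono) auto
  also have "\<dots> \<le> E f / c"
    using f c by (intro integral_Markov_inequality_measure[of _ _ "{}"]) auto
  finally show ?thesis .
qed

text \<open>Chebyshev with orthogonality: in degree j the variance is a term of the Bessel sum times
  a factor at most (m/N)^j, so the whole tail gains (m/N)^(l+1).\<close>

lemma high_degree_tail:
  assumes mN: "m \<le> N" "0 < N" and c: "c > 0"
  shows "P.prob {x. c \<le> \<bar>\<Sum>j\<in>{l<..m}. component N j x\<bar>} \<le> (real m / real N) ^ Suc l * B\<^sup>2 / c\<^sup>2"
proof -
  let ?r = "\<lambda>j. real (m choose j) / real (N choose j)"
  let ?L = "{I. I \<subseteq> {1..N} \<and> card I \<in> {l<..m}}"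
  let ?f = "\<lambda>x. \<Sum>j\<in>{l<..m}. component N j x"
  have eq: "?f x = (\<Sum>I\<in>?L. ?r (card I) * proj I x)" for x
    unfolding component_def chaos_def
    by (subst sum_by_card[of _ _ m]) (auto simp: sum_distrib_left intro!: sum.cong)
  have "E (\<lambda>x. (?f x)\<^sup>2) = (\<Sum>I\<in>?L. (?r (card I))\<^sup>2 * msq (card I))"
    unfolding eq by (rule E_sum_proj_square) (auto intro: subset_bounds)
  also have "\<dots> = (\<Sum>j\<in>{l<..m}. real (N choose j) * ((?r j)\<^sup>2 * msq j))"
    by (subst sum_by_card[of _ _ m]) (auto simp: n_subsets)
  also have "\<dots> = (\<Sum>j\<in>{l<..m}. ?r j * (real (m choose j) * msq j))"
    using mN by (intro sum.cong refl) (auto simp: power2_eq_square)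
  also have "\<dots> \<le> (\<Sum>j\<in>{l<..m}. (real m / real N) ^ Suc l * (real (m choose j) * msq j))"
  proof (intro sum_mono mult_right_mono)
    fix j assume "j \<in> {l<..m}"
    then have "(real m / real N) ^ j \<le> (real m / real N) ^ Suc l"
      using mN by (intro power_decreasing) auto
    then show "?r j \<le> (real m / real N) ^ Suc l" using binomial_ratio_le[OF mN, of j] by linarith
  qed (use msq_nonneg in auto)
  also have "\<dots> = (real m / real N) ^ Suc l * (\<Sum>j\<in>{l<..m}. real (m choose j) * msq j)"
    by (simp only: sum_distrib_left)
  also have "\<dots> \<le> (real m / real N) ^ Suc l * B\<^sup>2"
  proof (intro mult_left_mono order_trans[OF sum_mono2 bessel])
  qed (use msq_nonneg in auto)
  finally have *: "E (\<lambda>x. (?f x)\<^sup>2) \<le> (real m / real N) ^ Suc l * B\<^sup>2" .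
  have "integrable S (\<lambda>x. (?f x)\<^sup>2)"
  proof -
    have "(?f x)\<^sup>2 = (\<Sum>A\<in>?L. \<Sum>C\<in>?L. (?r (card A) * ?r (card C)) * (proj A x * proj C x))" for x
      unfolding eq by (simp add: power2_eq_square sum_product mult_ac)
    then show ?thesis
      using proj_mult_integrable subset_bounds by (auto intro!: Bochner_Integration.integrable_sum integrable_mult_right)
  qed
  then have "P.prob {x. c \<le> \<bar>?f x\<bar>} \<le> E (\<lambda>x. (?f x)\<^sup>2) / c\<^sup>2"
    using c by (intro markov_E) (auto simp: abs_le_square_iff[symmetric])
  then show ?thesis using * c by (meson divide_right_mono order_trans zero_le_power2)
qed

end

section \<open>Moments of degenerate U-statistics\<close>

lemma (in prob_space) power_expectation_le:
  fixes f :: "'a \<Rightarrow> real"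
  assumes f: "f \<in> borel_measurable M" "\<And>x. \<bar>f x\<bar> \<le> b"
  shows "expectation f ^ (2 * k) \<le> expectation (\<lambda>x. f x ^ (2 * k))"
proof -
  have i: "integrable M (\<lambda>x. f x ^ n)" for n
    using f by (intro integrable_const_bound[where B="b ^ n"]) (auto simp: power_abs intro!: power_mono)
  show ?thesis
    by (rule jensens_inequality[where I=UNIV and q="\<lambda>x. x ^ (2 * k)"])
       (use i[of 1] i[of "2 * k"] in \<open>auto intro: convex_power_even\<close>)
qed

context sym_kernel
begin

definition symz :: "nat set \<Rightarrow> (nat \<Rightarrow> 'b) \<Rightarrow> real" where
  "symz A z = symd A (even_part z) (odd_part z)"

lemma symz_measurable: "finite A \<Longrightarrow> card A \<le> m \<Longrightarrow> symz A \<in> borel_measurable S"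
  unfolding symz_def[abs_def] by (rule symd_measurable) measurable

lemma symz_bounded: "finite A \<Longrightarrow> card A \<le> m \<Longrightarrow> \<bar>symz A z\<bar> \<le> 2 ^ card A * B"
  unfolding symz_def by (rule symd_bounded)

lemma symz_depends:
  "finite A \<Longrightarrow> card A \<le> m \<Longrightarrow> depends_on ((\<lambda>i. 2 * i) ` A \<union> (\<lambda>i. 2 * i + 1) ` A) (symz A)"
  unfolding symz_def by (rule depends_onI) (auto simp: even_part_def odd_part_def intro!: symd_cong)

text \<open>Acts by e on both interleaved copies at once, hence commutes with taking even and odd
  parts.\<close>

definition lift2 :: "(nat \<Rightarrow> nat) \<Rightarrow> nat \<Rightarrow> nat" where
  "lift2 e i = (if even i then 2 * e (i div 2) else 2 * e (i div 2) + 1)"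

lemma inj_lift2: "inj e \<Longrightarrow> inj (lift2 e)"
proof (rule injI)
  fix i j assume e: "inj e" and eq: "lift2 e i = lift2 e j"
  have p: "even i = even j" using eq unfolding lift2_def by (metis even_add even_mult_iff odd_one dvd_triv_left)
  then have "e (i div 2) = e (j div 2)" using eq unfolding lift2_def by (auto split: if_splits)
  then have "i div 2 = j div 2" using e by (simp add: inj_eq)
  then show "i = j" using p by (metis div_mult_mod_eq mod2_eq_if)
qed

lemma symz_reindex:
  assumes "finite A" "card A \<le> m" "inj e"
  shows "symz (e ` A) z = symz A (z \<circ> lift2 e)"
  unfolding symz_def symd_reindex[OF assms]
  by (rule arg_cong2[where f="symd A"]) (auto simp: even_part_def odd_part_def lift2_def fun_eq_iff)

text \<open>Jensen over the second copy replaces projections by \<open>symz\<close>. Exchanges of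
  copies preserve the law and multiply the summands by Rademacher monomials, so averaging over all
  2^N exchanges allows the chaos inequality to be applied pointwise.\<close>

lemma chaos_moment_le_rademacher:
  assumes jm: "j \<le> m" and k: "k > 0"
  shows "E (\<lambda>x. chaos N j x ^ (2 * k))
    \<le> (2 * real k - 1) ^ (j * k) * E (\<lambda>z. (\<Sum>J | J \<subseteq> {1..N} \<and> card J = j. (symz J z)\<^sup>2) ^ k)"
proof -
  let ?K = "{J. J \<subseteq> {1..N} \<and> card J = j}"
  have K: "finite J" "card J \<le> m" if "J \<in> ?K" for J using that jm by (auto dest: subset_bounds)
  define W where "W x y = (\<Sum>J\<in>?K. symd J x y)" for x y
  define b where "b = real (card ?K) * (2 ^ j * B)"
  have Wm: "(\<lambda>z. W (g z) (h z)) \<in> borel_measurable M" if "g \<in> M \<rightarrow>\<^sub>M S" "h \<in> M \<rightarrow>\<^sub>M S" for g h M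
    unfolding W_def using K that by (intro borel_measurable_sum symd_measurable) auto
  have Wb: "\<bar>W x y\<bar> \<le> b" for x y
  proof -
    have "\<bar>W x y\<bar> \<le> (\<Sum>J\<in>?K. \<bar>symd J x y\<bar>)" unfolding W_def by (rule sum_abs)
    also have "\<dots> \<le> (\<Sum>J\<in>?K. 2 ^ j * B)"
    proof (rule sum_mono)
      fix J assume J: "J \<in> ?K"
      then show "\<bar>symd J x y\<bar> \<le> 2 ^ j * B" using symd_bounded[OF K[OF J], of x y] by simp
    qed
    finally show ?thesis by (simp add: b_def)
  qed
  have b0: "0 \<le> b" using Wb[of undefined undefined] by linarith
  have Wpb: "\<bar>W x y ^ n\<bar> \<le> b ^ n" for x y n unfolding power_abs using Wb by (intro power_mono) auto
  have chaos: "chaos N j x = E (\<lambda>y. W x y)" for x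
  proof -
    have int: "integrable S (\<lambda>y. symd J x y)" if "J \<in> ?K" for J
      by (rule integrable_bounded[OF symd_measurable[OF K[OF that]] symd_bounded[OF K[OF that]]]) simp_all
    have "E (\<lambda>y. W x y) = (\<Sum>J\<in>?K. E (\<lambda>y. symd J x y))"
      unfolding W_def by (rule Bochner_Integration.integral_sum) (rule int)
    also have "\<dots> = chaos N j x"
      unfolding chaos_def by (rule sum.cong[OF refl]) (rule proj_eq_E_symd[OF K, symmetric])
    finally show ?thesis ..
  qed
  have m1: "(\<lambda>(x, y). W x y ^ n) \<in> borel_measurable (S \<Otimes>\<^sub>M S)" for n
    using Wm[of fst "S \<Otimes>\<^sub>M S" snd] by (simp add: case_prod_beta')
  have Wx: "(\<lambda>y. W x y) \<in> borel_measurable S" for x by (rule Wm) simp_all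
  have i1: "integrable S (\<lambda>x. E (\<lambda>y. W x y ^ n))" for n
  proof (rule integrable_bounded[of _ "b ^ n"])
    show "(\<lambda>x. E (\<lambda>y. W x y ^ n)) \<in> borel_measurable S"
      by (rule P.borel_measurable_lebesgue_integral[OF m1])
    show "\<bar>E (\<lambda>y. W x y ^ n)\<bar> \<le> b ^ n" for x
      by (rule E_bounded[OF borel_measurable_power[OF Wx] Wpb])
  qed
  have "E (\<lambda>x. chaos N j x ^ (2 * k)) \<le> E (\<lambda>x. E (\<lambda>y. W x y ^ (2 * k)))"
  proof (rule integral_mono)
    have "\<bar>chaos N j x\<bar> \<le> b" for x unfolding chaos by (rule E_bounded[OF Wx Wb])
    then show "integrable S (\<lambda>x. chaos N j x ^ (2 * k))"
      using chaos_measurable[OF jm] by (intro integrable_bounded[of _ "b ^ (2 * k)"]) (auto simp: power_abs intro!: power_mono)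
    show "chaos N j x ^ (2 * k) \<le> E (\<lambda>y. W x y ^ (2 * k))" for x
      unfolding chaos by (rule P.power_expectation_le[OF Wx Wb])
  qed (rule i1)
  also have "\<dots> = E (\<lambda>z. W (even_part z) (odd_part z) ^ (2 * k))"
    by (rule pair_as_single[OF m1 Wpb])
  finally have 1: "E (\<lambda>x. chaos N j x ^ (2 * k)) \<le> E (\<lambda>z. (\<Sum>J\<in>?K. symz J z) ^ (2 * k))"
    unfolding W_def symz_def .
  have sm: "symz J \<in> borel_measurable S" if "J \<in> ?K" for J by (rule symz_measurable[OF K[OF that]])
  define R where "R \<epsilon> z = (\<Sum>J\<in>?K. (- 1) ^ card (J \<inter> \<epsilon>) * symz J z)" for \<epsilon> z
  have Rm: "R \<epsilon> \<in> borel_measurable S" for \<epsilon>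
    unfolding R_def[abs_def] by (intro borel_measurable_sum borel_measurable_times sm borel_measurable_const)
  have Rb: "\<bar>R \<epsilon> z\<bar> \<le> b" for \<epsilon> z
  proof -
    have "\<bar>R \<epsilon> z\<bar> \<le> (\<Sum>J\<in>?K. \<bar>(- 1) ^ card (J \<inter> \<epsilon>) * symz J z\<bar>)" unfolding R_def by (rule sum_abs)
    also have "\<dots> \<le> (\<Sum>J\<in>?K. 2 ^ j * B)"
    proof (rule sum_mono)
      fix J assume J: "J \<in> ?K"
      then show "\<bar>(- 1) ^ card (J \<inter> \<epsilon>) * symz J z\<bar> \<le> 2 ^ j * B"
        using symz_bounded[OF K[OF J], of z] by (simp add: abs_mult)
    qed
    finally show ?thesis by (simp add: b_def)
  qed
  have Ri: "integrable S (\<lambda>z. R \<epsilon> z ^ n)" for \<epsilon> n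
    using Rm Rb by (intro integrable_bounded[of _ "b ^ n"]) (auto simp: power_abs intro!: power_mono)
  have swap: "E (\<lambda>z. (\<Sum>J\<in>?K. symz J z) ^ (2 * k)) = E (\<lambda>z. R \<epsilon> z ^ (2 * k))" for \<epsilon>
  proof -
    \<comment> \<open>An involution of the indices that exchanges the two copies of each coordinate
      in \<epsilon>.\<close>
    define f where "f i = (if i div 2 \<in> \<epsilon> then (if even i then i + 1 else i - 1) else i)" for i :: nat
    have ff: "f (f i) = i" for i
      unfolding f_def by (cases "even i") (auto elim!: evenE oddE)
    then have inj: "inj f" by (metis injI)
    have "even_part (z \<circ> f) = glue \<epsilon> (odd_part z) (even_part z)" "odd_part (z \<circ> f) = glue \<epsilon> (even_part z) (odd_part z)"
      for z :: "nat \<Rightarrow> 'b" by (auto simp: even_part_def odd_part_def f_def glue_def fun_eq_iff)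
    then have "symz J (z \<circ> f) = (- 1) ^ card (J \<inter> \<epsilon>) * symz J z" if "J \<in> ?K" for J z
      unfolding symz_def using symd_swap[OF K[OF that]] by simp
    then have "R \<epsilon> z = (\<Sum>J\<in>?K. symz J (z \<circ> f))" for z unfolding R_def by (intro sum.cong) auto
    moreover have "R {} z = (\<Sum>J\<in>?K. symz J z)" for z by (simp add: R_def)
    ultimately show ?thesis
      using E_reindex[OF inj Ri[of "{}" "2 * k"]] by simp
  qed
  have "2 ^ N * E (\<lambda>z. (\<Sum>J\<in>?K. symz J z) ^ (2 * k)) = (\<Sum>\<epsilon>\<in>Pow {1..N}. E (\<lambda>z. R \<epsilon> z ^ (2 * k)))"
    using swap by (simp add: card_Pow)
  also have "\<dots> = E (\<lambda>z. \<Sum>\<epsilon>\<in>Pow {1..N}. R \<epsilon> z ^ (2 * k))"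
    using Ri by (intro Bochner_Integration.integral_sum[symmetric]) auto
  also have "\<dots> \<le> E (\<lambda>z. 2 ^ N * ((2 * real k - 1) ^ (j * k) * (\<Sum>J\<in>?K. (symz J z)\<^sup>2) ^ k))"
  proof (rule integral_mono)
    show "integrable S (\<lambda>z. \<Sum>\<epsilon>\<in>Pow {1..N}. R \<epsilon> z ^ (2 * k))" using Ri by auto
    have sq: "(symz J z)\<^sup>2 \<le> (2 ^ j * B)\<^sup>2" if "J \<in> ?K" for J z
    proof -
      have "\<bar>symz J z\<bar> \<le> 2 ^ j * B" using symz_bounded[OF K[OF that], of z] that by simp
      then have "\<bar>symz J z\<bar>\<^sup>2 \<le> (2 ^ j * B)\<^sup>2" by (intro power_mono) simp_all
      then show ?thesis by simp
    qed
    have "(\<Sum>J\<in>?K. (symz J z)\<^sup>2) \<le> real (card ?K) * (2 ^ j * B)\<^sup>2" for z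
      by (rule sum_bounded_above) (rule sq)
    then have "\<bar>(\<Sum>J\<in>?K. (symz J z)\<^sup>2) ^ k\<bar> \<le> (real (card ?K) * (2 ^ j * B)\<^sup>2) ^ k" for z
      by (auto simp: power_abs sum_nonneg intro!: power_mono)
    then have "integrable S (\<lambda>z. (\<Sum>J\<in>?K. (symz J z)\<^sup>2) ^ k)"
      by (intro integrable_bounded borel_measurable_power borel_measurable_sum sm)
    then show "integrable S (\<lambda>z. 2 ^ N * ((2 * real k - 1) ^ (j * k) * (\<Sum>J\<in>?K. (symz J z)\<^sup>2) ^ k))"
      by auto
    fix z
    \<comment> \<open>Extension by 0 to the whole power set; only |J| = j survives, so the weights
      in the chaos inequality are constant.\<close>
    define a where "a J = (if card J = j then symz J z else 0)" for J
    have "R \<epsilon> z = (\<Sum>J\<in>Pow {1..N}. (- 1) ^ card (J \<inter> \<epsilon>) * a J)" for \<epsilon>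
      unfolding R_def a_def by (intro sum.mono_neutral_cong_left) auto
    then have "(\<Sum>\<epsilon>\<in>Pow {1..N}. R \<epsilon> z ^ (2 * k)) \<le> 2 ^ N * (\<Sum>J\<in>Pow {1..N}. (2 * real k - 1) ^ card J * (a J)\<^sup>2) ^ k"
      using rademacher_chaos_moment[of "{1..N}" k a] k by simp
    also have "(\<Sum>J\<in>Pow {1..N}. (2 * real k - 1) ^ card J * (a J)\<^sup>2) = (\<Sum>J\<in>?K. (2 * real k - 1) ^ j * (symz J z)\<^sup>2)"
      unfolding a_def by (intro sum.mono_neutral_cong_right) auto
    also have "\<dots> = (2 * real k - 1) ^ j * (\<Sum>J\<in>?K. (symz J z)\<^sup>2)" by (simp add: sum_distrib_left)
    finally show "(\<Sum>\<epsilon>\<in>Pow {1..N}. R \<epsilon> z ^ (2 * k)) \<le> 2 ^ N * ((2 * real k - 1) ^ (j * k) * (\<Sum>J\<in>?K. (symz J z)\<^sup>2) ^ k)"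
      by (simp add: power_mult_distrib power_mult)
  qed
  also have "\<dots> = 2 ^ N * ((2 * real k - 1) ^ (j * k) * E (\<lambda>z. (\<Sum>J\<in>?K. (symz J z)\<^sup>2) ^ k))" by simp
  finally show ?thesis using 1 by simp
qed

end

context sym_kernel
begin

text \<open>Squares over overlapping sets are dependent. Hoeffding's device: their sum is, up to the
  factor (N choose j), the average over permutations of means over n disjoint blocks, and by
  convexity its k-th moment is at most that of one block mean, to which the Rosenthal bound
  applies.\<close>

lemma symz_square_sum_moment:
  assumes j: "0 < j" "j \<le> m" "j \<le> N" and k: "k > 0" and n: "n = N div j"
    and w: "E (\<lambda>z. ((symz {1..j} z)\<^sup>2) ^ k) \<le> w"
  shows "E (\<lambda>z. (\<Sum>J | J \<subseteq> {1..N} \<and> card J = j. (symz J z)\<^sup>2) ^ k)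
    \<le> real (N choose j) ^ k * ((6 * E (\<lambda>z. (symz {1..j} z)\<^sup>2)) ^ k + 2 * (real k / real n) ^ (k - 1) * w)"
proof -
  \<comment> \<open>Block l consists of lj+1 to lj+j; exactly N div j such blocks fit into
    {1..N}.\<close>
  define e where "e l i = i + l * j" for l i :: nat
  define Bl where "Bl l = e l ` {1..j}" for l
  define V where "V l z = (symz (Bl l) z)\<^sup>2" for l z
  define v where "v = E (\<lambda>z. (symz {1..j} z)\<^sup>2)"
  have n0: "n > 0" using j n by (simp add: div_greater_zero_iff)
  have inj_e: "inj (e l)" for l by (simp add: e_def inj_def)
  have Bl_fin: "finite (Bl l)" and Bl_card: "card (Bl l) = j" for l
    unfolding Bl_def using card_image[OF inj_on_subset[OF inj_e]] by auto
  have Bl_m: "card (Bl l) \<le> m" for l using j by (simp add: Bl_card)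
  have Bl_sub: "Bl l \<subseteq> {1..N}" if "l < n" for l
  proof -
    have "(l + 1) * j \<le> n * j" using that by (intro mult_right_mono) auto
    also have "\<dots> \<le> N" unfolding n by (rule div_times_less_eq_dividend)
    finally show ?thesis unfolding Bl_def e_def by auto
  qed
  have Bl_disj: "Bl l \<inter> Bl l' = {}" if "l \<noteq> l'" for l l'
  proof -
    have lt: False if "l < l'" "x + l * j = y + l' * j" "x \<le> j" "1 \<le> y" for l l' x y
    proof -
      have "(l + 1) * j \<le> l' * j" using that by (intro mult_right_mono) auto
      then show False using that by auto
    qed
    show ?thesis
    proof (rule ccontr)
      assume "Bl l \<inter> Bl l' \<noteq> {}"
      then obtain b where "b \<in> Bl l" "b \<in> Bl l'" by blast
      then obtain x y where "x \<in> {1..j}" "y \<in> {1..j}" "x + l * j = y + l' * j"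
        unfolding Bl_def e_def by blast
      then show False using lt[of l l' x y] lt[of l' l y x] that by (cases "l < l'") auto
    qed
  qed
  have Vm: "V l \<in> borel_measurable S" for l
    unfolding V_def[abs_def] using symz_measurable[OF Bl_fin Bl_m] by measurable
  have V_sh: "V l z = (symz {1..j} (z \<circ> lift2 (e l)))\<^sup>2" for l z
    unfolding V_def Bl_def using j by (subst symz_reindex) (auto simp: inj_e)
  have Vb: "V l z \<le> (2 ^ j * B)\<^sup>2" for l z
  proof -
    have "\<bar>symz (Bl l) z\<bar> \<le> 2 ^ j * B" using symz_bounded[OF Bl_fin Bl_m] by (simp add: Bl_card)
    then have "\<bar>symz (Bl l) z\<bar>\<^sup>2 \<le> (2 ^ j * B)\<^sup>2" by (intro power_mono) simp_all
    then show ?thesis by (simp add: V_def)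
  qed
  have V0: "0 \<le> V l z" for l z by (simp add: V_def)
  have base_int: "integrable S (\<lambda>z. ((symz {1..j} z)\<^sup>2) ^ p)" for p
  proof (rule integrable_bounded)
    have "symz {1..j} \<in> borel_measurable S" using j by (intro symz_measurable) auto
    then show "(\<lambda>z. ((symz {1..j} z)\<^sup>2) ^ p) \<in> borel_measurable S" by measurable
    fix z
    have "\<bar>symz {1..j} z\<bar> \<le> 2 ^ j * B" using symz_bounded[of "{1..j}" z] j by simp
    then have "(\<bar>symz {1..j} z\<bar>\<^sup>2) ^ p \<le> ((2 ^ j * B)\<^sup>2) ^ p" by (intro power_mono) simp_all
    then show "\<bar>((symz {1..j} z)\<^sup>2) ^ p\<bar> \<le> ((2 ^ j * B)\<^sup>2) ^ p" by simp
  qed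
  have V_pow: "E (\<lambda>z. V l z ^ p) = E (\<lambda>z. ((symz {1..j} z)\<^sup>2) ^ p)" for l p
    unfolding V_sh by (rule E_reindex[OF inj_lift2[OF inj_e] base_int])
  define D where "D l = (\<lambda>i. 2 * i) ` Bl l \<union> (\<lambda>i. 2 * i + 1) ` Bl l" for l
  have V_dep: "depends_on (D l) (V l)" for l
    using symz_depends[OF Bl_fin Bl_m, of l] unfolding D_def V_def depends_on_def by metis
  have D_disj: "D l \<inter> (\<Union>i\<in>{..<n} - {l}. D i) = {}" for l
  proof -
    have "D l \<inter> D i = {}" if "i \<noteq> l" for i
      using Bl_disj[of l i] that unfolding D_def by (auto; presburger)
    then show ?thesis by auto
  qed
  have block: "E (\<lambda>z. (\<Sum>l<n. V l z) ^ k) \<le> (6 * real n * v) ^ k + 2 * real k ^ (k - 1) * real n * w"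
  proof (rule P.sum_nonneg_moment[OF V0 Vb Vm k])
    fix l
    let ?T = "\<lambda>z. (\<Sum>i\<in>{..<n} - {l}. V i z) ^ (k - 1)"
    have "depends_on (\<Union>i\<in>{..<n} - {l}. D i) ?T"
    proof (rule depends_onI)
      fix x y :: "nat \<Rightarrow> 'b" assume "\<And>i. i \<in> (\<Union>i\<in>{..<n} - {l}. D i) \<Longrightarrow> x i = y i"
      then have "V i x = V i y" if "i \<in> {..<n} - {l}" for i
        using that by (intro depends_onD[OF V_dep]) auto
      then show "?T x = ?T y" by simp
    qed
    moreover have "integrable S ?T"
    proof (rule integrable_bounded)
      show "?T \<in> borel_measurable S" by (intro borel_measurable_power borel_measurable_sum Vm)
      fix z
      have "(\<Sum>i\<in>{..<n} - {l}. V i z) \<le> real (card ({..<n} - {l})) * (2 ^ j * B)\<^sup>2"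
        by (rule sum_bounded_above) (rule Vb)
      then show "\<bar>?T z\<bar> \<le> (real (card ({..<n} - {l})) * (2 ^ j * B)\<^sup>2) ^ (k - 1)"
        unfolding power_abs by (intro power_mono) (simp_all add: sum_nonneg V0)
    qed
    moreover have "integrable S (V l)"
      using Vb[of l] V0[of l] by (intro integrable_bounded[OF Vm, of _ "(2 ^ j * B)\<^sup>2"]) simp
    ultimately have "E (\<lambda>z. V l z * ?T z) = E (V l) * E ?T"
      using V_dep D_disj by (intro E_mult_indep)
    also have "E (V l) = v" using V_pow[of l 1] by (simp add: v_def)
    finally show "E (\<lambda>z. V l z * ?T z) = v * E ?T" .
    show "E (\<lambda>z. V l z ^ k) \<le> w" using w by (simp add: V_pow)
  qed (simp add: v_def)
  define T where "T z = (\<Sum>l<n. V l z) / real n" for z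
  let ?Sym = "{p. p permutes {1..N}}"
  have fin_Sym: "finite ?Sym" by (rule finite_permutations) simp
  have card_Sym: "card ?Sym = fact N" using card_permutations[of "{1..N}" N] by simp
  have Tb: "\<bar>T z\<bar> \<le> (2 ^ j * B)\<^sup>2" and T0: "0 \<le> T z" for z
  proof -
    have "(\<Sum>l<n. V l z) \<le> real (card {..<n}) * (2 ^ j * B)\<^sup>2" by (rule sum_bounded_above) (rule Vb)
    then have "T z \<le> (2 ^ j * B)\<^sup>2" using n0 by (simp add: T_def divide_le_eq mult.commute)
    moreover show "0 \<le> T z" by (simp add: T_def sum_nonneg V0)
    ultimately show "\<bar>T z\<bar> \<le> (2 ^ j * B)\<^sup>2" by simp
  qed
  have T_int: "integrable S (\<lambda>z. T z ^ k)"
  proof (rule integrable_bounded)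
    show "(\<lambda>z. T z ^ k) \<in> borel_measurable S"
      unfolding T_def using Vm by measurable
    show "\<bar>T z ^ k\<bar> \<le> ((2 ^ j * B)\<^sup>2) ^ k" for z unfolding power_abs by (intro power_mono Tb) simp
  qed
  \<comment> \<open>Hoeffding's representation; the permutations are counted for each block
    separately.\<close>
  have avg: "(\<Sum>J | J \<subseteq> {1..N} \<and> card J = j. (symz J z)\<^sup>2) = real (N choose j) * ((\<Sum>p\<in>?Sym. T (z \<circ> lift2 p)) / real (card ?Sym))"
    for z
  proof -
    let ?Q = "\<Sum>J | J \<subseteq> {1..N} \<and> card J = j. (symz J z)\<^sup>2"
    have 1: "real (N choose j) * (\<Sum>p\<in>?Sym. V l (z \<circ> lift2 p)) = fact N * ?Q" if l: "l < n" for l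
    proof -
      have "V l (z \<circ> lift2 p) = (symz (p ` Bl l) z)\<^sup>2" if "p \<in> ?Sym" for p
        unfolding V_def using that permutes_inj[of p "{1..N}"] symz_reindex[OF Bl_fin Bl_m, of p l z] by simp
      then have "(\<Sum>p\<in>?Sym. V l (z \<circ> lift2 p)) = (\<Sum>p\<in>?Sym. (symz (p ` Bl l) z)\<^sup>2)" by simp
      then show ?thesis
        using sum_permutes_image[of "{1..N}" "Bl l" "\<lambda>J. (symz J z)\<^sup>2"] Bl_sub[OF l] by (simp add: Bl_card)
    qed
    have "real (N choose j) * (\<Sum>p\<in>?Sym. T (z \<circ> lift2 p)) = (\<Sum>l<n. real (N choose j) * (\<Sum>p\<in>?Sym. V l (z \<circ> lift2 p))) / real n"
      unfolding T_def sum_divide_distrib[symmetric] by (subst sum.swap) (simp add: sum_distrib_left)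
    also have "\<dots> = fact N * ?Q" using 1 n0 by simp
    finally show ?thesis unfolding card_Sym by simp
  qed
  have "E (\<lambda>z. (\<Sum>J | J \<subseteq> {1..N} \<and> card J = j. (symz J z)\<^sup>2) ^ k)
    \<le> E (\<lambda>z. real (N choose j) ^ k * ((\<Sum>p\<in>?Sym. T (z \<circ> lift2 p) ^ k) / real (card ?Sym)))"
  proof (rule integral_mono)
    have lint: "integrable S (\<lambda>z. T (z \<circ> lift2 p) ^ k)" if "p \<in> ?Sym" for p
      using that permutes_inj[of p "{1..N}"] by (intro integrable_reindex[OF inj_lift2 T_int]) simp
    show "integrable S (\<lambda>z. real (N choose j) ^ k * ((\<Sum>p\<in>?Sym. T (z \<circ> lift2 p) ^ k) / real (card ?Sym)))"
      by (intro integrable_mult_right integrable_divide Bochner_Integration.integrable_sum lint)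
    fix z
    show "(\<Sum>J | J \<subseteq> {1..N} \<and> card J = j. (symz J z)\<^sup>2) ^ k
      \<le> real (N choose j) ^ k * ((\<Sum>p\<in>?Sym. T (z \<circ> lift2 p) ^ k) / real (card ?Sym))"
      unfolding avg power_mult_distrib
      using fin_Sym by (intro mult_left_mono power_mean_le T0) (auto intro: exI[of _ id] permutes_id)
  next
    show "integrable S (\<lambda>z. (\<Sum>J | J \<subseteq> {1..N} \<and> card J = j. (symz J z)\<^sup>2) ^ k)"
    proof (rule integrable_bounded)
      let ?K = "{J. J \<subseteq> {1..N} \<and> card J = j}"
      have J: "finite J" "card J \<le> m" if "J \<in> ?K" for J using that j by (auto dest: subset_bounds)
      show "(\<lambda>z. (\<Sum>J\<in>?K. (symz J z)\<^sup>2) ^ k) \<in> borel_measurable S"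
        by (intro borel_measurable_power borel_measurable_sum symz_measurable[OF J])
      fix z
      have "(symz J z)\<^sup>2 \<le> (2 ^ j * B)\<^sup>2" if "J \<in> ?K" for J
      proof -
        have "\<bar>symz J z\<bar> \<le> 2 ^ j * B" using symz_bounded[OF J[OF that], of z] that by simp
        then have "\<bar>symz J z\<bar>\<^sup>2 \<le> (2 ^ j * B)\<^sup>2" by (intro power_mono) simp_all
        then show ?thesis by simp
      qed
      then have "(\<Sum>J\<in>?K. (symz J z)\<^sup>2) \<le> real (card ?K) * (2 ^ j * B)\<^sup>2" by (rule sum_bounded_above)
      then show "\<bar>(\<Sum>J\<in>?K. (symz J z)\<^sup>2) ^ k\<bar> \<le> (real (card ?K) * (2 ^ j * B)\<^sup>2) ^ k"
        unfolding power_abs by (intro power_mono) (simp_all add: sum_nonneg)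
    qed
  qed
  also have "\<dots> = real (N choose j) ^ k * ((\<Sum>p\<in>?Sym. E (\<lambda>z. T (z \<circ> lift2 p) ^ k)) / real (card ?Sym))"
  proof -
    have lint: "integrable S (\<lambda>z. T (z \<circ> lift2 p) ^ k)" if "p \<in> ?Sym" for p
      using that permutes_inj[of p "{1..N}"] by (intro integrable_reindex[OF inj_lift2 T_int]) simp
    have "E (\<lambda>z. \<Sum>p\<in>?Sym. T (z \<circ> lift2 p) ^ k) = (\<Sum>p\<in>?Sym. E (\<lambda>z. T (z \<circ> lift2 p) ^ k))"
      by (rule Bochner_Integration.integral_sum) (rule lint)
    then show ?thesis by simp
  qed
  also have "(\<Sum>p\<in>?Sym. E (\<lambda>z. T (z \<circ> lift2 p) ^ k)) = (\<Sum>p\<in>?Sym. E (\<lambda>z. T z ^ k))"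
  proof (rule sum.cong[OF refl])
    fix p assume "p \<in> ?Sym"
    then have "inj p" using permutes_inj by blast
    then show "E (\<lambda>z. T (z \<circ> lift2 p) ^ k) = E (\<lambda>z. T z ^ k)"
      by (intro E_reindex[OF inj_lift2 T_int])
  qed
  also have "(\<Sum>p\<in>?Sym. E (\<lambda>z. T z ^ k)) / real (card ?Sym) = E (\<lambda>z. T z ^ k)"
    unfolding card_Sym by (simp add: card_Sym[simplified])
  also have "E (\<lambda>z. T z ^ k) = E (\<lambda>z. (\<Sum>l<n. V l z) ^ k) / real n ^ k"
    by (simp add: T_def power_divide)
  also have "\<dots> \<le> ((6 * real n * v) ^ k + 2 * real k ^ (k - 1) * real n * w) / real n ^ k"
    using block by (intro divide_right_mono) auto
  also have "\<dots> = (6 * v) ^ k + 2 * (real k / real n) ^ (k - 1) * w"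
  proof -
    have "real n ^ k = real n * real n ^ (k - 1)" using k by (metis power_eq_if not_gr_zero)
    then show ?thesis using n0 by (simp add: power_mult_distrib power_divide field_simps)
  qed
  finally show ?thesis by (simp add: v_def mult_left_mono)
qed

text \<open>By \<open>symd_eq_proj\<close> there are 2^j signed terms, each with second moment
  \<open>msq j\<close>; Cauchy-Schwarz costs another 2^j.\<close>

lemma E_symz_square_le:
  assumes j: "j \<le> m"
  shows "E (\<lambda>z. (symz {1..j} z)\<^sup>2) \<le> 4 ^ j * msq j"
proof -
  let ?A = "{1..j}"
  have A: "finite ?A" "card ?A \<le> m" using j by auto
  have pb: "(proj ?A x)\<^sup>2 \<le> (2 ^ j * B)\<^sup>2" for x
  proof -
    have "\<bar>proj ?A x\<bar> \<le> 2 ^ j * B" using proj_bounded[OF A, of x] by simp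
    then have "\<bar>proj ?A x\<bar>\<^sup>2 \<le> (2 ^ j * B)\<^sup>2" by (intro power_mono) simp_all
    then show ?thesis by simp
  qed
  have pint: "integrable S (\<lambda>x. (proj ?A x)\<^sup>2)"
    using pb proj_measurable[OF A] by (intro integrable_bounded[of _ "(2 ^ j * B)\<^sup>2"]) auto
  have C: "integrable S (\<lambda>z. (proj ?A (glue C (even_part z) (odd_part z)))\<^sup>2)
      \<and> E (\<lambda>z. (proj ?A (glue C (even_part z) (odd_part z)))\<^sup>2) = msq j" for C
  proof -
    \<comment> \<open>Mixing the two copies along C is a relabelling of the interleaved sequence and
      so preserves the law.\<close>
    define f where "f i = (if i \<in> C then 2 * i else 2 * i + 1)" for i :: nat
    have inj: "inj f" unfolding f_def inj_def by (auto split: if_splits; presburger)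
    have "glue C (even_part z) (odd_part z) = z \<circ> f" for z :: "nat \<Rightarrow> 'b"
      by (auto simp: glue_def even_part_def odd_part_def f_def fun_eq_iff)
    then show ?thesis using E_reindex[OF inj pint] integrable_reindex[OF inj pint] by (simp add: msq_def)
  qed
  have "E (\<lambda>z. (symz ?A z)\<^sup>2) \<le> E (\<lambda>z. 2 ^ card ?A * (\<Sum>C\<in>Pow ?A. (proj ?A (glue C (even_part z) (odd_part z)))\<^sup>2))"
  proof (rule integral_mono)
    show "integrable S (\<lambda>z. 2 ^ card ?A * (\<Sum>C\<in>Pow ?A. (proj ?A (glue C (even_part z) (odd_part z)))\<^sup>2))"
      using C by auto
    show "(symz ?A z)\<^sup>2 \<le> 2 ^ card ?A * (\<Sum>C\<in>Pow ?A. (proj ?A (glue C (even_part z) (odd_part z)))\<^sup>2)" for z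
      unfolding symz_def symd_eq_proj[OF A] by (rule alt_sum_square_le) simp
    then have "(symz ?A z)\<^sup>2 \<le> 2 ^ card ?A * (\<Sum>C\<in>Pow ?A. (2 ^ j * B)\<^sup>2)" for z
      by (rule order_trans) (intro mult_left_mono sum_mono pb, simp)
    then show "integrable S (\<lambda>z. (symz ?A z)\<^sup>2)"
      using symz_measurable[OF A] by (intro integrable_bounded) auto
  qed
  also have "\<dots> = 2 ^ card ?A * (\<Sum>C\<in>Pow ?A. msq j)"
    using C by simp
  also have "\<dots> = (2 * 2) ^ j * msq j" unfolding power_mult_distrib by (simp add: card_Pow)
  finally show ?thesis by simp
qed

end

section \<open>Exponential moments of the linear part and the tilting argument\<close>

lemma exp_le_quadratic: "exp (x::real) \<le> 1 + x + x\<^sup>2 / 2 * exp \<bar>x\<bar>"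
proof -
  obtain t where t: "\<bar>t\<bar> \<le> \<bar>x\<bar>" "exp x = (\<Sum>m<2. x ^ m / fact m) + exp t / fact 2 * x ^ 2"
    using Maclaurin_exp_le by blast
  have "exp t / 2 * x\<^sup>2 \<le> exp \<bar>x\<bar> / 2 * x\<^sup>2" using t(1) by (intro mult_right_mono) auto
  then show ?thesis using t(2) by (simp add: numeral_2_eq_2 mult.commute)
qed

text \<open>Cauchy-Schwarz from the nonnegativity of the quadratic E (f - t g)^2 in t.\<close>

lemma (in prob_space) expectation_mult_le_sqrt:
  fixes f g :: "'a \<Rightarrow> real"
  assumes int: "integrable M (\<lambda>x. (f x)\<^sup>2)" "integrable M (\<lambda>x. (g x)\<^sup>2)" "integrable M (\<lambda>x. f x * g x)"
  shows "\<bar>expectation (\<lambda>x. f x * g x)\<bar> \<le> sqrt (expectation (\<lambda>x. (f x)\<^sup>2) * expectation (\<lambda>x. (g x)\<^sup>2))"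
proof -
  define a b c where "a = expectation (\<lambda>x. (f x)\<^sup>2)" and "b = expectation (\<lambda>x. (g x)\<^sup>2)" and "c = expectation (\<lambda>x. f x * g x)"
  have q: "0 \<le> a - 2 * t * c + t\<^sup>2 * b" for t
  proof -
    have "0 \<le> expectation (\<lambda>x. (f x - t * g x)\<^sup>2)" by simp
    also have "expectation (\<lambda>x. (f x - t * g x)\<^sup>2) = expectation (\<lambda>x. (f x)\<^sup>2 - 2 * t * (f x * g x) + t\<^sup>2 * (g x)\<^sup>2)"
      by (intro Bochner_Integration.integral_cong) (auto simp: power2_eq_square algebra_simps)
    also have "\<dots> = a - 2 * t * c + t\<^sup>2 * b" using int by (simp add: a_def b_def c_def)
    finally show ?thesis .
  qed
  have b0: "0 \<le> b" by (simp add: b_def)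
  have "c\<^sup>2 \<le> a * b"
  proof (cases "b = 0")
    case True
    have "c = 0"
    proof (rule ccontr)
      assume "c \<noteq> 0"
      \<comment> \<open>If E g^2 = 0, this t makes the quadratic equal to -1.\<close>
      then show False using q[of "(a + 1) / (2 * c)"] True by (simp add: field_simps)
    qed
    then show ?thesis using True by simp
  next
    case False
    then have "0 \<le> a - c\<^sup>2 / b" using q[of "c / b"] b0 by (simp add: power2_eq_square field_simps)
    then show ?thesis using False b0 by (simp add: field_simps)
  qed
  then have "sqrt (c\<^sup>2) \<le> sqrt (a * b)" by (rule real_sqrt_le_mono)
  then show ?thesis by (simp add: a_def b_def c_def)
qed

context sym_kernel
begin

text \<open>F {1} reads coordinate 1 only, so a constant sequence serves as argument.\<close>

definition h1 :: "'b \<Rightarrow> real" where "h1 s = F {1} (\<lambda>_. s)"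

context
  assumes m1: "1 \<le> m"
begin

lemma proj_singleton: "proj {i} x = h1 (x i)"
proof -
  have "proj {i} x = F {i} x" unfolding proj_def using alt_sum_insert[of "{}" i "\<lambda>C. F C x"] by (simp add: F_empty)
  also have "\<dots> = F {1} (x \<circ> (\<lambda>_. i))" using F_reindex[of "{1}" "\<lambda>_. i" x] m1 by simp
  finally show ?thesis by (simp add: h1_def comp_def)
qed

lemma h1_measurable: "h1 \<in> borel_measurable P"
proof -
  have "(\<lambda>s. (\<lambda>_::nat. s)) \<in> P \<rightarrow>\<^sub>M S" by (rule measurable_PiM_single') auto
  from measurable_compose[OF this F_measurable[of "{1}"]] show ?thesis
    using m1 by (simp add: h1_def[abs_def])
qed

lemma h1_bounded: "\<bar>h1 s\<bar> \<le> B"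
  unfolding h1_def using m1 by (intro F_bounded) auto

lemma integrable_h1_power: "integrable P (\<lambda>s. h1 s ^ n)"
  using h1_measurable h1_bounded
  by (intro M.integrable_const_bound[where B="B ^ n"]) (auto simp: power_abs intro!: power_mono)

lemma h1_mean: "integral\<^sup>L P h1 = 0"
proof -
  have "E (\<lambda>y. proj {1} (x(1 := y 1))) = 0" for x using m1 by (intro proj_degenerate) auto
  then show ?thesis using E_coordinate(1)[of h1 1] integrable_h1_power[of 1] by (simp add: proj_singleton)
qed

lemma h1_square: "integral\<^sup>L P (\<lambda>s. (h1 s)\<^sup>2) = msq 1"
  using E_coordinate(1)[OF integrable_h1_power[of 2], of 1] by (simp add: msq_def proj_singleton)

lemma component_1: "component N 1 x = real m / real N * (\<Sum>i=1..N. h1 (x i))"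
proof -
  have "{I. I \<subseteq> {1..N} \<and> card I = 1} = (\<lambda>i. {i}) ` {1..N}"
    by (auto simp: card_1_singleton_iff)
  then have "chaos N 1 x = (\<Sum>i=1..N. h1 (x i))"
    by (simp add: chaos_def sum.reindex proj_singleton)
  then show ?thesis by (simp add: component_def)
qed

text \<open>Splitting at \<open>a\<close> lets small values of the projection contribute the sharp variance.\<close>

lemma linear_tail:
  fixes s r u a :: real
  assumes s: "\<bar>s\<bar> = 1" and r: "0 \<le> r" and N: "0 < N"
  shows "P.prob {x. u \<le> s * component N 1 x} \<le>
    exp (- (real N / real m * (r * u - r\<^sup>2 / 2 * (exp (r * a) * (real m * msq 1)
        + exp (r * B) * (real m * (\<integral>t. (h1 t)\<^sup>2 * indicator {t. a < \<bar>h1 t\<bar>} t \<partial>P))))))"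
proof -
  let ?ell = "\<integral>t. (h1 t)\<^sup>2 * indicator {t. a < \<bar>h1 t\<bar>} t \<partial>P"
  define c where "c = exp (r * a) * msq 1 + exp (r * B) * ?ell"
  note [measurable] = h1_measurable
  have set: "{t. a < \<bar>h1 t\<bar>} \<in> sets P"
  proof -
    have "{t \<in> space P. a < \<bar>h1 t\<bar>} \<in> sets P" by measurable
    then show ?thesis by simp
  qed
  have i_ell: "integrable P (\<lambda>t. (h1 t)\<^sup>2 * indicator {t. a < \<bar>h1 t\<bar>} t)"
    using integrable_real_mult_indicator[OF set integrable_h1_power[of 2]] by simp
  have i_exp: "integrable P (\<lambda>t. exp (r * (s * h1 t)))"
  proof (rule M.integrable_const_bound[where B="exp (r * B)"])
    have "s * h1 t \<le> B" for t using h1_bounded[of t] s by (auto simp: abs_if split: if_splits)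
    then show "AE t in P. norm (exp (r * (s * h1 t))) \<le> exp (r * B)"
      using r by (auto intro!: mult_left_mono)
  qed measurable
  have s2: "s\<^sup>2 = 1" using s by (simp add: power2_eq_1_iff abs_if split: if_splits)
  \<comment> \<open>The second-order bound keeps the exact second moment; its factor exp |x| is at
    most exp(ra) up to the level a and at most exp(rB) beyond it.\<close>
  have mgf: "(\<integral>t. exp (r * (s * h1 t)) \<partial>P) \<le> exp (r\<^sup>2 / 2 * c)"
  proof -
    have "(\<integral>t. exp (r * (s * h1 t)) \<partial>P) \<le> (\<integral>t. 1 + r * s * h1 t + r\<^sup>2 / 2 *
        (exp (r * a) * (h1 t)\<^sup>2 + exp (r * B) * ((h1 t)\<^sup>2 * indicator {t. a < \<bar>h1 t\<bar>} t)) \<partial>P)"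
    proof (rule integral_mono)
      fix t
      have "\<bar>r * (s * h1 t)\<bar> = r * \<bar>h1 t\<bar>" using s r by (simp add: abs_mult)
      moreover have "(r * (s * h1 t))\<^sup>2 = r\<^sup>2 * (h1 t)\<^sup>2" by (simp add: power_mult_distrib s2)
      ultimately have 1: "exp (r * (s * h1 t)) \<le> 1 + r * (s * h1 t) + r\<^sup>2 * (h1 t)\<^sup>2 / 2 * exp (r * \<bar>h1 t\<bar>)"
        using exp_le_quadratic[of "r * (s * h1 t)"] by simp
      have "(h1 t)\<^sup>2 * exp (r * \<bar>h1 t\<bar>) \<le> exp (r * a) * (h1 t)\<^sup>2 + exp (r * B) * ((h1 t)\<^sup>2 * indicator {t. a < \<bar>h1 t\<bar>} t)"
      proof (cases "a < \<bar>h1 t\<bar>")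
        case True
        have "exp (r * \<bar>h1 t\<bar>) \<le> exp (r * B)" using h1_bounded r by (auto intro: mult_left_mono)
        then have "exp (r * \<bar>h1 t\<bar>) \<le> exp (r * a) + exp (r * B)" by (simp add: add_increasing)
        then have "(h1 t)\<^sup>2 * exp (r * \<bar>h1 t\<bar>) \<le> (h1 t)\<^sup>2 * (exp (r * a) + exp (r * B))"
          by (rule mult_left_mono) simp
        then show ?thesis using True by (simp add: algebra_simps)
      next
        case False
        then have "exp (r * \<bar>h1 t\<bar>) \<le> exp (r * a)" using r by (auto intro: mult_left_mono)
        then have "(h1 t)\<^sup>2 * exp (r * \<bar>h1 t\<bar>) \<le> (h1 t)\<^sup>2 * exp (r * a)" by (rule mult_left_mono) simp
        then show ?thesis using False by (simp add: algebra_simps)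
      qed
      then have "r\<^sup>2 / 2 * ((h1 t)\<^sup>2 * exp (r * \<bar>h1 t\<bar>)) \<le> r\<^sup>2 / 2 *
        (exp (r * a) * (h1 t)\<^sup>2 + exp (r * B) * ((h1 t)\<^sup>2 * indicator {t. a < \<bar>h1 t\<bar>} t))"
        by (rule mult_left_mono) simp
      then show "exp (r * (s * h1 t)) \<le> 1 + r * s * h1 t + r\<^sup>2 / 2 *
        (exp (r * a) * (h1 t)\<^sup>2 + exp (r * B) * ((h1 t)\<^sup>2 * indicator {t. a < \<bar>h1 t\<bar>} t))"
        using 1 by (simp add: mult.assoc)
    qed (use i_exp i_ell integrable_h1_power[of 1] integrable_h1_power[of 2] in auto)
    also have "\<dots> = 1 + r\<^sup>2 / 2 * c"
      using i_ell integrable_h1_power[of 1] integrable_h1_power[of 2]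
      by (simp add: h1_mean h1_square c_def M.prob_space[simplified])
    also have "\<dots> \<le> exp (r\<^sup>2 / 2 * c)" by (rule exp_ge_add_one_self)
    finally show ?thesis .
  qed
  \<comment> \<open>The Chernoff parameter of the whole component: its weight m/N per summand leaves
    exp(r s h1) for each variable.\<close>
  define \<theta> where "\<theta> = r * real N / real m"
  have prod: "(\<Prod>i=1..N. exp (r * (s * h1 (x i)))) = exp (\<theta> * (s * component N 1 x))" for x
    unfolding component_1 \<theta>_def using N m1 by (simp add: exp_sum[symmetric] sum_distrib_left)
  have int: "integrable S (\<lambda>x. \<Prod>i=1..N. exp (r * (s * h1 (x i))))"
    by (rule integrable_prod_coordinates) (use i_exp in auto)
  have "\<theta> \<ge> 0" using r by (simp add: \<theta>_def)
  then have "P.prob {x. u \<le> s * component N 1 x} \<le> E (\<lambda>x. \<Prod>i=1..N. exp (r * (s * h1 (x i)))) / exp (\<theta> * u)"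
    by (intro markov_E[OF int]) (auto simp only: prod exp_gt_zero exp_ge_zero exp_le_cancel_iff intro: mult_left_mono)
  also have "E (\<lambda>x. \<Prod>i=1..N. exp (r * (s * h1 (x i)))) = (\<integral>t. exp (r * (s * h1 t)) \<partial>P) ^ N"
    by (subst E_prod_coordinates) (use i_exp in auto)
  also have "\<dots> \<le> exp (r\<^sup>2 / 2 * c) ^ N" by (intro power_mono mgf integral_nonneg_AE) auto
  also have "\<dots> / exp (\<theta> * u) = exp (real N * (r\<^sup>2 / 2 * c) - \<theta> * u)"
    by (simp only: exp_diff exp_of_nat_mult)
  also have "real N * (r\<^sup>2 / 2 * c) - \<theta> * u = - (real N / real m * (r * u - r\<^sup>2 / 2 * (exp (r * a) * (real m * msq 1) + exp (r * B) * (real m * ?ell))))"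
    using m1 by (simp add: \<theta>_def c_def field_simps)
  finally show ?thesis by (simp add: divide_right_mono)
qed

text \<open>Testing the kernel against the density \<open>\<Prod>(1 + v(x\<^sub>i))\<close>, whose expansion meets only the
  projection of the same index set.\<close>

lemma tilt_bound:
  fixes v :: "'b \<Rightarrow> real"
  assumes v: "v \<in> borel_measurable P" "\<And>s. \<bar>v s\<bar> \<le> c" "\<And>s. - 1 \<le> v s" and v0: "integral\<^sup>L P v = 0"
  shows "\<bar>real m * (\<integral>s. h1 s * v s \<partial>P)\<bar> \<le>
    B + (\<Sum>j=2..m. real (m choose j) * sqrt (msq j * (\<integral>s. (v s)\<^sup>2 \<partial>P) ^ j))"
proof -
  let ?J = "{1..m}"
  note [measurable] = v(1)
  define \<tau> where "\<tau> = (\<integral>s. (v s)\<^sup>2 \<partial>P)"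
  define W where "W I x = (\<Prod>i\<in>I. v (x i))" for I and x :: "nat \<Rightarrow> 'b"
  have c0: "0 \<le> c" using v(2) by (meson abs_ge_zero order_trans)
  have v_int: "integrable P (\<lambda>s. v s ^ n)" for n
    using v by (intro M.integrable_const_bound[where B="c ^ n"]) (auto simp: power_abs intro!: power_mono)
  have Wm: "W I \<in> borel_measurable S" for I unfolding W_def[abs_def] by measurable
  have Wb: "\<bar>W I x\<bar> \<le> c ^ card I" for I x
  proof -
    have "\<bar>W I x\<bar> = (\<Prod>i\<in>I. \<bar>v (x i)\<bar>)" by (simp add: W_def abs_prod)
    also have "\<dots> \<le> (\<Prod>i\<in>I. c)" using v by (intro prod_mono) auto
    finally show ?thesis by simp
  qed
  have W2: "E (\<lambda>x. (W I x)\<^sup>2) = \<tau> ^ card I" "integrable S (\<lambda>x. (W I x)\<^sup>2)" if "finite I" for I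
  proof -
    have eq: "(W I x)\<^sup>2 = (\<Prod>i\<in>I. (v (x i))\<^sup>2)" for x by (simp add: W_def prod_power_distrib)
    show "E (\<lambda>x. (W I x)\<^sup>2) = \<tau> ^ card I" unfolding eq using that v_int[of 2]
      by (subst E_prod_coordinates) (auto simp: \<tau>_def)
    show "integrable S (\<lambda>x. (W I x)\<^sup>2)" unfolding eq using that v_int[of 2]
      by (intro integrable_prod_coordinates) auto
  qed
  have fin: "finite A" "card A \<le> m" if "A \<subseteq> ?J" for A using that card_mono[of ?J A] by (auto intro: finite_subset)
  have pW_int: "integrable S (\<lambda>x. proj A x * W I x)" if "A \<subseteq> ?J" for A I
  proof (rule integrable_bounded)
    show "(\<lambda>x. proj A x * W I x) \<in> borel_measurable S" using proj_measurable[OF fin[OF that]] Wm by measurable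
    show "\<bar>proj A x * W I x\<bar> \<le> (2 ^ card A * B) * c ^ card I" for x
      unfolding abs_mult using proj_bounded[OF fin[OF that]] Wb B_nonneg by (intro mult_mono) auto
  qed
  \<comment> \<open>An index in A only annihilates the mean by degeneracy, an index in I only
    because v has mean zero.\<close>
  have orth: "E (\<lambda>x. proj A x * W I x) = 0" if A: "A \<subseteq> ?J" and I: "I \<subseteq> ?J" and ne: "A \<noteq> I" for A I
  proof -
    consider a where "a \<in> A" "a \<notin> I" | a where "a \<in> I" "a \<notin> A" using ne by auto
    then show ?thesis
    proof cases
      case 1
      have "depends_on (- {a}) (W I)" unfolding W_def using 1(2) by (intro depends_onI prod.cong refl arg_cong[where f=v]) (metis ComplI singletonD)
      then show ?thesis
        by (intro E_degenerate_mult[OF proj_measurable[OF fin[OF A]] proj_bounded[OF fin[OF A]] Wm Wb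
              proj_degenerate[OF fin[OF A] 1(1)]])
    next
      case 2
      have "depends_on (- {a}) (proj A)" using proj_depends[OF fin[OF A]] 2(2) by (auto simp: depends_on_def)
      moreover have "E (\<lambda>y. W I (x(a := y a))) = 0" for x
      proof -
        have "W I (x(a := y a)) = W (I - {a}) x * v (y a)" for y
          unfolding W_def using fin[OF I] 2(1) by (subst prod.remove[of _ a]) (auto intro!: prod.cong)
        then show ?thesis using E_coordinate[of v a] v_int[of 1] v0 by simp
      qed
      ultimately have "E (\<lambda>x. W I x * proj A x) = 0"
        by (intro E_degenerate_mult[OF Wm Wb proj_measurable[OF fin[OF A]] proj_bounded[OF fin[OF A]]])
      then show ?thesis by (simp add: mult.commute)
    qed
  qed
  let ?D = "\<lambda>x. \<Prod>i\<in>?J. 1 + v (x i)"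
  have D: "?D x = (\<Sum>I\<in>Pow ?J. W I x)" for x
    using prod_add[of ?J "\<lambda>i. v (x i)" "\<lambda>_. 1"] by (simp add: W_def add.commute)
  have FD: "F ?J x * ?D x = (\<Sum>A\<in>Pow ?J. \<Sum>I\<in>Pow ?J. proj A x * W I x)" for x
    unfolding D by (subst F_eq_sum_proj) (auto simp: sum_product)
  have "E (\<lambda>x. F ?J x * ?D x) = (\<Sum>A\<in>Pow ?J. \<Sum>I\<in>Pow ?J. E (\<lambda>x. proj A x * W I x))"
    unfolding FD using pW_int
    by (subst Bochner_Integration.integral_sum) (auto intro!: sum.cong Bochner_Integration.integral_sum)
  also have "\<dots> = (\<Sum>A\<in>Pow ?J. \<Sum>I\<in>Pow ?J. if I = A then E (\<lambda>x. proj A x * W A x) else 0)"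
    using orth by (intro sum.cong refl) auto
  also have "\<dots> = (\<Sum>A\<in>Pow ?J. E (\<lambda>x. proj A x * W A x))" by (simp add: sum.delta)
  also have "\<dots> = (\<Sum>A | A \<subseteq> ?J \<and> card A \<in> {..m}. E (\<lambda>x. proj A x * W A x))"
    using fin by (intro sum.cong) auto
  also have "\<dots> = (\<Sum>j\<le>m. \<Sum>A | A \<subseteq> ?J \<and> card A = j. E (\<lambda>x. proj A x * W A x))"
    by (rule sum_by_card) auto
  also have "{..m} = insert 0 (insert 1 {2..m})" using m1 by auto
  also have "(\<Sum>j\<in>\<dots>. \<Sum>A | A \<subseteq> ?J \<and> card A = j. E (\<lambda>x. proj A x * W A x))
    = (\<Sum>A | A \<subseteq> ?J \<and> card A = 0. E (\<lambda>x. proj A x * W A x)) + ((\<Sum>A | A \<subseteq> ?J \<and> card A = 1. E (\<lambda>x. proj A x * W A x))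
      + (\<Sum>j=2..m. \<Sum>A | A \<subseteq> ?J \<and> card A = j. E (\<lambda>x. proj A x * W A x)))" by (simp del: One_nat_def)
  also have "(\<Sum>A | A \<subseteq> ?J \<and> card A = 0. E (\<lambda>x. proj A x * W A x)) = 0"
  proof (rule sum.neutral, rule ballI)
    fix A assume "A \<in> {A. A \<subseteq> ?J \<and> card A = 0}"
    then have "A = {}" using fin by auto
    then show "E (\<lambda>x. proj A x * W A x) = 0" by (simp add: proj_def F_empty)
  qed
  also have "(\<Sum>A | A \<subseteq> ?J \<and> card A = 1. E (\<lambda>x. proj A x * W A x)) = real m * (\<integral>s. h1 s * v s \<partial>P)"
  proof -
    have i: "integrable P (\<lambda>s. h1 s * v s)"
      using v h1_bounded h1_measurable B_nonneg
      by (intro M.integrable_const_bound[where B="B * c"]) (auto simp: abs_mult intro!: mult_mono)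
    have "E (\<lambda>x. proj A x * W A x) = (\<integral>s. h1 s * v s \<partial>P)" if A: "A \<in> {A. A \<subseteq> ?J \<and> card A = 1}" for A
    proof -
      obtain a where "A = {a}" using A by (auto simp: card_1_singleton_iff)
      then show ?thesis using E_coordinate(1)[OF i, of a] by (simp add: proj_singleton W_def)
    qed
    then show ?thesis by (simp add: n_subsets)
  qed
  finally have main: "E (\<lambda>x. F ?J x * ?D x) = real m * (\<integral>s. h1 s * v s \<partial>P) + (\<Sum>j=2..m. \<Sum>A | A \<subseteq> ?J \<and> card A = j. E (\<lambda>x. proj A x * W A x))"
    by simp
  \<comment> \<open>The product is a probability density: nonnegative since v \<ge> -1, and of mean
    1. The tilted mean of the kernel is therefore at most B in absolute value.\<close>
  have "0 \<le> 1 + v t" for t using v(3)[of t] by linarith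
  then have D0: "0 \<le> ?D x" for x by (intro prod_nonneg) simp
  have ED: "E ?D = 1" "integrable S ?D"
  proof -
    have i: "integrable P (\<lambda>s. 1 + v s)" using v_int[of 1] by simp
    have "(\<integral>s. 1 + v s \<partial>P) = 1" using v_int[of 1] v0 by (simp add: M.prob_space[simplified])
    then show "E ?D = 1" using E_prod_coordinates[of ?J "\<lambda>_ s. 1 + v s"] i by simp
    show "integrable S ?D" using i by (intro integrable_prod_coordinates) auto
  qed
  have FJ: "\<bar>F ?J x\<bar> \<le> B" for x by (rule F_bounded) auto
  have FD_int: "integrable S (\<lambda>x. F ?J x * ?D x)"
    unfolding FD using pW_int by (intro Bochner_Integration.integrable_sum) auto
  have "\<bar>E (\<lambda>x. F ?J x * ?D x)\<bar> \<le> E (\<lambda>x. \<bar>F ?J x * ?D x\<bar>)" by (rule integral_abs_bound)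
  also have "\<dots> \<le> E (\<lambda>x. B * ?D x)"
  proof (rule integral_mono)
    show "integrable S (\<lambda>x. \<bar>F ?J x * ?D x\<bar>)" by (rule integrable_abs[OF FD_int])
    show "integrable S (\<lambda>x. B * ?D x)" using ED by simp
    show "\<bar>F ?J x * ?D x\<bar> \<le> B * ?D x" for x
      unfolding abs_mult abs_of_nonneg[OF D0] using FJ D0 by (rule mult_right_mono)
  qed
  also have "\<dots> = B" using ED by simp
  finally have 1: "\<bar>E (\<lambda>x. F ?J x * ?D x)\<bar> \<le> B" .
  have 2: "\<bar>\<Sum>j=2..m. \<Sum>A | A \<subseteq> ?J \<and> card A = j. E (\<lambda>x. proj A x * W A x)\<bar> \<le> (\<Sum>j=2..m. real (m choose j) * sqrt (msq j * \<tau> ^ j))"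
  proof (rule order_trans[OF sum_abs sum_mono])
    fix j assume "j \<in> {2..m}"
    have "\<bar>\<Sum>A | A \<subseteq> ?J \<and> card A = j. E (\<lambda>x. proj A x * W A x)\<bar> \<le> (\<Sum>A | A \<subseteq> ?J \<and> card A = j. sqrt (msq j * \<tau> ^ j))"
    proof (rule order_trans[OF sum_abs sum_mono])
      fix A assume "A \<in> {A. A \<subseteq> ?J \<and> card A = j}"
      then have A: "A \<subseteq> ?J" "card A = j" by auto
      have "integrable S (\<lambda>x. (proj A x)\<^sup>2)"
        using proj_mult_integrable[OF fin[OF A(1)] fin[OF A(1)]] by (simp add: power2_eq_square)
      then show "\<bar>E (\<lambda>x. proj A x * W A x)\<bar> \<le> sqrt (msq j * \<tau> ^ j)"
        using P.expectation_mult_le_sqrt[of "proj A" "W A"] W2[OF fin(1)[OF A(1)]] pW_int[OF A(1)] E_proj_square[OF fin[OF A(1)]] A(2)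
        by simp
    qed
    then show "\<bar>\<Sum>A | A \<subseteq> ?J \<and> card A = j. E (\<lambda>x. proj A x * W A x)\<bar> \<le> real (m choose j) * sqrt (msq j * \<tau> ^ j)"
      by (simp add: n_subsets)
  qed
  show ?thesis using 1 2 main unfolding \<tau>_def by linarith
qed

end
end

section \<open>Tail bounds for a single degree\<close>

lemma power_le_fact_exp: "real j ^ j \<le> 3 ^ j * fact j"
proof -
  have "(\<Sum>n\<in>{j}. real j ^ n /\<^sub>R fact n) \<le> exp (real j)"
    unfolding exp_def by (intro sum_le_suminf summable_exp_generic) auto
  then have "real j ^ j / fact j \<le> exp (real j)" by (simp add: field_simps)
  also have "exp (real j) = exp 1 ^ j" by (simp add: exp_of_nat_mult[symmetric])
  also have "\<dots> \<le> 3 ^ j" by (intro power_mono exp_le) simp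
  finally show ?thesis by (simp add: field_simps)
qed

text \<open>This is m^j/j! with j! \<ge> (j/3)^j, where 3 replaces e.\<close>

lemma binomial_le_power:
  assumes "0 < j" shows "real (m choose j) \<le> (3 * real m / real j) ^ j"
proof -
  have "real (fact j * (m choose j)) \<le> real (m ^ j)"
    using binomial_fact_pow[of m j] by (subst of_nat_le_iff) (simp add: mult.commute)
  then have "fact j * real (m choose j) \<le> real m ^ j" by simp
  then have "3 ^ j * (fact j * real (m choose j)) \<le> 3 ^ j * real m ^ j"
    by (rule mult_left_mono) simp
  moreover have "real j ^ j * real (m choose j) \<le> 3 ^ j * fact j * real (m choose j)"
    by (intro mult_right_mono power_le_fact_exp) simp
  ultimately have "real j ^ j * real (m choose j) \<le> 3 ^ j * real m ^ j"
    by (simp only: mult.assoc)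
  then show ?thesis using assms by (simp add: power_divide power_mult_distrib field_simps)
qed

lemma power_add_le_two:
  fixes a b :: real
  assumes "0 \<le> a" "0 \<le> b"
  shows "(a + b) ^ Suc n \<le> 2 ^ n * (a ^ Suc n + b ^ Suc n)"
  using power_add_le_weighted[OF assms, of 1 1 "Suc n"] by (simp add: field_simps)

context sym_kernel
begin

text \<open>Markov's inequality for the moment of order 2k. \<open>G\<close> gathers the weights
  common to both terms, of which the first comes from the variance and the second from a single
  large block.\<close>

lemma component_tail:
  assumes j: "0 < j" "j \<le> m" "m \<le> N" and k: "k > 0" and x: "x > 0" and n: "n = N div j"
    and w: "E (\<lambda>z. ((symz {1..j} z)\<^sup>2) ^ k) \<le> w"
    and G: "G = (real (m choose j))\<^sup>2 * (2 * real k) ^ j / real (N choose j)"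
  shows "P.prob {y. x \<le> \<bar>component N j y\<bar>}
    \<le> (6 * 4 ^ j * (G * msq j) / x\<^sup>2) ^ k + 2 * (real n / real k) * (G * (real k / real n) / x\<^sup>2) ^ k * w"
proof -
  have jN: "j \<le> N" using j by simp
  have n0: "n > 0" using j n by (simp add: div_greater_zero_iff)
  define v where "v = E (\<lambda>z. (symz {1..j} z)\<^sup>2)"
  define H where "H = (6 * v) ^ k + 2 * (real k / real n) ^ (k - 1) * w"
  have v0: "0 \<le> v" by (simp add: v_def)
  have w0: "0 \<le> w" by (rule order_trans[OF _ w]) (simp add: integral_nonneg_AE)
  have H0: "0 \<le> H" using v0 w0 by (simp add: H_def)
  have bnd: "\<exists>b. \<forall>y. \<bar>component N j y\<bar> \<le> b"
  proof (intro exI allI)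
    fix y
    have "\<bar>chaos N j y\<bar> \<le> (\<Sum>I | I \<subseteq> {1..N} \<and> card I = j. \<bar>proj I y\<bar>)" unfolding chaos_def by (rule sum_abs)
    also have "\<dots> \<le> (\<Sum>I | I \<subseteq> {1..N} \<and> card I = j. 2 ^ j * B)"
    proof (rule sum_mono)
      fix I assume I: "I \<in> {I. I \<subseteq> {1..N} \<and> card I = j}"
      then have "finite I" "card I \<le> m" using j by (auto dest: subset_bounds)
      from proj_bounded[OF this, of y] I show "\<bar>proj I y\<bar> \<le> 2 ^ j * B" by simp
    qed
    finally show "\<bar>component N j y\<bar> \<le> real (m choose j) / real (N choose j) * (\<Sum>I | I \<subseteq> {1..N} \<and> card I = j. 2 ^ j * B)"
      unfolding component_def abs_mult by (intro mult_mono) auto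
  qed
  then obtain b where b: "\<And>y. \<bar>component N j y\<bar> \<le> b" by blast
  have int: "integrable S (\<lambda>y. component N j y ^ (2 * k))"
  proof (rule integrable_bounded)
    show "(\<lambda>y. component N j y ^ (2 * k)) \<in> borel_measurable S" using component_measurable[OF j(2), of N] by measurable
    show "\<bar>component N j y ^ (2 * k)\<bar> \<le> b ^ (2 * k)" for y unfolding power_abs by (intro power_mono b) simp
  qed
  have "P.prob {y. x \<le> \<bar>component N j y\<bar>} \<le> E (\<lambda>y. component N j y ^ (2 * k)) / x ^ (2 * k)"
  proof (rule markov_E[OF int])
    fix y assume "x \<le> \<bar>component N j y\<bar>"
    then have "x ^ (2 * k) \<le> \<bar>component N j y\<bar> ^ (2 * k)" using x by (intro power_mono) auto
    then show "x ^ (2 * k) \<le> component N j y ^ (2 * k)" by (simp add: power_even_abs)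
  qed (use x in auto)
  also have "E (\<lambda>y. component N j y ^ (2 * k)) = (real (m choose j) / real (N choose j)) ^ (2 * k) * E (\<lambda>y. chaos N j y ^ (2 * k))"
    unfolding component_def power_mult_distrib by simp
  also have "E (\<lambda>y. chaos N j y ^ (2 * k)) \<le> (2 * real k) ^ (j * k) * (real (N choose j) ^ k * H)"
  proof (rule order_trans[OF chaos_moment_le_rademacher[OF j(2) k]], rule mult_mono)
    show "(2 * real k - 1) ^ (j * k) \<le> (2 * real k) ^ (j * k)" using k by (intro power_mono) auto
    show "E (\<lambda>z. (\<Sum>J | J \<subseteq> {1..N} \<and> card J = j. (symz J z)\<^sup>2) ^ k) \<le> real (N choose j) ^ k * H"
      using symz_square_sum_moment[OF j(1,2) jN k n w] by (simp add: H_def v_def)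
  qed (auto intro!: integral_nonneg_AE AE_I2 zero_le_power[where n=k] sum_nonneg)
  also have "(real (m choose j) / real (N choose j)) ^ (2 * k) * ((2 * real k) ^ (j * k) * (real (N choose j) ^ k * H)) = G ^ k * H"
    using jN by (simp add: G power_mult power_mult_distrib power_divide power2_eq_square field_simps)
  finally have "P.prob {y. x \<le> \<bar>component N j y\<bar>} \<le> G ^ k * H / x ^ (2 * k)"
    using x by (simp add: divide_right_mono mult_left_mono)
  also have "\<dots> = (6 * v * G / x\<^sup>2) ^ k + 2 * (real k / real n) ^ (k - 1) * (G / x\<^sup>2) ^ k * w"
    unfolding power_mult by (simp add: H_def power_mult_distrib power_divide add_divide_distrib distrib_left mult_ac)
  \<comment> \<open>Completed to a k-th power, so that only the prefactor n/k stands
    outside.\<close>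
  also have "(real k / real n) ^ (k - 1) = (real n / real k) * (real k / real n) ^ k"
  proof -
    have "(real k / real n) ^ k = (real k / real n) * (real k / real n) ^ (k - 1)"
      using k by (metis power_eq_if not_gr_zero)
    then show ?thesis using n0 k by simp
  qed
  also have "2 * ((real n / real k) * (real k / real n) ^ k) * (G / x\<^sup>2) ^ k * w = 2 * (real n / real k) * (G * (real k / real n) / x\<^sup>2) ^ k * w"
    by (simp add: power_mult_distrib power_divide mult_ac)
  also have "(6 * v * G / x\<^sup>2) ^ k \<le> (6 * 4 ^ j * (G * msq j) / x\<^sup>2) ^ k"
  proof (intro power_mono divide_right_mono)
    have "v * G \<le> 4 ^ j * msq j * G"
      using E_symz_square_le[OF j(2)] by (intro mult_right_mono) (auto simp: v_def G)
    then show "6 * v * G \<le> 6 * 4 ^ j * (G * msq j)" by (simp add: mult_ac)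
  qed (use v0 in \<open>auto simp: G\<close>)
  finally show ?thesis by simp
qed

text \<open>Jensen over the second copy. It carries bounds on the symmetrized kernel over to the
  variance of the projection.\<close>

lemma msq_le_E_symz:
  assumes j: "j \<le> m"
  shows "msq j \<le> E (\<lambda>z. (symz {1..j} z)\<^sup>2)"
proof -
  let ?A = "{1..j}"
  have A: "finite ?A" "card ?A \<le> m" using j by auto
  have m: "(\<lambda>y. symd ?A x y) \<in> borel_measurable S" for x by (rule symd_measurable[OF A]) simp_all
  have m2: "(\<lambda>(x, y). (symd ?A x y)\<^sup>2) \<in> borel_measurable (S \<Otimes>\<^sub>M S)"
    using borel_measurable_power[OF symd_measurable[OF A measurable_fst measurable_snd], of 2] by (simp add: case_prod_beta')
  have b: "\<bar>(symd ?A x y)\<^sup>2\<bar> \<le> (2 ^ card ?A * B)\<^sup>2" for x y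
    unfolding power_abs by (intro power_mono symd_bounded A) simp
  have "msq j \<le> E (\<lambda>x. E (\<lambda>y. (symd ?A x y)\<^sup>2))"
    unfolding msq_def
  proof (rule integral_mono)
    show "integrable S (\<lambda>x. (proj ?A x)\<^sup>2)" using proj_mult_integrable[OF A A] by (simp add: power2_eq_square)
    show "integrable S (\<lambda>x. E (\<lambda>y. (symd ?A x y)\<^sup>2))"
      by (rule integrable_bounded[OF P.borel_measurable_lebesgue_integral[OF m2] E_bounded[OF borel_measurable_power[OF m] b]])
    show "(proj ?A x)\<^sup>2 \<le> E (\<lambda>y. (symd ?A x y)\<^sup>2)" for x
      using P.power_expectation_le[OF m[of x] symd_bounded[OF A, of x], of 1]
      by (simp only: proj_eq_E_symd[OF A] mult_1_right)
  qed
  also have "\<dots> = E (\<lambda>z. (symz ?A z)\<^sup>2)" unfolding symz_def by (rule pair_as_single[OF m2 b])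
  finally show ?thesis .
qed

text \<open>The product is expanded into one choice of copy per index; every term is then a product
  over distinct coordinates and its mean factorizes.\<close>

lemma E_symz_power_le:
  fixes \<psi> :: "'b \<Rightarrow> real"
  assumes j: "j \<le> m" and k: "k > 0" and D: "0 \<le> D" and \<psi>0: "\<And>s. 0 \<le> \<psi> s"
    and symd: "\<And>x y. \<bar>symd {1..j} x y\<bar> \<le> D * (\<Prod>i=1..j. \<psi> (x i) + \<psi> (y i))"
    and int: "integrable P (\<lambda>s. \<psi> s ^ (2 * k))" and \<kappa>: "(\<integral>s. \<psi> s ^ (2 * k) \<partial>P) \<le> \<kappa> ^ (2 * k)"
  shows "E (\<lambda>z. ((symz {1..j} z)\<^sup>2) ^ k) \<le> (D\<^sup>2 * (4 * \<kappa>\<^sup>2) ^ j) ^ k"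
proof -
  let ?A = "{1..j}"
  define q where "q s = \<psi> s ^ (2 * k)" for s
  define c where "c = (2::real) ^ (2 * k - 1)"
  have iq: "integrable P q" using int by (simp add: q_def[abs_def])
  have q0: "0 \<le> q s" for s by (simp add: q_def \<psi>0)
  \<comment> \<open>For a choice X, indices in X read the first copy and the others the
    second.\<close>
  define f where "f X i = (if i \<in> X then 2 * i else 2 * i + 1)" for X and i :: nat
  have inj: "inj (f X)" for X unfolding f_def inj_def by (auto split: if_splits; presburger)
  have k2: "2 * k = Suc (2 * k - 1)" using k by simp
  have pt: "((symz ?A z)\<^sup>2) ^ k \<le> D ^ (2 * k) * (c ^ j * (\<Sum>X\<in>Pow ?A. \<Prod>l\<in>f X ` ?A. q (z l)))" for z
  proof -
    have "((symz ?A z)\<^sup>2) ^ k = \<bar>symz ?A z\<bar> ^ (2 * k)" by (simp add: power_mult)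
    also have "\<dots> \<le> (D * (\<Prod>i\<in>?A. \<psi> (z (2 * i)) + \<psi> (z (2 * i + 1)))) ^ (2 * k)"
      using symd[of "even_part z" "odd_part z"] by (intro power_mono) (auto simp: symz_def even_part_def odd_part_def)
    also have "\<dots> = D ^ (2 * k) * (\<Prod>i\<in>?A. (\<psi> (z (2 * i)) + \<psi> (z (2 * i + 1))) ^ (2 * k))"
      by (simp add: power_mult_distrib prod_power_distrib)
    also have "\<dots> \<le> D ^ (2 * k) * (\<Prod>i\<in>?A. c * (q (z (2 * i)) + q (z (2 * i + 1))))"
    proof (intro mult_left_mono prod_mono conjI)
      fix i
      show "(\<psi> (z (2 * i)) + \<psi> (z (2 * i + 1))) ^ (2 * k) \<le> c * (q (z (2 * i)) + q (z (2 * i + 1)))"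
        using power_add_le_two[OF \<psi>0 \<psi>0, of "z (2 * i)" "z (2 * i + 1)" "2 * k - 1"] unfolding q_def c_def k2[symmetric] .
    qed (use D \<psi>0 in auto)
    also have "(\<Prod>i\<in>?A. c * (q (z (2 * i)) + q (z (2 * i + 1)))) = c ^ j * (\<Prod>i\<in>?A. q (z (2 * i)) + q (z (2 * i + 1)))"
      by (simp add: prod.distrib)
    also have "(\<Prod>i\<in>?A. q (z (2 * i)) + q (z (2 * i + 1))) = (\<Sum>X\<in>Pow ?A. (\<Prod>i\<in>X. q (z (2 * i))) * (\<Prod>i\<in>?A - X. q (z (2 * i + 1))))"
      by (rule prod_add) simp
    also have "\<dots> = (\<Sum>X\<in>Pow ?A. \<Prod>l\<in>f X ` ?A. q (z l))"
    proof (rule sum.cong[OF refl])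
      fix X assume X: "X \<in> Pow ?A"
      have "(\<Prod>l\<in>f X ` ?A. q (z l)) = (\<Prod>i\<in>?A. q (z (f X i)))"
        using inj_on_subset[OF inj] by (subst prod.reindex) auto
      also have "\<dots> = (\<Prod>i\<in>X. q (z (f X i))) * (\<Prod>i\<in>?A - X. q (z (f X i)))"
        using X by (subst prod.subset_diff[of X]) (auto simp: mult.commute)
      also have "\<dots> = (\<Prod>i\<in>X. q (z (2 * i))) * (\<Prod>i\<in>?A - X. q (z (2 * i + 1)))"
        by (intro arg_cong2[where f="(*)"] prod.cong) (auto simp: f_def)
      finally show "(\<Prod>i\<in>X. q (z (2 * i))) * (\<Prod>i\<in>?A - X. q (z (2 * i + 1))) = (\<Prod>l\<in>f X ` ?A. q (z l))" ..
    qed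
    finally show ?thesis .
  qed
  have ip: "integrable S (\<lambda>z. \<Prod>l\<in>f X ` ?A. q (z l))" for X
    using iq by (intro integrable_prod_coordinates) auto
  have Ep: "E (\<lambda>z. \<Prod>l\<in>f X ` ?A. q (z l)) = integral\<^sup>L P q ^ j" for X
    using iq card_image[OF inj_on_subset[OF inj[of X]], of ?A]
    by (subst E_prod_coordinates) auto
  have "E (\<lambda>z. ((symz ?A z)\<^sup>2) ^ k) \<le> E (\<lambda>z. D ^ (2 * k) * (c ^ j * (\<Sum>X\<in>Pow ?A. \<Prod>l\<in>f X ` ?A. q (z l))))"
  proof (rule integral_mono[OF _ _ pt])
    show "integrable S (\<lambda>z. D ^ (2 * k) * (c ^ j * (\<Sum>X\<in>Pow ?A. \<Prod>l\<in>f X ` ?A. q (z l))))"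
      by (intro integrable_mult_right Bochner_Integration.integrable_sum ip)
    have A: "finite ?A" "card ?A \<le> m" using j by auto
    show "integrable S (\<lambda>z. ((symz ?A z)\<^sup>2) ^ k)"
      unfolding power_mult[symmetric]
    proof (rule integrable_bounded)
      show "(\<lambda>z. symz ?A z ^ (2 * k)) \<in> borel_measurable S" using symz_measurable[OF A] by measurable
      show "\<bar>symz ?A z ^ (2 * k)\<bar> \<le> (2 ^ card ?A * B) ^ (2 * k)" for z
        unfolding power_abs by (intro power_mono symz_bounded A) simp
    qed
  qed
  also have "\<dots> = D ^ (2 * k) * (c ^ j * (\<Sum>X\<in>Pow ?A. integral\<^sup>L P q ^ j))"
    by (simp only: Bochner_Integration.integral_mult_right_zero Bochner_Integration.integral_sum[OF ip] Ep)
  also have "\<dots> = D ^ (2 * k) * ((2 * c) ^ j * integral\<^sup>L P q ^ j)"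
    by (simp add: card_Pow power_mult_distrib)
  also have "\<dots> \<le> D ^ (2 * k) * ((2 * c) ^ j * (\<kappa> ^ (2 * k)) ^ j)"
    using \<kappa> D q0 by (intro mult_left_mono power_mono) (auto simp: q_def[symmetric] c_def integral_nonneg_AE)
  \<comment> \<open>Per index there are two choices of copy and the convexity factor
    2^(2k-1).\<close>
  also have "2 * c = 4 ^ k"
  proof -
    have "2 * c = 2 ^ (2 * k)" unfolding c_def by (subst (2) k2) simp
    then show ?thesis by (simp add: power_mult)
  qed
  also have "D ^ (2 * k) * ((4 ^ k) ^ j * (\<kappa> ^ (2 * k)) ^ j) = (D\<^sup>2 * (4 * \<kappa>\<^sup>2) ^ j) ^ k"
    by (simp add: power_mult_distrib power_mult[symmetric] mult_ac)
  finally show ?thesis .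
qed

text \<open>Let g be the part of h1 beyond a on one side. The tilt u (g - \<mu>) raises the mean of
  the linear part by u m E g^2, while the tilted mean of the kernel is at most B and the higher
  degrees contribute at most 1. A large u therefore makes m E g^2 small.\<close>

lemma lindeberg_bound:
  assumes m1: "1 \<le> m" and a: "0 < a" and u: "0 < u" and um: "u * B\<^sup>2 \<le> a * real m"
    and sum: "(\<Sum>j=2..m. real (m choose j) * sqrt (msq j * (u\<^sup>2 * B\<^sup>2 / real m) ^ j)) \<le> 1"
  shows "real m * (\<integral>t. (h1 t)\<^sup>2 * indicator {t. a < \<bar>h1 t\<bar>} t \<partial>P) \<le> 2 * (B + 1) / u"
proof -
  note [measurable] = h1_measurable[OF m1]
  note hb = h1_bounded[OF m1] and hi = integrable_h1_power[OF m1]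
  have msq1: "msq 1 \<le> B\<^sup>2 / real m"
    using bessel_le[of 1] m1 by (simp add: field_simps)
  have half: "real m * (\<integral>t. (h1 t)\<^sup>2 * indicator {t. a < s * h1 t} t \<partial>P) \<le> (B + 1) / u"
    and half_int: "integrable P (\<lambda>t. (h1 t)\<^sup>2 * indicator {t. a < s * h1 t} t)" if s: "s = 1 \<or> s = -1" for s :: real
  proof -
    define g where "g t = s * h1 t * indicator {t. a < s * h1 t} t" for t
    define \<mu> where "\<mu> = integral\<^sup>L P g"
    define v where "v t = u * (g t - \<mu>)" for t
    have gm [measurable]: "g \<in> borel_measurable P" unfolding g_def by measurable
    have g0: "0 \<le> g t" and gB: "g t \<le> B" for t
      using hb[of t] s a B_nonneg by (auto simp: g_def indicator_def)
    have g2: "(g t)\<^sup>2 = (h1 t)\<^sup>2 * indicator {t. a < s * h1 t} t" for t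
      using s by (auto simp: g_def power_mult_distrib indicator_def)
    have gi: "integrable P (\<lambda>t. g t ^ n)" for n
      using g0 gB by (intro M.integrable_const_bound[where B="B ^ n"]) (auto intro!: power_mono)
    show "integrable P (\<lambda>t. (h1 t)\<^sup>2 * indicator {t. a < s * h1 t} t)" using gi[of 2] by (simp add: g2)
    have \<mu>0: "0 \<le> \<mu>" using g0 by (simp add: \<mu>_def integral_nonneg_AE)
    have gh: "(g t)\<^sup>2 \<le> (h1 t)\<^sup>2" for t by (simp add: g2 indicator_def)
    have ig2: "integral\<^sup>L P (\<lambda>t. (g t)\<^sup>2) \<le> B\<^sup>2 / real m"
      using integral_mono[OF gi[of 2] hi[of 2] gh] h1_square[OF m1] msq1 by simp
    \<comment> \<open>g vanishes or exceeds a, so a \<mu> \<le> E g^2 \<le> B^2/m; by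
      \<open>um\<close> this gives u \<mu> \<le> 1 and hence v \<ge> -1.\<close>
    have "a * g t \<le> (g t)\<^sup>2" for t
      using a by (auto simp: g_def indicator_def power2_eq_square intro!: mult_right_mono)
    then have "a * \<mu> \<le> integral\<^sup>L P (\<lambda>t. (g t)\<^sup>2)"
      using gi[of 1] gi[of 2] unfolding \<mu>_def by (subst integral_mult_right_zero[symmetric]) (intro integral_mono, auto)
    then have "a * \<mu> \<le> B\<^sup>2 / real m" using ig2 by simp
    then have "a * real m * \<mu> \<le> B\<^sup>2" using m1 by (simp add: field_simps)
    then have "u * (a * real m * \<mu>) \<le> u * B\<^sup>2" using u by (intro mult_left_mono) auto
    then have "(a * real m) * (u * \<mu>) \<le> (a * real m) * 1" using um by (simp add: mult_ac)
    then have u\<mu>: "u * \<mu> \<le> 1" using a m1 by (subst (asm) mult_le_cancel_left_pos) auto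
    have \<mu>B: "\<mu> \<le> B" unfolding \<mu>_def
      using integral_mono[of P g "\<lambda>_. B"] gi[of 1] gB by (simp add: M.prob_space[simplified])
    have vm: "v \<in> borel_measurable P" unfolding v_def by measurable
    have vb: "\<bar>v t\<bar> \<le> u * B" for t
      unfolding v_def abs_mult using u g0[of t] gB[of t] \<mu>0 \<mu>B by (intro mult_mono) auto
    have vl: "- 1 \<le> v t" for t
    proof -
      have "0 \<le> u * g t" using u g0 by simp
      then show ?thesis using u\<mu> by (simp add: v_def right_diff_distrib)
    qed
    have v0: "integral\<^sup>L P v = 0" unfolding v_def using gi[of 1]
      by (simp add: \<mu>_def M.prob_space[simplified])
    have v2: "(\<integral>t. (v t)\<^sup>2 \<partial>P) \<le> u\<^sup>2 * B\<^sup>2 / real m"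
    proof -
      have "(\<integral>t. (v t)\<^sup>2 \<partial>P) = (\<integral>t. u\<^sup>2 * ((g t)\<^sup>2 - 2 * \<mu> * g t + \<mu>\<^sup>2) \<partial>P)"
        by (intro Bochner_Integration.integral_cong) (auto simp: v_def power2_eq_square algebra_simps)
      also have "\<dots> = u\<^sup>2 * (integral\<^sup>L P (\<lambda>t. (g t)\<^sup>2) - \<mu>\<^sup>2)"
        using gi[of 1] gi[of 2] by (simp add: \<mu>_def[symmetric] M.prob_space[simplified] power2_eq_square)
      also have "\<dots> \<le> u\<^sup>2 * (B\<^sup>2 / real m)" using ig2 by (intro mult_left_mono) (auto intro: order_trans[rotated])
      finally show ?thesis by simp
    qed
    have hv: "(\<integral>t. h1 t * v t \<partial>P) = s * u * (\<integral>t. (g t)\<^sup>2 \<partial>P)"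
    proof -
      have "h1 t * v t = s * u * (g t)\<^sup>2 - u * \<mu> * h1 t" for t
        using s by (auto simp: v_def g_def power2_eq_square indicator_def algebra_simps)
      then show ?thesis using gi[of 2] hi[of 1] by (simp add: h1_mean[OF m1])
    qed
    have "\<bar>real m * (\<integral>t. h1 t * v t \<partial>P)\<bar> \<le> B + (\<Sum>j=2..m. real (m choose j) * sqrt (msq j * (\<integral>t. (v t)\<^sup>2 \<partial>P) ^ j))"
      by (rule tilt_bound[OF m1 vm vb vl v0])
    also have "\<dots> \<le> B + (\<Sum>j=2..m. real (m choose j) * sqrt (msq j * (u\<^sup>2 * B\<^sup>2 / real m) ^ j))"
      using v2 msq_nonneg
      by (intro add_left_mono sum_mono mult_left_mono real_sqrt_le_mono power_mono integral_nonneg_AE) auto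
    also have "\<dots> \<le> B + 1" using sum by simp
    finally have "real m * (u * (\<integral>t. (g t)\<^sup>2 \<partial>P)) \<le> B + 1"
      using s u by (auto simp: hv abs_mult integral_nonneg_AE)
    then show "real m * (\<integral>t. (h1 t)\<^sup>2 * indicator {t. a < s * h1 t} t \<partial>P) \<le> (B + 1) / u"
      using u by (simp add: g2[symmetric] field_simps)
  qed
  have "(h1 t)\<^sup>2 * indicator {t. a < \<bar>h1 t\<bar>} t = (h1 t)\<^sup>2 * indicator {t. a < 1 * h1 t} t + (h1 t)\<^sup>2 * indicator {t. a < -1 * h1 t} t" for t
    using a by (auto simp: indicator_def)
  then have "(\<integral>t. (h1 t)\<^sup>2 * indicator {t. a < \<bar>h1 t\<bar>} t \<partial>P) =
    (\<integral>t. (h1 t)\<^sup>2 * indicator {t. a < 1 * h1 t} t \<partial>P) + (\<integral>t. (h1 t)\<^sup>2 * indicator {t. a < -1 * h1 t} t \<partial>P)"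
    using half_int[of 1] half_int[of "-1"] by simp
  then show ?thesis using half[of 1] half[of "-1"] by (simp add: distrib_left add_divide_distrib)
qed

end

section \<open>The kernel of a U-statistic on the infinite product space\<close>

text \<open>The order in which \<open>U_stat\<close> feeds a set to the kernel, with positions
  counted from 1.\<close>

definition enum_set :: "nat set \<Rightarrow> nat \<Rightarrow> nat" where
  "enum_set A i = sorted_list_of_set A ! (i - 1)"

lemma bij_betw_enum_set:
  assumes "finite A" shows "bij_betw (enum_set A) {1..card A} A"
proof -
  have "bij_betw (\<lambda>i. i - 1) {1..card A} {..<length (sorted_list_of_set A)}"
    by (rule bij_betwI[where g=Suc]) (use assms in auto)
  moreover have "bij_betw ((!) (sorted_list_of_set A)) {..<length (sorted_list_of_set A)} A"
    using assms by (intro bij_betw_nth) auto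
  ultimately have "bij_betw ((!) (sorted_list_of_set A) \<circ> (\<lambda>i. i - 1)) {1..card A} A"
    by (rule bij_betw_trans)
  then show ?thesis by (simp add: enum_set_def[abs_def] comp_def)
qed

locale ustat_model = prob_space \<Omega> for \<Omega> :: "'a measure" +
  fixes X :: "nat \<Rightarrow> 'a \<Rightarrow> real" and h :: "(nat \<Rightarrow> real) \<Rightarrow> real" and N m :: nat and B :: real
  assumes m: "1 \<le> m" "m \<le> N"
    and indep: "indep_vars (\<lambda>_. borel) X {1..N}"
    and ident: "\<And>i. i \<in> {1..N} \<Longrightarrow> distr \<Omega> borel (X i) = distr \<Omega> borel (X 1)"
    and kernel: "symmetric_kernel m h"
    and centered: "expectation (\<lambda>\<omega>. scaled_kernel m h (\<lambda>i. X i \<omega>)) = 0"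
    and bounded: "\<And>x. x \<in> {1..m} \<rightarrow>\<^sub>E UNIV \<Longrightarrow> \<bar>h x\<bar> \<le> B"
begin

lemma X_measurable: "i \<in> {1..N} \<Longrightarrow> X i \<in> borel_measurable \<Omega>"
  using indep by (auto simp: indep_vars_def)

lemma distr_X: "distr \<Omega> (\<Pi>\<^sub>M i\<in>{1..N}. borel) (\<lambda>\<omega>. \<lambda>i\<in>{1..N}. X i \<omega>) = (\<Pi>\<^sub>M i\<in>{1..N}. distr \<Omega> borel (X i))"
  using indep m by (subst indep_vars_iff_distr_eq_PiM'[symmetric]) (auto simp: X_measurable)

lemma X1_measurable: "X 1 \<in> borel_measurable \<Omega>"
  using m by (intro X_measurable) auto

definition law :: "real measure" where "law = distr \<Omega> borel (X 1)"

lemma prob_space_law: "prob_space law"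
  unfolding law_def using m by (intro prob_space_distr X_measurable) auto

lemma sets_law [simp, measurable_cong]: "sets law = sets borel" by (simp add: law_def)

sublocale law: prob_space law by (rule prob_space_law)

sublocale iid_seq law
  by (intro_locales; unfold_locales) (simp add: law_def)

lemma sets_S [measurable_cong]: "sets S = sets (\<Pi>\<^sub>M i\<in>UNIV. borel)"
  by (rule sets_PiM_cong) auto

definition H :: "(nat \<Rightarrow> real) \<Rightarrow> real" where "H x = scaled_kernel m h x"

lemma H_measurable [measurable]: "H \<in> borel_measurable S"
proof -
  have [measurable]: "h \<in> borel_measurable (\<Pi>\<^sub>M i\<in>{1..m}. borel)" using kernel by (simp add: symmetric_kernel_def)
  have "(\<lambda>x i. if i \<in> {1..m} then x i / sqrt (real m) else undefined) \<in> S \<rightarrow>\<^sub>M (\<Pi>\<^sub>M i\<in>{1..m}. borel)"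
    by (rule measurable_PiM_single') auto
  then show ?thesis unfolding H_def[abs_def] scaled_kernel_def restrict_def by measurable
qed

lemma H_bounded: "\<bar>H x\<bar> \<le> B"
  unfolding H_def scaled_kernel_def by (rule bounded) auto

lemma H_depends: "depends_on {1..m} H"
  unfolding H_def scaled_kernel_def
  by (intro depends_onI arg_cong[where f=h]) (auto simp: restrict_def fun_eq_iff)

lemma H_permutes:
  assumes p: "p permutes {1..m}" shows "H (x \<circ> p) = H x"
proof -
  define y where "y = (\<lambda>i\<in>{1..m}. x i / sqrt (real m))"
  have "y \<in> {1..m} \<rightarrow>\<^sub>E UNIV" by (simp add: y_def)
  then have "h (\<lambda>i. y (p i)) = h y" using kernel p by (simp add: symmetric_kernel_def)
  moreover have "(\<lambda>i. y (p i)) = (\<lambda>i\<in>{1..m}. (x \<circ> p) i / sqrt (real m))"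
    using permutes_in_image[OF p] permutes_not_in[OF p] by (auto simp: y_def restrict_def fun_eq_iff)
  ultimately show ?thesis by (simp add: H_def scaled_kernel_def y_def)
qed

lemma glue_empty [simp]: "glue {} x y = y"
  by (simp add: glue_def fun_eq_iff)

text \<open>The N observations are padded to a point of the sequence space, where only functions of
  the first N coordinates are evaluated.\<close>

definition Y :: "'a \<Rightarrow> nat \<Rightarrow> real" where
  "Y \<omega> i = (if i \<in> {1..N} then X i \<omega> else 0)"

lemma Y_measurable: "Y \<in> \<Omega> \<rightarrow>\<^sub>M S"
proof (rule measurable_PiM_single')
  fix i
  show "(\<lambda>\<omega>. Y \<omega> i) \<in> \<Omega> \<rightarrow>\<^sub>M law"
  proof (cases "i \<in> {1..N}")
    case True
    then show ?thesis using X_measurable[OF True] by (simp add: Y_def measurable_cong_sets[OF refl sets_law])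
  next
    case False
    then have "Y \<omega> i = 0" for \<omega> unfolding Y_def by (rule if_not_P)
    then show ?thesis by simp
  qed
qed simp

text \<open>Independence with equal marginals means that the N observations have the product law;
  both sides are pushed forward from this finite product.\<close>

lemma distr_Y:
  fixes g :: "(nat \<Rightarrow> real) \<Rightarrow> real"
  assumes g: "g \<in> borel_measurable S" and dep: "depends_on {1..N} g"
  shows "distr \<Omega> borel (\<lambda>\<omega>. g (Y \<omega>)) = distr S borel g"
proof -
  let ?J = "{1..N}"
  let ?Q = "\<Pi>\<^sub>M i\<in>?J. law"
  define ext where "ext x i = (if i \<in> ?J then x i else 0)" for x :: "nat \<Rightarrow> real" and i
  have ext: "ext \<in> ?Q \<rightarrow>\<^sub>M S"
    unfolding ext_def[abs_def]
  proof (rule measurable_PiM_single')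
    fix i
    show "(\<lambda>x. if i \<in> ?J then x i else 0) \<in> ?Q \<rightarrow>\<^sub>M law" by (cases "i \<in> ?J") auto
  qed auto
  have gext: "(\<lambda>x. g (ext x)) \<in> borel_measurable ?Q" by (rule measurable_compose[OF ext g])
  have Qb: "sets (\<Pi>\<^sub>M i\<in>?J. borel) = sets ?Q" by (rule sets_PiM_cong) auto
  have XJ: "(\<lambda>\<omega>. \<lambda>i\<in>?J. X i \<omega>) \<in> \<Omega> \<rightarrow>\<^sub>M ?Q"
    by (rule measurable_restrict) (auto simp: X_measurable measurable_cong_sets[OF refl sets_law])
  have "distr \<Omega> ?Q (\<lambda>\<omega>. \<lambda>i\<in>?J. X i \<omega>) = distr \<Omega> (\<Pi>\<^sub>M i\<in>?J. borel) (\<lambda>\<omega>. \<lambda>i\<in>?J. X i \<omega>)"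
    by (rule distr_cong[OF refl Qb[symmetric] refl])
  also have "\<dots> = (\<Pi>\<^sub>M i\<in>?J. distr \<Omega> borel (X i))"
    by (rule distr_X)
  also have "\<dots> = ?Q" by (intro PiM_cong refl ident[folded law_def])
  also have "?Q = distr S ?Q (\<lambda>x. restrict x ?J)" by (rule distr_PiM_restrict_finite[symmetric]) auto
  finally have eq: "distr \<Omega> ?Q (\<lambda>\<omega>. \<lambda>i\<in>?J. X i \<omega>) = distr S ?Q (\<lambda>x. restrict x ?J)" .
  have 1: "g (Y \<omega>) = g (ext (\<lambda>i\<in>?J. X i \<omega>))" for \<omega>
    by (rule depends_onD[OF dep]) (simp add: Y_def ext_def)
  have 2: "g x = g (ext (restrict x ?J))" for x
    by (rule depends_onD[OF dep]) (simp add: ext_def)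
  have "distr \<Omega> borel (\<lambda>\<omega>. g (Y \<omega>)) = distr (distr \<Omega> ?Q (\<lambda>\<omega>. \<lambda>i\<in>?J. X i \<omega>)) borel (\<lambda>x. g (ext x))"
    by (subst distr_distr[OF gext XJ]) (simp add: 1 comp_def)
  also have "\<dots> = distr S borel (\<lambda>x. g (ext (restrict x ?J)))"
    unfolding eq by (subst distr_distr[OF gext]) (auto simp: comp_def)
  also have "(\<lambda>x. g (ext (restrict x ?J))) = g" using 2 by auto
  finally show ?thesis .
qed

lemma expectation_Y:
  fixes g :: "(nat \<Rightarrow> real) \<Rightarrow> real"
  assumes g: "g \<in> borel_measurable S" and dep: "depends_on {1..N} g"
  shows "integral\<^sup>L \<Omega> (\<lambda>\<omega>. g (Y \<omega>)) = E g"
proof -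
  have "integral\<^sup>L \<Omega> (\<lambda>\<omega>. g (Y \<omega>)) = integral\<^sup>L (distr \<Omega> borel (\<lambda>\<omega>. g (Y \<omega>))) (\<lambda>x. x)"
    using measurable_compose[OF Y_measurable g] by (subst integral_distr) auto
  also have "\<dots> = E g" unfolding distr_Y[OF g dep] using g by (subst integral_distr) auto
  finally show ?thesis .
qed

lemma prob_Y:
  fixes g :: "(nat \<Rightarrow> real) \<Rightarrow> real"
  assumes g: "g \<in> borel_measurable S" and dep: "depends_on {1..N} g"
  shows "measure \<Omega> {\<omega> \<in> space \<Omega>. c \<le> g (Y \<omega>)} = P.prob {x. c \<le> g x}"
proof -
  have "measure (distr \<Omega> borel (\<lambda>\<omega>. g (Y \<omega>))) {c..} = measure (distr S borel g) {c..}"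
    unfolding distr_Y[OF g dep] ..
  moreover have "measure (distr \<Omega> borel (\<lambda>\<omega>. g (Y \<omega>))) {c..} = measure \<Omega> {\<omega> \<in> space \<Omega>. c \<le> g (Y \<omega>)}"
    using measurable_compose[OF Y_measurable g] by (subst measure_distr) (auto intro!: arg_cong[where f="measure \<Omega>"])
  moreover have "measure (distr S borel g) {c..} = P.prob {x. c \<le> g x}"
    using g by (subst measure_distr) (auto simp: vimage_def)
  ultimately show ?thesis by simp
qed

lemma E_H: "E H = 0"
proof -
  have "depends_on {1..N} H" using H_depends m by (auto simp: depends_on_def)
  then have "E H = integral\<^sup>L \<Omega> (\<lambda>\<omega>. H (Y \<omega>))" by (simp add: expectation_Y)
  also have "\<dots> = integral\<^sup>L \<Omega> (\<lambda>\<omega>. H (\<lambda>i. X i \<omega>))"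
    by (intro Bochner_Integration.integral_cong refl depends_onD[OF H_depends]) (use m in \<open>auto simp: Y_def\<close>)
  finally show ?thesis using centered by (simp add: H_def)
qed

text \<open>The coordinates in A fill the first slots of the kernel and the remaining slots are
  averaged over fresh variables, which makes this the conditional mean.\<close>

definition F :: "nat set \<Rightarrow> (nat \<Rightarrow> real) \<Rightarrow> real" where
  "F A x = E (\<lambda>w. H (glue {1..card A} (x \<circ> enum_set A) w))"

text \<open>Two enumerations of A differ by a permutation of the first slots, under which the kernel
  is invariant.\<close>

lemma F_eq:
  assumes A: "finite A" "card A \<le> m" and e: "bij_betw e {1..card A} A"
  shows "F A x = E (\<lambda>w. H (glue {1..card A} (x \<circ> e) w))"
proof -
  let ?J = "{1..card A}"
  let ?g = "inv_into ?J (enum_set A)"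
  define p where "p i = (if i \<in> ?J then ?g (e i) else i)" for i
  note b = bij_betw_enum_set[OF A(1)]
  have "bij_betw (?g \<circ> e) ?J ?J" by (rule bij_betw_trans[OF e bij_betw_inv_into[OF b]])
  then have pb: "bij_betw p ?J ?J" by (rule bij_betw_cong[THEN iffD1, rotated]) (simp add: p_def)
  then have p: "p permutes ?J" by (rule bij_imp_permutes) (unfold p_def, rule if_not_P)
  then have "p permutes {1..m}" by (rule permutes_subset) (use A in auto)
  moreover have "enum_set A (p i) = e i" if "i \<in> ?J" for i
    unfolding p_def if_P[OF that] using that e by (intro bij_betw_inv_into_right[OF b]) (auto dest: bij_betwE)
  then have "glue ?J (x \<circ> e) w = glue ?J (x \<circ> enum_set A) w \<circ> p" for w
    using permutes_in_image[OF p] by (auto simp: glue_def fun_eq_iff p_def)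
  ultimately show ?thesis unfolding F_def by (simp add: H_permutes)
qed

lemma H_glue_measurable: "(\<lambda>w. H (glue D x w)) \<in> borel_measurable S"
  by (rule measurable_compose[OF measurable_glue'' H_measurable]) auto

lemma enum_set_in: "finite A \<Longrightarrow> i \<in> {1..card A} \<Longrightarrow> enum_set A i \<in> A"
  using bij_betw_enum_set[of A] by (auto simp: bij_betw_def)

sublocale sym_kernel law F m B
proof
  fix A :: "nat set" assume A: "finite A" "card A \<le> m"
  let ?J = "{1..card A}"
  show "F A \<in> borel_measurable S"
    unfolding F_def[abs_def]
  proof (rule P.borel_measurable_lebesgue_integral)
    show "(\<lambda>(x, w). H (glue ?J (x \<circ> enum_set A) w)) \<in> borel_measurable (S \<Otimes>\<^sub>M S)"
      using measurable_compose[OF measurable_glue[of ?J "enum_set A"] H_measurable] by (simp add: case_prod_beta')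
  qed
  show "\<bar>F A x\<bar> \<le> B" for x unfolding F_def by (rule E_bounded[OF H_glue_measurable H_bounded])
  show "depends_on A (F A)"
  proof (rule depends_onI)
    fix x y :: "nat \<Rightarrow> real" assume "\<And>i. i \<in> A \<Longrightarrow> x i = y i"
    then have "glue ?J (x \<circ> enum_set A) w = glue ?J (y \<circ> enum_set A) w" for w
      using enum_set_in[OF A(1)] by (auto simp: glue_def fun_eq_iff)
    then show "F A x = F A y" by (simp add: F_def)
  qed
  show "F (e ` A) x = F A (x \<circ> e)" if e: "inj_on e A" for e x
  proof -
    have c: "card (e ` A) = card A" by (rule card_image[OF e])
    have "bij_betw (e \<circ> enum_set A) ?J (e ` A)"
      by (rule bij_betw_trans[OF bij_betw_enum_set[OF A(1)]]) (use e in \<open>simp add: bij_betw_def\<close>)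
    then have "F (e ` A) x = E (\<lambda>w. H (glue ?J (x \<circ> (e \<circ> enum_set A)) w))"
      using F_eq[of "e ` A" "e \<circ> enum_set A" x] A c by simp
    then show ?thesis by (simp add: F_def comp_assoc)
  qed
  show "E (\<lambda>y. F A (glue C x y)) = F C x" if C: "C \<subseteq> A" for C x
  proof -
    have Cf: "finite C" "card C \<le> card A" using A C card_mono by (auto intro: finite_subset)
    let ?c = "{1..card C}"
    note b = bij_betw_enum_set[OF A(1)]
    have s: "enum_set A ` ?c \<subseteq> A" "card (enum_set A ` ?c) = card C"
      using b Cf by (auto simp: bij_betw_def card_image inj_on_subset)
    \<comment> \<open>Rearranges the enumeration of A so that it starts with C; averaging over A - C
      is then averaging over the slots just after the first |C|, an instance of
      \<open>E_glue\<close>.\<close>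
    obtain t where t: "t permutes A" "t ` enum_set A ` ?c = C"
      using ex_permutes_image[OF A(1) s(1) C] s(2) by metis
    define e where "e = t \<circ> enum_set A"
    have be: "bij_betw e ?J A" unfolding e_def by (rule bij_betw_trans[OF b permutes_imp_bij[OF t(1)]])
    have eC: "e ` ?c = C" using t(2) by (simp add: e_def image_comp)
    have inj: "inj_on e ?J" using be by (simp add: bij_betw_def)
    have bC: "bij_betw e ?c C" using eC inj_on_subset[OF inj] Cf by (auto simp: bij_betw_def)
    have nC: "e i \<notin> C" if i: "i \<in> {card C<..card A}" for i
    proof
      assume "e i \<in> C"
      then obtain l where l: "l \<in> ?c" "e i = e l" using eC by blast
      then have "i = l" using inj_onD[OF inj, of i l] i Cf by auto
      then show False using l i by auto
    qed
    have yC: "e i \<in> C" if "i \<in> ?c" for i using that eC by blast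
    let ?g = "\<lambda>z. H (glue ?c (x \<circ> e) z)"
    have "glue ?J (glue C x y \<circ> e) w = glue ?c (x \<circ> e) (glue {card C<..card A} (y \<circ> e) w)" for y w
    proof
      fix i
      consider "i \<in> ?c" | "i \<in> {card C<..card A}" | "i \<notin> ?J" using Cf by fastforce
      then show "glue ?J (glue C x y \<circ> e) w i = glue ?c (x \<circ> e) (glue {card C<..card A} (y \<circ> e) w) i"
        by cases (use Cf nC yC in \<open>auto simp: glue_def\<close>)
    qed
    then have "F A (glue C x y) = E (\<lambda>w. ?g (glue {card C<..card A} (y \<circ> e) w))" for y
      using F_eq[OF A be] by simp
    then have "E (\<lambda>y. F A (glue C x y)) = E (\<lambda>y. E (\<lambda>w. ?g (glue {card C<..card A} (y \<circ> e) w)))"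
      by simp
    also have "\<dots> = E ?g"
    proof (rule E_glue[symmetric])
      show "inj_on e {card C<..card A}" by (rule inj_on_subset[OF inj]) auto
      show "integrable S ?g" by (rule integrable_bounded[OF H_glue_measurable H_bounded])
    qed
    also have "\<dots> = F C x" using F_eq[OF Cf(1) _ bC] Cf A by simp
    finally show ?thesis .
  qed
next
  show "F {} x = 0" for x
    using E_H by (simp add: F_def)
qed

lemma F_interval:
  assumes "j \<le> m" shows "F {1..j} x = E (\<lambda>w. H (glue {1..j} x w))"
  using F_eq[of "{1..j}" id x] assms by (simp add: bij_betw_def)

lemma kernel_mean_eq:
  assumes "j \<le> m" shows "kernel_mean \<Omega> m h X j x = F {1..j} x"
proof -
  have eq: "H (\<lambda>i. if i \<le> j then x i else X i \<omega>) = H (glue {1..j} x (Y \<omega>))" for \<omega>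
    by (rule depends_onD[OF H_depends]) (use m in \<open>auto simp: glue_def Y_def\<close>)
  have "depends_on {1..N} (\<lambda>w. H (glue {1..j} x w))"
    using m by (intro depends_onI depends_onD[OF H_depends]) (auto simp: glue_def)
  then have "integral\<^sup>L \<Omega> (\<lambda>\<omega>. H (glue {1..j} x (Y \<omega>))) = E (\<lambda>w. H (glue {1..j} x w))"
    by (intro expectation_Y[OF H_glue_measurable])
  then show ?thesis unfolding kernel_mean_def H_def[symmetric] eq F_interval[OF assms] .
qed

lemma hoeffding_proj1_eq: "hoeffding_proj1 \<Omega> m h X s = h1 s"
proof -
  have eq: "H (\<lambda>i. if i = 1 then s else X i \<omega>) = H (glue {1..1} (\<lambda>_. s) (Y \<omega>))" for \<omega>
    by (rule depends_onD[OF H_depends]) (use m in \<open>auto simp: glue_def Y_def\<close>)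
  have "depends_on {1..N} (\<lambda>w. H (glue {1..1} (\<lambda>_. s) w))"
    using m by (intro depends_onI depends_onD[OF H_depends]) (auto simp: glue_def)
  then have "integral\<^sup>L \<Omega> (\<lambda>\<omega>. H (glue {1..1} (\<lambda>_. s) (Y \<omega>))) = E (\<lambda>w. H (glue {1..1} (\<lambda>_. s) w))"
    by (intro expectation_Y[OF H_glue_measurable])
  then have "integral\<^sup>L \<Omega> (\<lambda>\<omega>. H (glue {1..1} (\<lambda>_. s) (Y \<omega>))) = h1 s"
    unfolding F_interval[OF m(1), symmetric] by (simp add: h1_def)
  then show ?thesis unfolding hoeffding_proj1_def H_def[symmetric] eq .
qed

lemma proj1_variance_eq: "proj1_variance \<Omega> m h X = real m * msq 1"
proof -
  have [measurable]: "X 1 \<in> borel_measurable \<Omega>" by (rule X1_measurable)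
  have [measurable]: "h1 \<in> borel_measurable borel" using h1_measurable[OF m(1)] by (simp add: measurable_cong_sets[OF sets_law refl])
  have "integral\<^sup>L \<Omega> (\<lambda>\<omega>. h1 (X 1 \<omega>)) = integral\<^sup>L law h1" unfolding law_def by (subst integral_distr) (use X1_measurable in auto)
  then have mean: "integral\<^sup>L \<Omega> (\<lambda>\<omega>. sqrt (real m) * h1 (X 1 \<omega>)) = 0" by (simp add: h1_mean[OF m(1)])
  have "proj1_variance \<Omega> m h X = integral\<^sup>L \<Omega> (\<lambda>\<omega>. (sqrt (real m) * h1 (X 1 \<omega>))\<^sup>2)"
    unfolding proj1_variance_def hoeffding_proj1_eq mean by simp
  also have "\<dots> = real m * integral\<^sup>L \<Omega> (\<lambda>\<omega>. (h1 (X 1 \<omega>))\<^sup>2)" by (simp add: power_mult_distrib)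
  also have "integral\<^sup>L \<Omega> (\<lambda>\<omega>. (h1 (X 1 \<omega>))\<^sup>2) = integral\<^sup>L law (\<lambda>s. (h1 s)\<^sup>2)"
    unfolding law_def by (subst integral_distr) (use X1_measurable in auto)
  finally show ?thesis by (simp add: h1_square[OF m(1)])
qed

lemma ustat_depends: "depends_on {1..N} (ustat N)"
proof (rule depends_onI)
  fix x y :: "nat \<Rightarrow> real" assume xy: "\<And>i. i \<in> {1..N} \<Longrightarrow> x i = y i"
  have "F J x = F J y" if "J \<in> {J. J \<subseteq> {1..N} \<and> card J = m}" for J
    using that xy by (intro depends_onD[OF F_depends]) (auto dest: subset_bounds)
  then show "ustat N x = ustat N y" by (simp add: ustat_def)
qed

lemma ustat_measurable: "ustat N \<in> borel_measurable S"
proof -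
  have "F J \<in> borel_measurable S" if "J \<in> {J. J \<subseteq> {1..N} \<and> card J = m}" for J
    using that by (intro F_measurable) (auto dest: subset_bounds)
  then show ?thesis unfolding ustat_def[abs_def]
    by (intro borel_measurable_divide borel_measurable_sum borel_measurable_const)
qed

lemma U_stat_eq: "U_stat N m h X \<omega> = ustat N (Y \<omega>)"
proof -
  have "scaled_kernel m h (\<lambda>i. X (sorted_list_of_set J ! (i - 1)) \<omega>) = F J (Y \<omega>)"
    if J: "J \<in> {J. J \<subseteq> {1..N} \<and> card J = m}" for J
  proof -
    have fJ: "finite J" using J by (auto dest: subset_bounds)
    have "F J (Y \<omega>) = E (\<lambda>w. H (glue {1..m} (Y \<omega> \<circ> enum_set J) w))" using J by (simp add: F_def)
    also have "\<dots> = E (\<lambda>w. H (\<lambda>i. X (enum_set J i) \<omega>))"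
    proof (intro Bochner_Integration.integral_cong refl depends_onD[OF H_depends])
      fix w i assume i: "i \<in> {1..m}"
      then have "enum_set J i \<in> {1..N}" using enum_set_in[OF fJ, of i] J by auto
      then show "glue {1..m} (Y \<omega> \<circ> enum_set J) w i = X (enum_set J i) \<omega>" using i by (simp add: glue_def Y_def)
    qed
    finally show ?thesis by (simp add: H_def enum_set_def)
  qed
  then show ?thesis by (simp add: U_stat_def ustat_def)
qed

lemma U_stat_tail:
  "measure \<Omega> {\<omega> \<in> space \<Omega>. c \<le> \<bar>U_stat N m h X \<omega>\<bar>} = P.prob {x. c \<le> \<bar>ustat N x\<bar>}"
proof -
  have "depends_on {1..N} (\<lambda>x. \<bar>ustat N x\<bar>)"
    by (intro depends_onI arg_cong[where f=abs] depends_onD[OF ustat_depends])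
  then show ?thesis unfolding U_stat_eq using ustat_measurable by (intro prob_Y) auto
qed

text \<open>A common centre c separates the two copies, so that only central moments of one variable
  enter later.\<close>

lemma symd_le:
  assumes j: "j \<le> m" and ex: "mixed_partials_exist j (kernel_mean \<Omega> m h X j)"
    and D: "\<And>x. \<bar>mixed_partial 1 j (kernel_mean \<Omega> m h X j) x\<bar> \<le> D"
  shows "\<bar>symd {1..j} x y\<bar> \<le> D * (\<Prod>i=1..j. \<bar>x i - c\<bar> + \<bar>y i - c\<bar>)"
proof -
  have "kernel_mean \<Omega> m h X j = F {1..j}" using kernel_mean_eq[OF j] by (simp add: fun_eq_iff)
  then have "\<bar>symd {1..j} x y\<bar> \<le> D * (\<Prod>i=1..j. \<bar>x i - y i\<bar>)"
    unfolding symd_def using alt_sum_diff_le[OF ex D, of x y] by simp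
  also have "\<dots> \<le> D * (\<Prod>i=1..j. \<bar>x i - c\<bar> + \<bar>y i - c\<bar>)"
    using D[of undefined] by (intro mult_left_mono prod_mono) auto
  finally show ?thesis .
qed

end

section \<open>Tail bounds under smoothness\<close>

locale smooth_model = ustat_model +
  fixes jmax :: nat and C1 \<gamma> M :: real
  assumes jmax: "2 \<le> jmax" "jmax \<le> m" and C1: "0 < C1" and \<gamma>: "0 \<le> \<gamma>" and M: "0 < M" and B1: "1 \<le> B"
    and smooth: "\<And>j. 2 \<le> j \<Longrightarrow> j \<le> jmax \<Longrightarrow> mixed_partials_exist j (kernel_mean \<Omega> m h X j)"
    and deriv_bound: "\<And>j x. 2 \<le> j \<Longrightarrow> j \<le> jmax \<Longrightarrow>
      \<bar>mixed_partial 1 j (kernel_mean \<Omega> m h X j) x\<bar> \<le> (C1 / real m) powr (real j / 2) * real j powr (real j / 2)"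
    and integrable_moments: "\<And>k. 2 \<le> k \<Longrightarrow> integrable \<Omega> (\<lambda>\<omega>. \<bar>X 1 \<omega> - integral\<^sup>L \<Omega> (X 1)\<bar> ^ k)"
    and moment_bound: "\<And>k. 2 \<le> k \<Longrightarrow>
      (\<integral>\<omega>. \<bar>X 1 \<omega> - integral\<^sup>L \<Omega> (X 1)\<bar> ^ k \<partial>\<Omega>) powr (1 / real k) \<le> real k powr \<gamma> * M"
begin

text \<open>The squared derivative bound is (C1 j/m)^j, and each of the j coordinates adds a squared
  central norm of order 2k with a factor 4.\<close>

lemma E_symz_power_smooth:
  assumes j: "2 \<le> j" "j \<le> jmax" and k: "k > 0"
  shows "E (\<lambda>z. ((symz {1..j} z)\<^sup>2) ^ k) \<le> ((4 * C1 * real j / real m * (real (2 * k) powr \<gamma> * M)\<^sup>2) ^ j) ^ k"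
proof -
  define D where "D = (C1 / real m) powr (real j / 2) * real j powr (real j / 2)"
  define c where "c = integral\<^sup>L \<Omega> (X 1)"
  define \<kappa> where "\<kappa> = real (2 * k) powr \<gamma> * M"
  have jm: "j \<le> m" using j jmax by simp
  have k2: "2 \<le> 2 * k" using k by simp
  have mb: "(\<lambda>s. \<bar>s - c\<bar> ^ (2 * k)) \<in> borel_measurable borel" by measurable
  have "integrable (distr \<Omega> borel (X 1)) (\<lambda>s. \<bar>s - c\<bar> ^ (2 * k))"
    using integrable_moments[OF k2] by (subst integrable_distr_eq[OF X1_measurable mb]) (simp add: c_def)
  then have int: "integrable law (\<lambda>s. \<bar>s - c\<bar> ^ (2 * k))" by (simp add: law_def)
  have eq: "(\<integral>s. \<bar>s - c\<bar> ^ (2 * k) \<partial>law) = (\<integral>\<omega>. \<bar>X 1 \<omega> - c\<bar> ^ (2 * k) \<partial>\<Omega>)" (is "?I = ?I'")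
    unfolding law_def by (rule integral_distr[OF X1_measurable mb])
  have I0: "0 \<le> ?I'" by simp
  have "?I = ?I'" by (rule eq)
  also have "?I' = (?I' powr (1 / real (2 * k))) powr real (2 * k)" using I0 k by (simp add: powr_powr)
  also have "\<dots> \<le> \<kappa> powr real (2 * k)"
    using moment_bound[OF k2] unfolding \<kappa>_def c_def by (intro powr_mono2) auto
  also have "\<dots> = \<kappa> ^ (2 * k)" using M k by (intro powr_realpow) (auto simp: \<kappa>_def)
  finally have \<kappa>: "?I \<le> \<kappa> ^ (2 * k)" .
  have "E (\<lambda>z. ((symz {1..j} z)\<^sup>2) ^ k) \<le> (D\<^sup>2 * (4 * \<kappa>\<^sup>2) ^ j) ^ k"
  proof (rule E_symz_power_le[OF jm k _ _ _ int \<kappa>])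
    show "\<bar>symd {1..j} x y\<bar> \<le> D * (\<Prod>i=1..j. \<bar>x i - c\<bar> + \<bar>y i - c\<bar>)" for x y
      using j unfolding D_def by (intro symd_le[OF jm smooth deriv_bound]) auto
  qed (auto simp: D_def)
  also have "D\<^sup>2 = (C1 / real m * real j) ^ j"
  proof -
    have "(x powr (real j / 2))\<^sup>2 = x ^ j" if "x > 0" for x
      using that by (simp add: powr_power powr_realpow)
    then show ?thesis using C1 jm j by (simp add: D_def power_mult_distrib power_divide)
  qed
  also have "(C1 / real m * real j) ^ j * (4 * \<kappa>\<^sup>2) ^ j = (4 * C1 * real j / real m * \<kappa>\<^sup>2) ^ j"
    unfolding power_mult_distrib[symmetric] by (simp add: mult_ac)
  finally show ?thesis by (simp add: \<kappa>_def)
qed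

text \<open>The case k = 1: the estimate (3m/j)^j of the binomial coefficient cancels (j/m)^j from
  the derivative bound.\<close>

lemma variance_smooth:
  assumes j: "2 \<le> j" "j \<le> jmax"
  shows "real (m choose j) * msq j \<le> (12 * C1 * (2 powr \<gamma> * M)\<^sup>2) ^ j"
proof -
  have jm: "j \<le> m" using j jmax by simp
  have "msq j \<le> (4 * C1 * real j / real m * (2 powr \<gamma> * M)\<^sup>2) ^ j"
    using msq_le_E_symz[OF jm] E_symz_power_smooth[OF j, of 1] by simp
  then have "real (m choose j) * msq j \<le> (3 * real m / real j) ^ j * (4 * C1 * real j / real m * (2 powr \<gamma> * M)\<^sup>2) ^ j"
    using binomial_le_power[of j m] j msq_nonneg by (intro mult_mono) auto
  also have "\<dots> = (12 * C1 * (2 powr \<gamma> * M)\<^sup>2) ^ j"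
    unfolding power_mult_distrib[symmetric] using j jm by (simp add: field_simps)
  finally show ?thesis .
qed

text \<open>The deviation level is sqrt y, of which degree j is allotted the share \<eta>/2^j;
  moments of order 2k are used.\<close>

context
  fixes t K \<eta> y :: real and k :: nat
  assumes t: "2 \<le> t" and K: "1 \<le> K" and \<eta>: "0 < \<eta>" "\<eta> < 1" and y: "y = t * real m / real N"
    and k: "K * t \<le> real k" "real k \<le> 2 * K * t"
begin

lemma k_pos: "k > 0"
proof -
  have "0 < K * t" using t K by simp
  then show ?thesis using k(1) by simp
qed

lemma y_pos: "0 < y" using t m by (simp add: y)

lemma N_pos: "0 < N" using m by simp

lemma G_le:
  assumes j: "1 \<le> j" "j \<le> m"
  shows "(real (m choose j))\<^sup>2 * (2 * real k) ^ j / real (N choose j) \<le> (4 * K * y) ^ j * real (m choose j)"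
proof -
  have jN: "j \<le> N" using j m by simp
  have "(real (m choose j))\<^sup>2 * (2 * real k) ^ j / real (N choose j) =
      real (m choose j) / real (N choose j) * (2 * real k) ^ j * real (m choose j)"
    by (simp add: power2_eq_square)
  also have "\<dots> \<le> (real m / real N) ^ j * (4 * K * t) ^ j * real (m choose j)"
    using binomial_ratio_le[OF m(2) N_pos, of j] power_mono[of "2 * real k" "4 * K * t" j] k
    by (intro mult_right_mono mult_mono) auto
  also have "\<dots> = (4 * K * y) ^ j * real (m choose j)"
    by (simp add: y power_mult_distrib power_divide)
  finally show ?thesis .
qed

lemma x_square: "(\<eta> / 2 ^ j * sqrt y)\<^sup>2 = \<eta>\<^sup>2 / 4 ^ j * y"
proof -
  have "((2::real) ^ j)\<^sup>2 = 4 ^ j" by (simp add: power2_eq_square power_mult_distrib[symmetric])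
  then show ?thesis using y_pos by (simp add: power_mult_distrib power_divide)
qed

text \<open>64 is 4 from \<open>E_symz_square_le\<close> times 4 from the squared share times 4 from
  \<open>G_le\<close>.\<close>

lemma variance_term_le:
  assumes j: "1 \<le> j" "j \<le> m" and \<beta>: "real (m choose j) * msq j \<le> \<beta>"
  shows "6 * 4 ^ j * ((real (m choose j))\<^sup>2 * (2 * real k) ^ j / real (N choose j) * msq j) / (\<eta> / 2 ^ j * sqrt y)\<^sup>2
    \<le> 6 * (64 * K * y) ^ j * \<beta> / (\<eta>\<^sup>2 * y)"
proof -
  let ?G = "(real (m choose j))\<^sup>2 * (2 * real k) ^ j / real (N choose j)"
  have K0: "0 \<le> 4 * K * y" using K y_pos by simp
  have "?G * msq j \<le> (4 * K * y) ^ j * real (m choose j) * msq j"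
    by (intro mult_right_mono G_le j msq_nonneg)
  also have "\<dots> \<le> (4 * K * y) ^ j * \<beta>" unfolding mult.assoc using K0 by (intro mult_left_mono \<beta>) auto
  finally have "6 * 4 ^ j * (?G * msq j) / (\<eta>\<^sup>2 / 4 ^ j * y) \<le> 6 * 4 ^ j * ((4 * K * y) ^ j * \<beta>) / (\<eta>\<^sup>2 / 4 ^ j * y)"
    using y_pos by (intro divide_right_mono mult_left_mono) auto
  also have "\<dots> = 6 * ((4 * 4) ^ j * (4 * K * y) ^ j) * \<beta> / (\<eta>\<^sup>2 * y)"
    unfolding power_mult_distrib[of 4 4] by simp
  also have "(4 * 4) ^ j * (4 * K * y) ^ j = (64 * K * y) ^ j"
    unfolding power_mult_distrib[symmetric] by (simp add: mult_ac)
  finally show ?thesis by (simp only: x_square)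
qed

text \<open>Since N div j \<ge> N/(2j), the factor k/n is at most 4Ky and cancels the y of the
  squared level.\<close>

lemma sup_term_le:
  assumes j: "1 \<le> j" "j \<le> m"
  shows "(real (m choose j))\<^sup>2 * (2 * real k) ^ j / real (N choose j) * (real k / real (N div j)) / (\<eta> / 2 ^ j * sqrt y)\<^sup>2
    \<le> (24 * real k * (real m)\<^sup>2 / (real N * real j)) ^ j * (4 * K / \<eta>\<^sup>2)"
proof -
  let ?G = "(real (m choose j))\<^sup>2 * (2 * real k) ^ j / real (N choose j)"
  have jN: "j \<le> N" using j m by simp
  have "?G = real (m choose j) / real (N choose j) * (2 * real k) ^ j * real (m choose j)"
    by (simp add: power2_eq_square)
  also have "\<dots> \<le> (real m / real N) ^ j * (2 * real k) ^ j * (3 * real m / real j) ^ j"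
    using binomial_ratio_le[OF m(2) N_pos, of j] binomial_le_power[of j m] j by (intro mult_mono) auto
  also have "\<dots> = (6 * real k * (real m)\<^sup>2 / (real N * real j)) ^ j"
    unfolding power_mult_distrib[symmetric] by (simp add: power2_eq_square mult_ac)
  finally have G: "?G \<le> (6 * real k * (real m)\<^sup>2 / (real N * real j)) ^ j" .
  have n: "real N \<le> 2 * real j * real (N div j)"
  proof -
    have "N div j \<ge> 1" using j jN by (simp add: div_greater_zero_iff Suc_le_eq)
    then have "j \<le> j * (N div j)" by simp
    moreover have "N < j + j * (N div j)" using j mult_div_mod_eq[of j N] mod_less_divisor[of j N] by linarith
    ultimately have "N \<le> 2 * j * (N div j)" by linarith
    then have "real N \<le> real (2 * j * (N div j))" by (simp only: of_nat_le_iff)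
    then show ?thesis by simp
  qed
  have n0: "real (N div j) > 0" using j jN by (simp add: div_greater_zero_iff)
  have "real k / real (N div j) \<le> 2 * K * t / (real N / (2 * real j))"
    using k n n0 j N_pos K t by (intro frac_le) (auto simp: field_simps)
  also have "\<dots> = 4 * real j * K * t / real N" using j N_pos by (simp add: field_simps)
  also have "\<dots> \<le> 4 * real m * K * t / real N" using j K t by (intro divide_right_mono mult_right_mono) auto
  also have "\<dots> = 4 * K * y" by (simp add: y)
  finally have kn: "real k / real (N div j) \<le> 4 * K * y" .
  have "?G * (real k / real (N div j)) / (\<eta>\<^sup>2 / 4 ^ j * y) \<le>
    (6 * real k * (real m)\<^sup>2 / (real N * real j)) ^ j * (4 * K * y) / (\<eta>\<^sup>2 / 4 ^ j * y)"
    using G kn y_pos by (intro divide_right_mono mult_mono) auto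
  also have "\<dots> = (4 ^ j * (6 * real k * (real m)\<^sup>2 / (real N * real j)) ^ j) * (4 * K / \<eta>\<^sup>2)"
    using y_pos \<eta> by (simp add: field_simps)
  also have "4 ^ j * (6 * real k * (real m)\<^sup>2 / (real N * real j)) ^ j = (24 * real k * (real m)\<^sup>2 / (real N * real j)) ^ j"
    unfolding power_mult_distrib[symmetric] by (simp add: mult_ac)
  finally show ?thesis by (simp only: x_square)
qed

text \<open>Here j disappears: per degree, 24 k m^2/(N j) from the weights times 4 C1 j \<kappa>^2/m
  from the kernel is 48 C1 r.\<close>

lemma component_tail_smooth:
  assumes j: "2 \<le> j" "j \<le> jmax" and \<beta>: "real (m choose j) * msq j \<le> \<beta>"
    and r: "r = real (2 * k) * (real (2 * k) powr \<gamma> * M)\<^sup>2 * real m / real N"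
  shows "P.prob {x. \<eta> / 2 ^ j * sqrt y \<le> \<bar>component N j x\<bar>}
    \<le> (6 * (64 * K * y) ^ j * \<beta> / (\<eta>\<^sup>2 * y)) ^ k + 2 * real N * ((48 * C1 * r) ^ j * (4 * K / \<eta>\<^sup>2)) ^ k"
proof -
  have jm: "0 < j" "j \<le> m" "1 \<le> j" using j jmax by auto
  define G where "G = (real (m choose j))\<^sup>2 * (2 * real k) ^ j / real (N choose j)"
  define x where "x = \<eta> / 2 ^ j * sqrt y"
  define \<kappa> where "\<kappa> = real (2 * k) powr \<gamma> * M"
  define W where "W = (4 * C1 * real j / real m * \<kappa>\<^sup>2) ^ j"
  have x0: "0 < x" using \<eta> y_pos by (simp add: x_def)
  have G0: "0 \<le> G" by (simp add: G_def)
  have W0: "0 \<le> W" using C1 by (simp add: W_def)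
  have "P.prob {z. x \<le> \<bar>component N j z\<bar>}
    \<le> (6 * 4 ^ j * (G * msq j) / x\<^sup>2) ^ k + 2 * (real (N div j) / real k) * (G * (real k / real (N div j)) / x\<^sup>2) ^ k * W ^ k"
    using E_symz_power_smooth[OF j k_pos] unfolding W_def \<kappa>_def
    by (intro component_tail[OF jm(1,2) m(2) k_pos x0 refl _ G_def])
  also have "\<dots> \<le> (6 * (64 * K * y) ^ j * \<beta> / (\<eta>\<^sup>2 * y)) ^ k + 2 * real N * ((48 * C1 * r) ^ j * (4 * K / \<eta>\<^sup>2)) ^ k"
  proof (rule add_mono)
    show "(6 * 4 ^ j * (G * msq j) / x\<^sup>2) ^ k \<le> (6 * (64 * K * y) ^ j * \<beta> / (\<eta>\<^sup>2 * y)) ^ k"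
      unfolding G_def x_def
      by (intro power_mono variance_term_le jm \<beta>) (auto intro!: divide_nonneg_nonneg mult_nonneg_nonneg msq_nonneg)
    have "real (N div j) / real k \<le> real N / 1"
    proof (rule frac_le)
      show "real (N div j) \<le> real N" by simp
      show "1 \<le> real k" using k_pos by simp
    qed auto
    moreover have "(G * (real k / real (N div j)) / x\<^sup>2) ^ k * W ^ k \<le> ((48 * C1 * r) ^ j * (4 * K / \<eta>\<^sup>2)) ^ k"
      unfolding power_mult_distrib[symmetric]
    proof (rule power_mono)
      have "G * (real k / real (N div j)) / x\<^sup>2 * W \<le> (24 * real k * (real m)\<^sup>2 / (real N * real j)) ^ j * (4 * K / \<eta>\<^sup>2) * W"
        unfolding G_def x_def by (intro mult_right_mono sup_term_le jm W0)
      also have "\<dots> = ((24 * real k * (real m)\<^sup>2 / (real N * real j)) ^ j * W) * (4 * K / \<eta>\<^sup>2)" by (simp only: mult_ac)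
      also have "(24 * real k * (real m)\<^sup>2 / (real N * real j)) ^ j * W = (48 * C1 * r) ^ j"
        unfolding W_def power_mult_distrib[symmetric] r \<kappa>_def[symmetric] using jm m by (simp add: field_simps power2_eq_square)
      finally show "G * (real k / real (N div j)) / x\<^sup>2 * W \<le> (48 * C1 * r) ^ j * (4 * K / \<eta>\<^sup>2)" .
      show "0 \<le> G * (real k / real (N div j)) / x\<^sup>2 * W" using G0 W0 by simp
    qed
    ultimately have "(real (N div j) / real k) * ((G * (real k / real (N div j)) / x\<^sup>2) ^ k * W ^ k)
      \<le> real N * ((48 * C1 * r) ^ j * (4 * K / \<eta>\<^sup>2)) ^ k"
      using G0 W0 by (intro mult_mono) auto
    then show "2 * (real (N div j) / real k) * (G * (real k / real (N div j)) / x\<^sup>2) ^ k * W ^ k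
      \<le> 2 * real N * ((48 * C1 * r) ^ j * (4 * K / \<eta>\<^sup>2)) ^ k" by (simp add: mult.assoc)
  qed
  finally show ?thesis by (simp add: x_def)
qed

text \<open>Only the sup-norm of the symmetrized kernel enters. There is no spare power to pay for
  the prefactor n/k, so it is removed by interpolating between sup-norm and variance.\<close>

lemma component_tail_bounded:
  assumes j: "2 \<le> j" "j \<le> m" and \<beta>: "real (m choose j) * msq j \<le> \<beta>"
  shows "P.prob {x. \<eta> / 2 ^ j * sqrt y \<le> \<bar>component N j x\<bar>}
    \<le> 3 * (6 * (64 * K * y) ^ j * \<beta> / (\<eta>\<^sup>2 * y)) ^ k
      + 2 * ((96 * real k * (real m)\<^sup>2 / (real N * real j)) ^ j * (4 * K * B\<^sup>2 / \<eta>\<^sup>2)) ^ k"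
proof -
  have jm: "0 < j" "1 \<le> j" "j \<le> N" using j m by auto
  define G where "G = (real (m choose j))\<^sup>2 * (2 * real k) ^ j / real (N choose j)"
  define x where "x = \<eta> / 2 ^ j * sqrt y"
  define n where "n = N div j"
  define b where "b = (4::real) ^ j * B\<^sup>2"
  define v where "v = E (\<lambda>z. (symz {1..j} z)\<^sup>2)"
  define z where "z = G * (real k / real n) / x\<^sup>2 * b"
  define A where "A = 6 * (64 * K * y) ^ j * \<beta> / (\<eta>\<^sup>2 * y)"
  have x0: "0 < x" using \<eta> y_pos by (simp add: x_def)
  have G0: "0 \<le> G" by (simp add: G_def)
  have b0: "0 < b" using B1 by (simp add: b_def)
  have v0: "0 \<le> v" by (simp add: v_def)
  have n0: "0 < n" using jm by (simp add: n_def div_greater_zero_iff)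
  have z0: "0 \<le> z" using G0 b0 by (simp add: z_def)
  have sq: "(symz {1..j} u)\<^sup>2 \<le> b" for u
  proof -
    have "\<bar>symz {1..j} u\<bar> \<le> 2 ^ j * B" using symz_bounded[of "{1..j}" u] j by simp
    then have "\<bar>symz {1..j} u\<bar>\<^sup>2 \<le> (2 ^ j * B)\<^sup>2" by (intro power_mono) simp_all
    also have "(2 ^ j * B)\<^sup>2 = b" unfolding b_def power_mult_distrib by (simp add: power2_eq_square power_mult_distrib[symmetric])
    finally show ?thesis by simp
  qed
  have sm: "symz {1..j} \<in> borel_measurable S" using j by (intro symz_measurable) auto
  \<comment> \<open>All squares but one are bounded by b; the last one keeps the variance v.\<close>
  have w: "E (\<lambda>u. ((symz {1..j} u)\<^sup>2) ^ k) \<le> b ^ (k - 1) * v"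
  proof -
    have i: "integrable S (\<lambda>u. ((symz {1..j} u)\<^sup>2) ^ p)" for p
    proof (rule integrable_bounded[of _ "b ^ p"])
      show "(\<lambda>u. ((symz {1..j} u)\<^sup>2) ^ p) \<in> borel_measurable S" using sm by measurable
      show "\<bar>((symz {1..j} u)\<^sup>2) ^ p\<bar> \<le> b ^ p" for u unfolding power_abs using sq by (intro power_mono) auto
    qed
    have "E (\<lambda>u. ((symz {1..j} u)\<^sup>2) ^ k) \<le> E (\<lambda>u. b ^ (k - 1) * (symz {1..j} u)\<^sup>2)"
    proof (rule integral_mono)
      show "integrable S (\<lambda>u. b ^ (k - 1) * (symz {1..j} u)\<^sup>2)" using i[of 1] by simp
      fix u
      have "((symz {1..j} u)\<^sup>2) ^ k = ((symz {1..j} u)\<^sup>2) ^ (k - 1) * (symz {1..j} u)\<^sup>2"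
        using k_pos by (metis mult.commute power_eq_if not_gr_zero)
      also have "\<dots> \<le> b ^ (k - 1) * (symz {1..j} u)\<^sup>2" using sq by (intro mult_right_mono power_mono) auto
      finally show "((symz {1..j} u)\<^sup>2) ^ k \<le> b ^ (k - 1) * (symz {1..j} u)\<^sup>2" .
    qed (rule i)
    then show ?thesis by (simp add: v_def)
  qed
  have A6: "6 * 4 ^ j * (G * msq j) / x\<^sup>2 \<le> A"
    unfolding G_def x_def A_def by (rule variance_term_le[OF jm(2) j(2) \<beta>])
  have A60: "0 \<le> 6 * 4 ^ j * (G * msq j) / x\<^sup>2" using G0 msq_nonneg by simp
  have vA: "G * v / x\<^sup>2 \<le> A"
  proof -
    have "G * v / x\<^sup>2 \<le> G * (4 ^ j * msq j) / x\<^sup>2"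
      using E_symz_square_le[OF j(2)] G0 by (intro divide_right_mono mult_left_mono) (auto simp: v_def)
    also have "\<dots> \<le> 6 * 4 ^ j * (G * msq j) / x\<^sup>2"
      using G0 msq_nonneg by (intro divide_right_mono) auto
    finally show ?thesis using A6 by simp
  qed
  \<comment> \<open>Let p = (n/k)(v/b) be the prefactor of z^k. If p \<le> 1 it is dropped; if p > 1
    then p \<le> p^k, and p z is the variance term G v/x^2.\<close>
  have extra: "(real n / real k) * (G * (real k / real n) / x\<^sup>2) ^ k * (b ^ (k - 1) * v) \<le> z ^ k + A ^ k"
  proof -
    have "b ^ k = b * b ^ (k - 1)" using k_pos by (metis power_eq_if not_gr_zero)
    then have eq: "(real n / real k) * (G * (real k / real n) / x\<^sup>2) ^ k * (b ^ (k - 1) * v) = (real n / real k * (v / b)) * z ^ k"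
    proof -
      define c where "c = (G * (real k / real n) / x\<^sup>2) ^ k"
      have "z ^ k = c * b ^ k" unfolding z_def c_def by (rule power_mult_distrib)
      then have "z ^ k = c * (b * b ^ (k - 1))" using \<open>b ^ k = b * b ^ (k - 1)\<close> by simp
      then show ?thesis unfolding c_def[symmetric] using b0 by simp
    qed
    have A0: "0 \<le> A ^ k" using A6 A60 by (intro zero_le_power) linarith
    show ?thesis
    proof (cases "real n / real k * (v / b) \<le> 1")
      case True
      then have "(real n / real k * (v / b)) * z ^ k \<le> 1 * z ^ k" using z0 by (intro mult_right_mono) auto
      then show ?thesis unfolding eq using A0 by simp
    next
      case False
      then have "(real n / real k * (v / b)) ^ 1 \<le> (real n / real k * (v / b)) ^ k"
        using k_pos by (intro power_increasing) auto
      then have "(real n / real k * (v / b)) * z ^ k \<le> (real n / real k * (v / b)) ^ k * z ^ k"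
        using z0 by (intro mult_right_mono) auto
      also have "\<dots> = (G * v / x\<^sup>2) ^ k"
        unfolding power_mult_distrib[symmetric] using n0 k_pos b0 by (simp add: z_def mult.commute)
      also have "\<dots> \<le> A ^ k" using vA G0 v0 by (intro power_mono) auto
      finally show ?thesis unfolding eq using z0 by (simp add: add_increasing)
    qed
  qed
  have zle: "z \<le> (96 * real k * (real m)\<^sup>2 / (real N * real j)) ^ j * (4 * K * B\<^sup>2 / \<eta>\<^sup>2)"
  proof -
    have "z \<le> (24 * real k * (real m)\<^sup>2 / (real N * real j)) ^ j * (4 * K / \<eta>\<^sup>2) * b"
      unfolding z_def G_def x_def n_def using b0 by (intro mult_right_mono sup_term_le jm j) auto
    also have "\<dots> = (4 ^ j * (24 * real k * (real m)\<^sup>2 / (real N * real j)) ^ j) * (4 * K * B\<^sup>2 / \<eta>\<^sup>2)"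
      by (simp add: b_def)
    also have "4 ^ j * (24 * real k * (real m)\<^sup>2 / (real N * real j)) ^ j = (96 * real k * (real m)\<^sup>2 / (real N * real j)) ^ j"
      unfolding power_mult_distrib[symmetric] by (simp add: mult_ac)
    finally show ?thesis .
  qed
  have "P.prob {u. x \<le> \<bar>component N j u\<bar>}
    \<le> (6 * 4 ^ j * (G * msq j) / x\<^sup>2) ^ k + 2 * (real n / real k) * (G * (real k / real n) / x\<^sup>2) ^ k * (b ^ (k - 1) * v)"
    by (rule component_tail[OF jm(1) j(2) m(2) k_pos x0 n_def w G_def])
  also have "\<dots> \<le> A ^ k + 2 * (z ^ k + A ^ k)"
    using power_mono[OF A6 A60, of k] extra by (simp add: mult.assoc)
  also have "\<dots> \<le> 3 * A ^ k + 2 * ((96 * real k * (real m)\<^sup>2 / (real N * real j)) ^ j * (4 * K * B\<^sup>2 / \<eta>\<^sup>2)) ^ k"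
    using power_mono[OF zle z0, of k] by simp
  finally show ?thesis by (simp add: x_def A_def)
qed

end

end

section \<open>Summing the bounds over the degrees\<close>

lemma power_small_pred:
  fixes Q s :: real
  assumes Q: "1 \<le> Q" and s: "0 \<le> s" "s * (exp 1 * Q)\<^sup>2 \<le> 1" and j: "2 \<le> j"
  shows "Q * s ^ (j - 1) \<le> exp (- 1) ^ j"
proof -
  define w where "w = exp 1 * Q"
  have w: "1 \<le> w" unfolding w_def using Q by (metis exp_ge_zero mult_mono' mult_1 one_le_exp_iff zero_le_one)
  have "s * w\<^sup>2 \<le> 1" using s(2) by (simp only: w_def)
  \<comment> \<open>Only j-1 factors s are available; as s \<le> w^-2, they still give w^-j because
    2(j-1) \<ge> j.\<close>
  then have "s \<le> (1 / w)\<^sup>2" using w by (simp add: power_divide field_simps)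
  then have "s ^ (j - 1) \<le> ((1 / w)\<^sup>2) ^ (j - 1)" using s(1) by (intro power_mono)
  also have "\<dots> = (1 / w) ^ (2 * (j - 1))" by (simp only: power_mult)
  also have "\<dots> \<le> (1 / w) ^ j" using w j by (intro power_decreasing) auto
  finally have "Q * s ^ (j - 1) \<le> Q * (1 / w) ^ j" using Q by (intro mult_left_mono) auto
  also have "\<dots> \<le> Q ^ j * (1 / w) ^ j"
    using power_increasing[of 1 j Q] Q j w by (intro mult_right_mono) auto
  also have "\<dots> = exp (- 1) ^ j"
    unfolding power_mult_distrib[symmetric] w_def using Q by (simp add: exp_minus field_simps)
  finally show ?thesis .
qed

lemma power_small:
  fixes Q s :: real
  assumes Q: "1 \<le> Q" and s: "0 \<le> s" "s * (exp 1 * Q) \<le> 1" and j: "1 \<le> j"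
  shows "Q * s ^ j \<le> exp (- 1) ^ j"
proof -
  have "Q * s ^ j \<le> Q ^ j * s ^ j"
    using power_increasing[of 1 j Q] Q j s by (intro mult_right_mono) auto
  also have "\<dots> = (s * (exp 1 * Q) * exp (- 1)) ^ j"
    unfolding power_mult_distrib[symmetric] by (simp add: exp_minus field_simps)
  also have "\<dots> \<le> (1 * exp (- 1)) ^ j"
    using Q s by (intro power_mono mult_right_mono) auto
  finally show ?thesis by simp
qed

lemma sum_exp_power_le:
  assumes "k > 0" shows "(\<Sum>j=2..l. (exp (- 1) ^ j) ^ k) \<le> exp (- real k)"
proof -
  have summand: "(exp (- 1) ^ j) ^ k \<le> exp (- real k) * (1 / 2) ^ (j - 1)" if j: "j \<in> {2..l}" for j
  proof -
    have "(exp (- 1 :: real) ^ j) ^ k = exp (- real k) ^ j"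
      by (simp add: power_mult[symmetric] exp_of_nat_mult[symmetric] mult.commute)
    also have "\<dots> = exp (- real k) * exp (- real k) ^ (j - 1)"
      using j by (metis atLeastAtMost_iff not_numeral_le_zero power_eq_if)
    also have "exp (- real k) \<le> 1 / 2"
    proof -
      have "2 \<le> exp (real k)" using exp_ge_add_one_self[of "real k"] assms by linarith
      then show ?thesis by (simp add: exp_minus field_simps)
    qed
    then have "exp (- real k) * exp (- real k) ^ (j - 1) \<le> exp (- real k) * (1 / 2) ^ (j - 1)"
      by (intro mult_left_mono power_mono) auto
    finally show ?thesis .
  qed
  have geo: "(\<Sum>j=2..l. (1 / 2 :: real) ^ (j - 1)) \<le> 1"
  proof -
    have "(\<Sum>j=2..l. (1 / 2 :: real) ^ (j - 1)) = 1 - (1/2) ^ (l - 1)" if "1 \<le> l"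
      using that by (induction l rule: dec_induct) (auto simp: sum.nat_ivl_Suc' Suc_diff_le power_eq_if)
    then show ?thesis by (cases "1 \<le> l") auto
  qed
  have "(\<Sum>j=2..l. (exp (- 1) ^ j) ^ k) \<le> (\<Sum>j=2..l. exp (- real k) * (1 / 2) ^ (j - 1))"
    by (rule sum_mono[OF summand])
  also have "\<dots> = exp (- real k) * (\<Sum>j=2..l. (1 / 2) ^ (j - 1))" by (simp add: sum_distrib_left)
  also have "\<dots> \<le> exp (- real k) * 1" using geo by (intro mult_left_mono) auto
  finally show ?thesis by simp
qed

lemma sum_half_powers: "(\<Sum>j=2..l. (1 / 2 :: real) ^ j) \<le> 1 / 2"
proof -
  have "(\<Sum>j=2..l. (1 / 2 :: real) ^ j) = 1 / 2 - (1/2) ^ l" if "1 \<le> l"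
    using that by (induction l rule: dec_induct) (auto simp: sum.nat_ivl_Suc')
  then show ?thesis by (cases "1 \<le> l") auto
qed

context smooth_model
begin

text \<open>The shares add up to 1: degree 1 gets 1 - \<eta>, degrees 2 to l together at most
  \<eta>/2 since the powers 2^-j sum to at most 1/2, and the rest \<eta>/2.\<close>

lemma ustat_tail_union:
  fixes \<eta> x :: real
  assumes \<eta>: "0 < \<eta>" "\<eta> < 1" and x: "0 < x" and l: "1 \<le> l" "l \<le> m"
    and comp: "\<And>j. j \<in> {2..l} \<Longrightarrow> P.prob {z. \<eta> / 2 ^ j * x \<le> \<bar>component N j z\<bar>} \<le> c j"
    and lin: "P.prob {z. (1 - \<eta>) * x \<le> \<bar>component N 1 z\<bar>} \<le> L"
    and high: "P.prob {z. \<eta> / 2 * x \<le> \<bar>\<Sum>j\<in>{l<..m}. component N j z\<bar>} \<le> R"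
  shows "P.prob {z. x \<le> \<bar>ustat N z\<bar>} \<le> L + (\<Sum>j=2..l. c j) + R"
proof -
  define A where "A j = {z. \<eta> / 2 ^ j * x \<le> \<bar>component N j z\<bar>}" for j
  define A1 where "A1 = {z. (1 - \<eta>) * x \<le> \<bar>component N 1 z\<bar>}"
  define AR where "AR = {z. \<eta> / 2 * x \<le> \<bar>\<Sum>j\<in>{l<..m}. component N j z\<bar>}"
  have meas: "{z. c \<le> \<bar>f z\<bar>} \<in> P.events" if f: "f \<in> borel_measurable S" for f and c :: real
  proof -
    note [measurable] = f
    have "{z \<in> space S. c \<le> \<bar>f z\<bar>} \<in> P.events" by measurable
    then show ?thesis by simp
  qed
  have cm: "component N j \<in> borel_measurable S" if "j \<le> m" for j using component_measurable[OF that] .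
  have Am: "A j \<in> P.events" if "j \<in> {2..l}" for j unfolding A_def using that l by (intro meas cm) auto
  have A1m: "A1 \<in> P.events" unfolding A1_def using m by (intro meas cm) auto
  have ARm: "AR \<in> P.events" unfolding AR_def by (intro meas borel_measurable_sum cm) auto
  have sub: "{z. x \<le> \<bar>ustat N z\<bar>} \<subseteq> A1 \<union> (\<Union>j\<in>{2..l}. A j) \<union> AR"
  proof
    fix z assume z: "z \<in> {z. x \<le> \<bar>ustat N z\<bar>}"
    show "z \<in> A1 \<union> (\<Union>j\<in>{2..l}. A j) \<union> AR"
    proof (rule ccontr)
      assume "z \<notin> A1 \<union> (\<Union>j\<in>{2..l}. A j) \<union> AR"
      then have 1: "\<bar>component N 1 z\<bar> < (1 - \<eta>) * x" and 3: "\<bar>\<Sum>j\<in>{l<..m}. component N j z\<bar> < \<eta> / 2 * x"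
        and 2: "\<And>j. j \<in> {2..l} \<Longrightarrow> \<bar>component N j z\<bar> < \<eta> / 2 ^ j * x"
        by (auto simp: A_def A1_def AR_def not_le)
      have "{1..m} = insert 1 ({2..l} \<union> {l<..m})" using l by auto
      then have "ustat N z = component N 1 z + ((\<Sum>j=2..l. component N j z) + (\<Sum>j\<in>{l<..m}. component N j z))"
      proof -
        have "(\<Sum>j\<in>{2..l} \<union> {l<..m}. component N j z) = (\<Sum>j=2..l. component N j z) + (\<Sum>j\<in>{l<..m}. component N j z)"
          by (rule sum.union_disjoint) auto
        moreover have "(\<Sum>j\<in>insert 1 ({2..l} \<union> {l<..m}). component N j z) = component N 1 z + (\<Sum>j\<in>{2..l} \<union> {l<..m}. component N j z)"
          using l by (intro sum.insert) auto
        ultimately show ?thesis using \<open>{1..m} = insert 1 ({2..l} \<union> {l<..m})\<close> by (simp only: ustat_eq_sum_component[OF m(2)])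
      qed
      moreover have "\<bar>\<Sum>j=2..l. component N j z\<bar> \<le> \<eta> / 2 * x"
      proof -
        have "\<bar>\<Sum>j=2..l. component N j z\<bar> \<le> (\<Sum>j=2..l. \<eta> * x * (1 / 2) ^ j)"
          by (rule order_trans[OF sum_abs sum_mono]) (use 2 in \<open>force simp: power_divide\<close>)
        also have "\<dots> = \<eta> * x * (\<Sum>j=2..l. (1 / 2) ^ j)" by (simp add: sum_distrib_left)
        also have "\<dots> \<le> \<eta> * x * (1 / 2)" using \<eta> x by (intro mult_left_mono sum_half_powers) auto
        finally show ?thesis by simp
      qed
      ultimately have "\<bar>ustat N z\<bar> < (1 - \<eta>) * x + \<eta> / 2 * x + \<eta> / 2 * x" using 1 3 by linarith
      also have "\<dots> = x" by (simp add: algebra_simps)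
      finally show False using z by simp
    qed
  qed
  have "P.prob {z. x \<le> \<bar>ustat N z\<bar>} \<le> P.prob (A1 \<union> (\<Union>j\<in>{2..l}. A j) \<union> AR)"
    using sub Am A1m ARm by (intro P.finite_measure_mono) auto
  also have "\<dots> \<le> P.prob (A1 \<union> (\<Union>j\<in>{2..l}. A j)) + P.prob AR"
    using Am A1m ARm by (intro measure_Un_le) auto
  also have "P.prob (A1 \<union> (\<Union>j\<in>{2..l}. A j)) \<le> P.prob A1 + P.prob (\<Union>j\<in>{2..l}. A j)"
    using Am A1m by (intro measure_Un_le) auto
  also have "P.prob (\<Union>j\<in>{2..l}. A j) \<le> (\<Sum>j=2..l. P.prob (A j))"
    using Am by (intro P.finite_measure_subadditive_finite) auto
  also have "\<dots> \<le> (\<Sum>j=2..l. c j)" unfolding A_def by (intro sum_mono comp)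
  finally show ?thesis using lin high unfolding A1_def AR_def by linarith
qed

text \<open>r = u/V optimizes the Chernoff bound with the enlarged variance V = (1 + \<eta>)
  \<sigma>2. The smallness conditions, stated at the larger value sqrt y / s0, keep the true
  coefficient below V.\<close>

lemma linear_two_sided:
  fixes a s0 \<eta> y :: real
  defines "\<sigma>2 \<equiv> real m * msq 1"
  assumes s0: "0 < s0" "s0 \<le> \<sigma>2" and \<eta>: "0 < \<eta>" "\<eta> < 1" and y: "0 < y" and a: "0 < a"
    and small: "exp (sqrt y / s0 * a) \<le> 1 + \<eta> / 2"
      "exp (sqrt y / s0 * B) * (real m * (\<integral>t. (h1 t)\<^sup>2 * indicator {t. a < \<bar>h1 t\<bar>} t \<partial>law)) \<le> \<eta> / 2 * s0"
  shows "P.prob {z. (1 - \<eta>) * sqrt y \<le> \<bar>component N 1 z\<bar>} \<le> 2 * exp (- ((1 - \<eta>)\<^sup>2 * (y * real N / real m) / (2 * (1 + \<eta>) * \<sigma>2)))"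
proof -
  define ell where "ell = real m * (\<integral>t. (h1 t)\<^sup>2 * indicator {t. a < \<bar>h1 t\<bar>} t \<partial>law)"
  define u where "u = (1 - \<eta>) * sqrt y"
  define V where "V = (1 + \<eta>) * \<sigma>2"
  define r where "r = u / V"
  have \<sigma>0: "0 < \<sigma>2" using s0 by linarith
  have V0: "0 < V" using \<sigma>0 \<eta> by (simp add: V_def)
  have u0: "0 < u" using \<eta> y by (simp add: u_def)
  have r0: "0 \<le> r" using u0 V0 by (simp add: r_def)
  have rle: "r \<le> sqrt y / s0"
    unfolding r_def
  proof (rule frac_le)
    show "u \<le> sqrt y" using \<eta> y by (simp add: u_def mult_le_cancel_right1)
    have "1 * s0 \<le> (1 + \<eta>) * \<sigma>2" using s0 \<eta> by (intro mult_mono) auto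
    then show "s0 \<le> V" by (simp add: V_def)
  qed (use s0 y in auto)
  have ell0: "0 \<le> ell" by (simp add: ell_def integral_nonneg_AE)
  have "exp (r * a) * \<sigma>2 + exp (r * B) * ell \<le> V"
  proof -
    have "exp (r * a) \<le> 1 + \<eta> / 2"
      using mult_right_mono[OF rle, of a] a by (intro order_trans[OF _ small(1)]) (simp only: exp_le_cancel_iff less_imp_le)
    then have 1: "exp (r * a) * \<sigma>2 \<le> (1 + \<eta> / 2) * \<sigma>2" using \<sigma>0 by (intro mult_right_mono) auto
    have "exp (r * B) * ell \<le> exp (sqrt y / s0 * B) * ell"
      using mult_right_mono[OF rle B_nonneg] ell0 by (intro mult_right_mono) (simp_all only: exp_le_cancel_iff)
    also have "\<dots> \<le> \<eta> / 2 * s0" using small(2) by (simp add: ell_def)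
    also have "\<dots> \<le> \<eta> / 2 * \<sigma>2" using s0 \<eta> by (intro mult_left_mono) auto
    finally show ?thesis using 1 by (simp add: V_def algebra_simps)
  qed
  then have ex: "r * u - r\<^sup>2 / 2 * (exp (r * a) * \<sigma>2 + exp (r * B) * ell) \<ge> u\<^sup>2 / (2 * V)"
  proof -
    assume le: "exp (r * a) * \<sigma>2 + exp (r * B) * ell \<le> V"
    have "r\<^sup>2 / 2 * (exp (r * a) * \<sigma>2 + exp (r * B) * ell) \<le> r\<^sup>2 / 2 * V" by (intro mult_left_mono le) auto
    moreover have "r * u - r\<^sup>2 / 2 * V = u\<^sup>2 / (2 * V)" using V0 by (simp add: r_def power2_eq_square field_simps)
    ultimately show ?thesis by linarith
  qed
  have one: "P.prob {z. u \<le> s * component N 1 z} \<le> exp (- (real N / real m * (u\<^sup>2 / (2 * V))))" if "\<bar>s\<bar> = 1" for s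
  proof -
    have "P.prob {z. u \<le> s * component N 1 z} \<le> exp (- (real N / real m * (r * u - r\<^sup>2 / 2 * (exp (r * a) * \<sigma>2 + exp (r * B) * ell))))"
      unfolding ell_def \<sigma>2_def using m by (intro linear_tail[OF m(1) that r0]) auto
    also have "\<dots> \<le> exp (- (real N / real m * (u\<^sup>2 / (2 * V))))"
      using mult_left_mono[OF ex, of "real N / real m"] by (simp only: exp_le_cancel_iff neg_le_iff_le) simp
    finally show ?thesis .
  qed
  have meas: "{z. u \<le> s * component N 1 z} \<in> P.events" for s
  proof -
    note [measurable] = component_measurable[OF m(1), of N]
    have "{z \<in> space S. u \<le> s * component N 1 z} \<in> P.events" by measurable
    then show ?thesis by simp
  qed
  have "P.prob {z. u \<le> \<bar>component N 1 z\<bar>} \<le> P.prob ({z. u \<le> 1 * component N 1 z} \<union> {z. u \<le> - 1 * component N 1 z})"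
    by (intro P.finite_measure_mono sets.Un meas) auto
  also have "\<dots> \<le> P.prob {z. u \<le> 1 * component N 1 z} + P.prob {z. u \<le> - 1 * component N 1 z}"
    by (rule measure_Un_le[OF meas meas])
  also have "\<dots> \<le> 2 * exp (- (real N / real m * (u\<^sup>2 / (2 * V))))" using one[of 1] one[of "-1"] by simp
  also have "real N / real m * (u\<^sup>2 / (2 * V)) = (1 - \<eta>)\<^sup>2 * (y * real N / real m) / (2 * (1 + \<eta>) * \<sigma>2)"
  proof -
    have "u\<^sup>2 = (1 - \<eta>)\<^sup>2 * y" using y by (simp add: u_def power_mult_distrib)
    then show ?thesis by (simp add: V_def mult_ac)
  qed
  finally show ?thesis by (simp add: u_def)
qed

context
  fixes t K \<eta> y :: real and k :: nat
  assumes t: "2 \<le> t" and K: "1 \<le> K" and \<eta>: "0 < \<eta>" "\<eta> < 1" and y: "y = t * real m / real N"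
    and k: "K * t \<le> real k" "real k \<le> 2 * K * t"
begin

lemmas y_pos' = y_pos[OF t K \<eta> y k]

text \<open>One of the j factors y cancels the y of the squared level, so a positive power remains
  from degree 2 on.\<close>

lemma variance_term_small_y:
  assumes j: "2 \<le> j" and small: "64 * K * y * (exp 1 * (384 * K * B\<^sup>2 / \<eta>\<^sup>2))\<^sup>2 \<le> 1"
  shows "6 * (64 * K * y) ^ j * B\<^sup>2 / (\<eta>\<^sup>2 * y) \<le> exp (- 1) ^ j"
proof -
  have "\<eta>\<^sup>2 \<le> 1" using \<eta> by (simp add: power_le_one)
  moreover have "1 \<le> K * B\<^sup>2" using K B1 mult_mono[of 1 K 1 "B\<^sup>2"] by (simp add: one_le_power)
  ultimately have Q: "1 \<le> 384 * K * B\<^sup>2 / \<eta>\<^sup>2" using \<eta> by (subst pos_le_divide_eq) auto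
  have "6 * (64 * K * y) ^ j * B\<^sup>2 / (\<eta>\<^sup>2 * y) = 384 * K * B\<^sup>2 / \<eta>\<^sup>2 * (64 * K * y) ^ (j - 1)"
  proof -
    have "(64 * K * y) ^ j = 64 * K * y * (64 * K * y) ^ (j - 1)" using j by (metis not_numeral_le_zero power_eq_if)
    then show ?thesis using y_pos' by (simp add: field_simps)
  qed
  also have "\<dots> \<le> exp (- 1) ^ j"
    using K y_pos' by (intro power_small_pred[OF Q _ small j]) auto
  finally show ?thesis .
qed

text \<open>The variance term has two regimes: small y with the Bessel bound, or y \<ge> \<theta>
  with small M, where \<open>variance_smooth\<close> supplies the decay.\<close>

lemma component_tail_smooth_small:
  assumes j: "2 \<le> j" "j \<le> jmax"
    and A: "64 * K * y * (exp 1 * (384 * K * B\<^sup>2 / \<eta>\<^sup>2))\<^sup>2 \<le> 1 \<or>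
       (0 < \<theta> \<and> \<theta> \<le> 1 \<and> \<theta> \<le> y \<and> y \<le> B\<^sup>2 \<and> 768 * K * B\<^sup>2 * C1 * (2 powr \<gamma> * M)\<^sup>2 * (exp 1 * (6 / (\<eta>\<^sup>2 * \<theta>))) \<le> 1)"
    and r: "r = real (2 * k) * (real (2 * k) powr \<gamma> * M)\<^sup>2 * real m / real N"
    and Nr: "real N * r ^ k \<le> 1" and rs: "48 * C1 * r * (exp 1 * (192 * C1 * K / \<eta>\<^sup>2 + 1))\<^sup>2 \<le> 1"
  shows "P.prob {x. \<eta> / 2 ^ j * sqrt y \<le> \<bar>component N j x\<bar>} \<le> 5 * (exp (- 1) ^ j) ^ k"
proof -
  have jm: "j \<le> m" using j jmax by simp
  have r0: "0 \<le> r" using r by simp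
  obtain \<beta> where \<beta>: "real (m choose j) * msq j \<le> \<beta>" and A': "6 * (64 * K * y) ^ j * \<beta> / (\<eta>\<^sup>2 * y) \<le> exp (- 1) ^ j"
    using A
  proof (elim disjE conjE)
    assume "64 * K * y * (exp 1 * (384 * K * B\<^sup>2 / \<eta>\<^sup>2))\<^sup>2 \<le> 1"
    then show ?thesis by (intro that[OF bessel_le[OF jm]] variance_term_small_y j)
  next
    assume \<theta>: "0 < \<theta>" "\<theta> \<le> 1" "\<theta> \<le> y" "y \<le> B\<^sup>2"
      and s: "768 * K * B\<^sup>2 * C1 * (2 powr \<gamma> * M)\<^sup>2 * (exp 1 * (6 / (\<eta>\<^sup>2 * \<theta>))) \<le> 1"
    define \<kappa> where "\<kappa> = (2 powr \<gamma> * M)\<^sup>2"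
    have \<kappa>0: "0 \<le> \<kappa>" by (simp add: \<kappa>_def)
    have "\<eta>\<^sup>2 * \<theta> \<le> 1 * 1" using \<eta> \<theta> by (intro mult_mono power_le_one) auto
    then have Q: "1 \<le> 6 / (\<eta>\<^sup>2 * \<theta>)" using \<eta> \<theta> by (subst pos_le_divide_eq) auto
    have "6 * (64 * K * y) ^ j * (12 * C1 * \<kappa>) ^ j / (\<eta>\<^sup>2 * y) = 6 / (\<eta>\<^sup>2 * y) * ((64 * K * y) ^ j * (12 * C1 * \<kappa>) ^ j)"
      by simp
    also have "(64 * K * y) ^ j * (12 * C1 * \<kappa>) ^ j = (768 * K * y * C1 * \<kappa>) ^ j"
      unfolding power_mult_distrib[symmetric] by (simp add: mult_ac)
    also have "6 / (\<eta>\<^sup>2 * y) * (768 * K * y * C1 * \<kappa>) ^ j \<le> 6 / (\<eta>\<^sup>2 * \<theta>) * (768 * K * B\<^sup>2 * C1 * \<kappa>) ^ j"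
      using \<theta> K C1 \<kappa>0 \<eta>
      by (intro mult_mono power_mono mult_right_mono mult_left_mono divide_left_mono) auto
    also have "\<dots> \<le> exp (- 1) ^ j"
      using s K C1 \<kappa>0 j unfolding \<kappa>_def[symmetric] by (intro power_small[OF Q]) auto
    finally show ?thesis using variance_smooth[OF j] by (intro that[of "(12 * C1 * \<kappa>) ^ j"]) (simp_all add: \<kappa>_def)
  qed
  have \<beta>0: "0 \<le> \<beta>" using \<beta> by (rule order_trans[rotated]) (simp add: msq_nonneg)
  have 1: "(6 * (64 * K * y) ^ j * \<beta> / (\<eta>\<^sup>2 * y)) ^ k \<le> (exp (- 1) ^ j) ^ k"
    using A' \<beta>0 K y_pos' by (intro power_mono) auto
  have 2: "real N * ((48 * C1 * r) ^ j * (4 * K / \<eta>\<^sup>2)) ^ k \<le> (exp (- 1) ^ j) ^ k"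
  proof -
    define Q where "Q = 192 * C1 * K / \<eta>\<^sup>2 + 1"
    have Q1: "1 \<le> Q" using C1 K by (simp add: Q_def)
    \<comment> \<open>One factor r is set aside, whose k-th power pays for N through
      \<open>Nr\<close>; the other j-1 give the decay in j.\<close>
    have "(48 * C1 * r) ^ j = 48 * C1 * r * (48 * C1 * r) ^ (j - 1)" using j by (metis not_numeral_le_zero power_eq_if)
    then have "(48 * C1 * r) ^ j * (4 * K / \<eta>\<^sup>2) = r * ((192 * C1 * K / \<eta>\<^sup>2) * (48 * C1 * r) ^ (j - 1))" by simp
    also have "\<dots> \<le> r * exp (- 1) ^ j"
    proof (rule mult_left_mono[OF _ r0])
      have "(192 * C1 * K / \<eta>\<^sup>2) * (48 * C1 * r) ^ (j - 1) \<le> Q * (48 * C1 * r) ^ (j - 1)"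
        using C1 r0 by (intro mult_right_mono) (auto simp: Q_def)
      also have "\<dots> \<le> exp (- 1) ^ j" using rs C1 r0 by (intro power_small_pred[OF Q1 _ _ j(1)]) (auto simp: Q_def)
      finally show "(192 * C1 * K / \<eta>\<^sup>2) * (48 * C1 * r) ^ (j - 1) \<le> exp (- 1) ^ j" .
    qed
    finally have "((48 * C1 * r) ^ j * (4 * K / \<eta>\<^sup>2)) ^ k \<le> (r * exp (- 1) ^ j) ^ k"
      using C1 r0 K by (intro power_mono) auto
    also have "\<dots> = r ^ k * (exp (- 1) ^ j) ^ k" by (simp only: power_mult_distrib)
    finally have "real N * ((48 * C1 * r) ^ j * (4 * K / \<eta>\<^sup>2)) ^ k \<le> (real N * r ^ k) * (exp (- 1) ^ j) ^ k"
      by (simp add: mult_left_mono mult.assoc)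
    also have "\<dots> \<le> 1 * (exp (- 1) ^ j) ^ k" by (intro mult_right_mono Nr) simp
    finally show ?thesis by simp
  qed
  have "P.prob {x. \<eta> / 2 ^ j * sqrt y \<le> \<bar>component N j x\<bar>} \<le> (exp (- 1) ^ j) ^ k + 2 * (exp (- 1) ^ j) ^ k"
    using component_tail_smooth[OF t K \<eta> y k j \<beta> r] 1 2 by linarith
  also have "\<dots> \<le> 5 * (exp (- 1) ^ j) ^ k" by simp
  finally show ?thesis .
qed

lemma component_tail_bounded_small:
  assumes j: "jmax < j" "j \<le> m"
    and A: "64 * K * y * (exp 1 * (384 * K * B\<^sup>2 / \<eta>\<^sup>2))\<^sup>2 \<le> 1"
    and z: "96 * real k * (real m)\<^sup>2 / (real N * real jmax) * (exp 1 * (4 * K * B\<^sup>2 / \<eta>\<^sup>2)) \<le> 1"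
  shows "P.prob {x. \<eta> / 2 ^ j * sqrt y \<le> \<bar>component N j x\<bar>} \<le> 5 * (exp (- 1) ^ j) ^ k"
proof -
  have j2: "2 \<le> j" using j jmax by simp
  have N0: "0 < N" using m by simp
  have \<eta>2: "\<eta>\<^sup>2 \<le> 1" using \<eta> by (simp add: power_le_one)
  moreover have "1 \<le> K * B\<^sup>2" using K B1 mult_mono[of 1 K 1 "B\<^sup>2"] by (simp add: one_le_power)
  ultimately have Q: "1 \<le> 4 * K * B\<^sup>2 / \<eta>\<^sup>2" using \<eta> by (subst pos_le_divide_eq) auto
  have 1: "(6 * (64 * K * y) ^ j * B\<^sup>2 / (\<eta>\<^sup>2 * y)) ^ k \<le> (exp (- 1) ^ j) ^ k"
    using K y_pos' by (intro power_mono variance_term_small_y j2 A) auto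
  have "96 * real k * (real m)\<^sup>2 / (real N * real j) \<le> 96 * real k * (real m)\<^sup>2 / (real N * real jmax)"
    using j jmax N0 by (intro divide_left_mono mult_left_mono mult_pos_pos) auto
  then have "(96 * real k * (real m)\<^sup>2 / (real N * real j)) ^ j * (4 * K * B\<^sup>2 / \<eta>\<^sup>2) \<le>
    (96 * real k * (real m)\<^sup>2 / (real N * real jmax)) ^ j * (4 * K * B\<^sup>2 / \<eta>\<^sup>2)"
    using K by (intro mult_right_mono power_mono) auto
  also have "\<dots> = (4 * K * B\<^sup>2 / \<eta>\<^sup>2) * (96 * real k * (real m)\<^sup>2 / (real N * real jmax)) ^ j" by (rule mult.commute)
  also have "\<dots> \<le> exp (- 1) ^ j" using j2 by (intro power_small[OF Q _ z]) auto
  finally have 2: "((96 * real k * (real m)\<^sup>2 / (real N * real j)) ^ j * (4 * K * B\<^sup>2 / \<eta>\<^sup>2)) ^ k \<le> (exp (- 1) ^ j) ^ k"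
    using K by (intro power_mono) auto
  show ?thesis using component_tail_bounded[OF t K \<eta> y k j2 j(2) bessel_le[OF j(2)]] 1 2 by linarith
qed

end
end

context smooth_model
begin

lemma variance_le: "real m * msq 1 \<le> B\<^sup>2"
  using bessel_le[OF m(1)] by simp

lemma ustat_bounded: "\<bar>ustat N z\<bar> \<le> B"
proof -
  let ?K = "{J. J \<subseteq> {1..N} \<and> card J = m}"
  have "\<bar>\<Sum>J\<in>?K. F J z\<bar> \<le> (\<Sum>J\<in>?K. \<bar>F J z\<bar>)" by (rule sum_abs)
  also have "\<dots> \<le> (\<Sum>J\<in>?K. B)"
  proof (rule sum_mono)
    fix J assume "J \<in> ?K"
    then show "\<bar>F J z\<bar> \<le> B" by (intro F_bounded) (auto dest: subset_bounds)
  qed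
  also have "\<dots> = real (N choose m) * B" by (simp add: n_subsets)
  finally show ?thesis using m by (simp add: ustat_def field_simps)
qed

text \<open>Degrees above \<open>jmax\<close> are handled in \<open>L\<^sup>2\<close> if \<open>K t \<le> jmax ln (N/m)\<close>, and by moments otherwise.\<close>

lemma fixed_bound:
  fixes t K \<eta> y s0 r :: real and k :: nat
  assumes t: "2 \<le> t" and K: "1 \<le> K" and \<eta>: "0 < \<eta>" "\<eta> < 1" and y: "y = t * real m / real N"
    and k: "K * t \<le> real k" "real k \<le> 2 * K * t"
    and s0: "0 < s0" "s0 \<le> real m * msq 1"
    and A: "64 * K * y * (exp 1 * (384 * K * B\<^sup>2 / \<eta>\<^sup>2))\<^sup>2 \<le> 1 \<or>
       (0 < \<theta> \<and> \<theta> \<le> 1 \<and> \<theta> \<le> y \<and> y \<le> B\<^sup>2 \<and> 768 * K * B\<^sup>2 * C1 * (2 powr \<gamma> * M)\<^sup>2 * (exp 1 * (6 / (\<eta>\<^sup>2 * \<theta>))) \<le> 1)"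
    and r: "r = real (2 * k) * (real (2 * k) powr \<gamma> * M)\<^sup>2 * real m / real N"
    and Nr: "real N * r ^ k \<le> 1" and rs: "48 * C1 * r * (exp 1 * (192 * C1 * K / \<eta>\<^sup>2 + 1))\<^sup>2 \<le> 1"
    and a: "0 < a" "exp (sqrt y / s0 * a) \<le> 1 + \<eta> / 2"
      "exp (sqrt y / s0 * B) * (real m * (\<integral>t. (h1 t)\<^sup>2 * indicator {t. a < \<bar>h1 t\<bar>} t \<partial>law)) \<le> \<eta> / 2 * s0"
    and high: "K * t \<le> real jmax * ln (real N / real m) \<or>
      (64 * K * y * (exp 1 * (384 * K * B\<^sup>2 / \<eta>\<^sup>2))\<^sup>2 \<le> 1 \<and>
       96 * real k * (real m)\<^sup>2 / (real N * real jmax) * (exp 1 * (4 * K * B\<^sup>2 / \<eta>\<^sup>2)) \<le> 1)"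
  shows "P.prob {z. sqrt y \<le> \<bar>ustat N z\<bar>} \<le>
    2 * exp (- ((1 - \<eta>)\<^sup>2 * t / (2 * (1 + \<eta>) * (real m * msq 1)))) + (5 + 2 * B\<^sup>2 / \<eta>\<^sup>2) * exp (- (K * t))"
proof -
  have y0: "0 < y" using t m by (simp add: y)
  have k0: "k > 0" using k_pos[OF t K \<eta> y k] .
  have ty: "y * real N / real m = t" using m by (simp add: y)
  note lin = linear_two_sided[OF s0 \<eta> y0 a, unfolded ty]
  have sum5: "(\<Sum>j=2..l. 5 * (exp (- 1) ^ j) ^ k) \<le> 5 * exp (- (K * t))" for l
  proof -
    have "(\<Sum>j=2..l. 5 * (exp (- 1) ^ j) ^ k) = 5 * (\<Sum>j=2..l. (exp (- 1 :: real) ^ j) ^ k)" by (simp only: sum_distrib_left)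
    also have "\<dots> \<le> 5 * exp (- real k)" by (intro mult_left_mono sum_exp_power_le k0) simp
    also have "\<dots> \<le> 5 * exp (- (K * t))" using k by simp
    finally show ?thesis .
  qed
  note smooth_comp = component_tail_smooth_small[OF t K \<eta> y k _ _ A r Nr rs]
  from high show ?thesis
  proof (elim disjE conjE)
    assume Kt: "K * t \<le> real jmax * ln (real N / real m)"
    define R where "R = (real m / real N) ^ Suc jmax * B\<^sup>2 / (\<eta> / 2 * sqrt y)\<^sup>2"
    have pos: "0 < real m / real N" using m by simp
    \<comment> \<open>Of the jmax + 1 factors m/N one is used up by y = t m/N in the squared level;
      the others give exp(-Kt).\<close>
    have "R = (real m / real N) ^ jmax * (real m / real N * B\<^sup>2 / (\<eta>\<^sup>2 / 4 * y))"
      using y0 by (simp add: R_def power_mult_distrib power_divide mult_ac)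
    also have "real m / real N * B\<^sup>2 / (\<eta>\<^sup>2 / 4 * y) = 4 * B\<^sup>2 / (\<eta>\<^sup>2 * t)"
      using m t by (simp add: y)
    also have "(real m / real N) ^ jmax = exp (- (real jmax * ln (real N / real m)))"
    proof -
      have "(real m / real N) ^ jmax = exp (ln (real m / real N)) ^ jmax" using pos by simp
      also have "\<dots> = exp (real jmax * ln (real m / real N))" by (rule exp_of_nat_mult[symmetric])
      also have "ln (real m / real N) = - ln (real N / real m)" using m by (simp add: ln_div)
      finally show ?thesis by simp
    qed
    also have "exp (- (real jmax * ln (real N / real m))) * (4 * B\<^sup>2 / (\<eta>\<^sup>2 * t)) \<le> exp (- (K * t)) * (4 * B\<^sup>2 / (\<eta>\<^sup>2 * 2))"
      using Kt t \<eta> by (intro mult_mono divide_left_mono mult_left_mono mult_pos_pos) auto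
    finally have R: "R \<le> 2 * B\<^sup>2 / \<eta>\<^sup>2 * exp (- (K * t))" by (simp add: mult.commute)
    have "P.prob {z. sqrt y \<le> \<bar>ustat N z\<bar>} \<le>
      2 * exp (- ((1 - \<eta>)\<^sup>2 * t / (2 * (1 + \<eta>) * (real m * msq 1)))) + (\<Sum>j=2..jmax. 5 * (exp (- 1) ^ j) ^ k) + R"
    proof (rule ustat_tail_union[OF \<eta> _ _ jmax(2)])
      show "P.prob {z. \<eta> / 2 ^ j * sqrt y \<le> \<bar>component N j z\<bar>} \<le> 5 * (exp (- 1) ^ j) ^ k" if "j \<in> {2..jmax}" for j
        using that by (intro smooth_comp) auto
      show "P.prob {z. \<eta> / 2 * sqrt y \<le> \<bar>\<Sum>j\<in>{jmax<..m}. component N j z\<bar>} \<le> R"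
        unfolding R_def using m \<eta> y0 by (intro high_degree_tail) auto
    qed (use lin y0 jmax in auto)
    then show ?thesis unfolding distrib_right[of 5 "2 * B\<^sup>2 / \<eta>\<^sup>2"] using sum5[of jmax] R by linarith
  next
    assume A1: "64 * K * y * (exp 1 * (384 * K * B\<^sup>2 / \<eta>\<^sup>2))\<^sup>2 \<le> 1"
      and z: "96 * real k * (real m)\<^sup>2 / (real N * real jmax) * (exp 1 * (4 * K * B\<^sup>2 / \<eta>\<^sup>2)) \<le> 1"
    have "P.prob {z. sqrt y \<le> \<bar>ustat N z\<bar>} \<le>
      2 * exp (- ((1 - \<eta>)\<^sup>2 * t / (2 * (1 + \<eta>) * (real m * msq 1)))) + (\<Sum>j=2..m. 5 * (exp (- 1) ^ j) ^ k) + 0"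
    proof (rule ustat_tail_union[OF \<eta> _ m(1) order_refl])
      show "P.prob {z. \<eta> / 2 ^ j * sqrt y \<le> \<bar>component N j z\<bar>} \<le> 5 * (exp (- 1) ^ j) ^ k" if j: "j \<in> {2..m}" for j
      proof (cases "j \<le> jmax")
        case True
        then show ?thesis using j by (intro smooth_comp) auto
      next
        case False
        then show ?thesis using j by (intro component_tail_bounded_small[OF t K \<eta> y k _ _ A1 z]) auto
      qed
      have "{z :: nat \<Rightarrow> real. \<eta> / 2 * sqrt y \<le> \<bar>\<Sum>j\<in>{m<..m}. component N j z\<bar>} = {}" using \<eta> y0 by (auto simp: not_le)
      then show "P.prob {z. \<eta> / 2 * sqrt y \<le> \<bar>\<Sum>j\<in>{m<..m}. component N j z\<bar>} \<le> 0" by simp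
    qed (use lin y0 in auto)
    moreover have "0 \<le> 2 * B\<^sup>2 / \<eta>\<^sup>2 * exp (- (K * t))" by simp
    ultimately show ?thesis unfolding distrib_right[of 5 "2 * B\<^sup>2 / \<eta>\<^sup>2"] using sum5[of m] by linarith
  qed
qed

text \<open>Under the root stand (m choose j) \<open>msq j\<close> and a factor at most
  (3\<tau>/j)^j. Up to jmax smoothness makes the first small; beyond it the first is at most B^2 and
  the large j makes the second small.\<close>

lemma lindeberg_sum_le:
  assumes u: "0 \<le> u" and low: "36 * C1 * (2 powr \<gamma> * M)\<^sup>2 * (u\<^sup>2 * B\<^sup>2) \<le> 1 / 4"
    and high: "12 * (u\<^sup>2 * B\<^sup>2 * B\<^sup>2) \<le> real jmax"
  shows "(\<Sum>j=2..m. real (m choose j) * sqrt (msq j * (u\<^sup>2 * B\<^sup>2 / real m) ^ j)) \<le> 1"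
proof -
  define \<tau> where "\<tau> = u\<^sup>2 * B\<^sup>2"
  have \<tau>0: "0 \<le> \<tau>" by (simp add: \<tau>_def)
  have "real (m choose j) * sqrt (msq j * (\<tau> / real m) ^ j) \<le> (1 / 2) ^ j" if j: "j \<in> {2..m}" for j
  proof -
    have j0: "0 < j" "j \<le> m" using j by auto
    have "real (m choose j) * sqrt (msq j * (\<tau> / real m) ^ j) = sqrt ((real (m choose j))\<^sup>2 * (msq j * (\<tau> / real m) ^ j))"
      by (simp add: real_sqrt_mult)
    also have "(real (m choose j))\<^sup>2 * (msq j * (\<tau> / real m) ^ j) = real (m choose j) * msq j * (real (m choose j) * (\<tau> / real m) ^ j)"
      by (simp add: power2_eq_square)
    also have "\<dots> \<le> real (m choose j) * msq j * ((3 * real m / real j) ^ j * (\<tau> / real m) ^ j)"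
      using \<tau>0 binomial_le_power[OF j0(1), of m] msq_nonneg by (intro mult_left_mono mult_right_mono) auto
    also have "(3 * real m / real j) ^ j * (\<tau> / real m) ^ j = (3 * \<tau> / real j) ^ j"
      unfolding power_mult_distrib[symmetric] using j0 by simp
    also have "real (m choose j) * msq j * (3 * \<tau> / real j) ^ j \<le> (1 / 4) ^ j"
    proof (cases "j \<le> jmax")
      case True
      have "real (m choose j) * msq j * (3 * \<tau> / real j) ^ j \<le> (12 * C1 * (2 powr \<gamma> * M)\<^sup>2) ^ j * (3 * \<tau>) ^ j"
        using variance_smooth[of j] True j \<tau>0 msq_nonneg C1 frac_le[of "3 * \<tau>" "3 * \<tau>" 1 "real j"]
        by (intro mult_mono power_mono) auto
      also have "\<dots> = (36 * C1 * (2 powr \<gamma> * M)\<^sup>2 * \<tau>) ^ j"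
        unfolding power_mult_distrib[symmetric] by (simp add: mult_ac)
      also have "\<dots> \<le> (1 / 4) ^ j" using low C1 \<tau>0 by (intro power_mono) (auto simp: \<tau>_def)
      finally show ?thesis .
    next
      case False
      have "real (m choose j) * msq j * (3 * \<tau> / real j) ^ j \<le> (B\<^sup>2) ^ j * (3 * \<tau> / real j) ^ j"
      proof (rule mult_right_mono)
        have "real (m choose j) * msq j \<le> B\<^sup>2" by (rule bessel_le[OF j0(2)])
        also have "\<dots> \<le> (B\<^sup>2) ^ j" using B1 j0 power_increasing[of 1 j "B\<^sup>2"] by (simp add: one_le_power)
        finally show "real (m choose j) * msq j \<le> (B\<^sup>2) ^ j" .
      qed (use \<tau>0 in auto)
      also have "\<dots> = (B\<^sup>2 * (3 * \<tau> / real j)) ^ j" by (simp only: power_mult_distrib)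
      also have "\<dots> \<le> (1 / 4) ^ j"
      proof (rule power_mono)
        have "12 * (\<tau> * B\<^sup>2) \<le> real j" using high False by (simp add: \<tau>_def)
        then show "B\<^sup>2 * (3 * \<tau> / real j) \<le> 1 / 4" using j0 by (simp add: field_simps)
      qed (use \<tau>0 in auto)
      finally show ?thesis .
    qed
    also have "sqrt ((1 / 4) ^ j) = (1 / 2) ^ j"
      by (simp add: real_sqrt_power real_sqrt_divide)
    finally show ?thesis by simp
  qed
  then have "(\<Sum>j=2..m. real (m choose j) * sqrt (msq j * (\<tau> / real m) ^ j)) \<le> (\<Sum>j=2..m. (1 / 2) ^ j)"
    by (rule sum_mono)
  also have "\<dots> \<le> 1 / 2" by (rule sum_half_powers)
  finally show ?thesis by (simp add: \<tau>_def)
qed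

end

section \<open>Absorbing the errors with constants uniform in N, m and the law\<close>

lemma exp_absorb_remainder:
  fixes e B s0 V t K :: real
  defines "\<eta> \<equiv> e / 16"
  defines "Z \<equiv> (5 + 2 * B\<^sup>2 / \<eta>\<^sup>2) / (4 * (e / (12 * B\<^sup>2)))"
  assumes e: "0 < e" "e \<le> 1" and V: "0 < s0" "s0 \<le> V" "V \<le> B\<^sup>2" and t: "2 \<le> t" and K: "1 / (2 * s0) + Z \<le> K"
  shows "2 * exp (- ((1 - \<eta>)\<^sup>2 * t / (2 * (1 + \<eta>) * V))) + (5 + 2 * B\<^sup>2 / \<eta>\<^sup>2) * exp (- (K * t))
    \<le> 2 * exp (- t / (2 * (1 + e) * V))"
proof -
  \<comment> \<open>A slack in the rate: the linear term decays at rate \<alpha>' + g, the target at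
    \<alpha>'. The remainder is at most 2 g t exp(-(\<alpha>' + g) t), and 1 + g t \<le> exp(g t)
    uses up the slack.\<close>
  define g where "g = e / (12 * B\<^sup>2)"
  define Y where "Y = 5 + 2 * B\<^sup>2 / \<eta>\<^sup>2"
  define \<alpha>' where "\<alpha>' = 1 / (2 * (1 + e) * V)"
  have V0: "0 < V" using V by linarith
  have B2: "0 < B\<^sup>2" using V0 V by linarith
  have g0: "0 < g" using e B2 by (simp add: g_def)
  have Y0: "0 < Y" by (simp add: Y_def add_pos_nonneg)
  have Z: "Z = Y / (4 * g)" by (simp add: Z_def Y_def g_def)
  have Z0: "0 < Z" using Y0 g0 by (simp add: Z)
  have step1: "\<alpha>' + g \<le> 1 / (2 * (1 + e / 2) * V)"
  proof -
    \<comment> \<open>1/(1 + e/2) - 1/(1 + e) equals (e/2)/((1 + e/2)(1 + e)), whose denominator is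
      at most 3.\<close>
    have "g = (1 / (2 * B\<^sup>2)) * ((e / 2) / 3)" by (simp add: g_def)
    also have "\<dots> \<le> (1 / (2 * V)) * ((e / 2) / ((1 + e / 2) * (1 + e)))"
    proof (intro mult_mono frac_le)
      show "(1 + e / 2) * (1 + e) \<le> 3" using mult_mono[of "1 + e / 2" "3 / 2" "1 + e" 2] e by simp
    qed (use e V V0 B2 in auto)
    also have "\<dots> = 1 / (2 * (1 + e / 2) * V) - \<alpha>'"
      using e V0 unfolding \<alpha>'_def by (simp add: divide_simps) (simp add: algebra_simps)?
    finally show ?thesis by simp
  qed
  have step2: "1 / (2 * (1 + e / 2) * V) \<le> (1 - \<eta>)\<^sup>2 / (2 * (1 + \<eta>) * V)"
  proof -
    have eta: "e = 16 * \<eta>" "0 < \<eta>" "\<eta> \<le> 1 / 16" using e by (auto simp: \<eta>_def)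
    \<comment> \<open>The factored form of (1 - \<eta>)^2 (1 + 8\<eta>) - (1 + \<eta>), with e/2 =
      8\<eta>.\<close>
    have "0 \<le> \<eta> * (5 - 15 * \<eta> + 8 * \<eta>\<^sup>2)" using eta by (intro mult_nonneg_nonneg add_nonneg_nonneg) auto
    then have "(1 + \<eta>) \<le> (1 - \<eta>)\<^sup>2 * (1 + e / 2)" unfolding eta(1) by (simp add: power2_eq_square algebra_simps)
    then have "1 / (1 + e / 2) \<le> (1 - \<eta>)\<^sup>2 / (1 + \<eta>)" using eta e by (simp add: field_simps)
    then have "1 / (1 + e / 2) / (2 * V) \<le> (1 - \<eta>)\<^sup>2 / (1 + \<eta>) / (2 * V)" using V0 by (intro divide_right_mono) auto
    then show ?thesis by (simp add: mult_ac)
  qed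
  have a: "\<alpha>' * t + g * t \<le> (1 - \<eta>)\<^sup>2 * t / (2 * (1 + \<eta>) * V)"
    using mult_right_mono[OF order_trans[OF step1 step2], of t] t by (simp add: distrib_right)
  have b: "\<alpha>' * t + g * t \<le> t / (2 * s0)"
  proof -
    have "1 / (2 * (1 + e / 2) * V) \<le> 1 / (2 * s0)"
    proof (rule divide_left_mono)
      have "1 * s0 \<le> (1 + e / 2) * V" using e V V0 by (intro mult_mono) auto
      then show "2 * s0 \<le> 2 * (1 + e / 2) * V" by (simp add: algebra_simps)
    qed (use e V V0 in \<open>auto intro!: mult_pos_pos\<close>)
    then have "\<alpha>' + g \<le> 1 / (2 * s0)" using step1 by linarith
    from mult_right_mono[OF this, of t] t show ?thesis by (simp add: distrib_right)
  qed
  \<comment> \<open>The part 1/(2 s0) of K covers the rate; the part Z turns the constant Y into 4g,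
    because exp(-Zt) \<le> 1/Z.\<close>
  have "Y * exp (- (K * t)) \<le> 2 * (g * t) * exp (- (\<alpha>' * t + g * t))"
  proof -
    have "(1 / (2 * s0) + Z) * t \<le> K * t" using K t by (intro mult_right_mono) auto
    then have "t / (2 * s0) + Z * t \<le> K * t" by (simp add: distrib_right)
    then have "exp (- (K * t)) \<le> exp (- (t / (2 * s0))) * exp (- (Z * t))" by (simp add: exp_add[symmetric])
    also have "\<dots> \<le> exp (- (\<alpha>' * t + g * t)) * (1 / Z)"
    proof (rule mult_mono)
      have "Z * 1 \<le> Z * t" using Z0 t by (intro mult_left_mono) auto
      also have "\<dots> \<le> exp (Z * t)" using exp_ge_add_one_self[of "Z * t"] by linarith
      finally show "exp (- (Z * t)) \<le> 1 / Z" using Z0 by (simp add: exp_minus field_simps)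
    qed (use b Z0 in auto)
    finally have "Y * exp (- (K * t)) \<le> Y * (exp (- (\<alpha>' * t + g * t)) * (1 / Z))" using Y0 by (intro mult_left_mono) auto
    also have "\<dots> = 4 * g * exp (- (\<alpha>' * t + g * t))" using Y0 g0 by (simp add: Z)
    also have "\<dots> \<le> 2 * (g * t) * exp (- (\<alpha>' * t + g * t))" using g0 t by (intro mult_right_mono) auto
    finally show ?thesis .
  qed
  then have rem: "2 * w + Y * exp (- (K * t)) \<le> 2 * w * (1 + g * t)" if "w = exp (- (\<alpha>' * t + g * t))" for w
    unfolding that[symmetric] by (simp add: distrib_left mult_ac)
  have "2 * exp (- ((1 - \<eta>)\<^sup>2 * t / (2 * (1 + \<eta>) * V))) \<le> 2 * exp (- (\<alpha>' * t + g * t))" using a by simp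
  then have "2 * exp (- ((1 - \<eta>)\<^sup>2 * t / (2 * (1 + \<eta>) * V))) + Y * exp (- (K * t)) \<le> 2 * exp (- (\<alpha>' * t + g * t)) * (1 + g * t)"
    using rem[OF refl] by linarith
  also have "\<dots> \<le> 2 * exp (- (\<alpha>' * t + g * t)) * exp (g * t)"
    by (intro mult_left_mono exp_ge_add_one_self) auto
  also have "\<dots> = 2 * exp (- (\<alpha>' * t))" by (simp add: exp_add[symmetric])
  also have "\<alpha>' * t = t / (2 * (1 + e) * V)" by (simp add: \<alpha>'_def)
  finally show ?thesis by (simp add: Y_def)
qed

text \<open>The constants are fixed before the space, the kernel, N and m, and this order of
  quantifiers makes the limit uniform. \<open>K0\<close> leaves room for a later lower bound on
  K.\<close>

lemma uniform_bound:
  fixes B s0 C1 \<gamma> e K0 :: real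
  assumes B: "1 \<le> B" and s0: "0 < s0" and C1: "0 < C1" and \<gamma>: "0 \<le> \<gamma>" and e: "0 < e" "e \<le> 1"
  shows "\<exists>K cY c. K0 \<le> K \<and> 1 \<le> K \<and> 0 < cY \<and> 0 < c \<and>
    (\<forall>(\<Omega> :: 'a measure) X h N m jmax M t k r. smooth_model \<Omega> X h N m B jmax C1 \<gamma> M \<longrightarrow>
      s0 \<le> proj1_variance \<Omega> m h X \<longrightarrow> 2 \<le> t \<longrightarrow> k = nat \<lceil>K * t\<rceil> \<longrightarrow>
      r = real (2 * k) * (real (2 * k) powr \<gamma> * M)\<^sup>2 * real m / real N \<longrightarrow> real N * r ^ k \<le> 1 \<longrightarrow> r \<le> c \<longrightarrow>
      t * real m / real N \<le> cY \<or> M\<^sup>2 \<le> c \<and> 1 \<le> c * real jmax \<longrightarrow>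
      K * t \<le> real jmax * ln (real N / real m) \<or> t * real m / real N \<le> cY \<and> t * (real m)\<^sup>2 \<le> c * (real N * real jmax) \<longrightarrow>
      measure \<Omega> {\<omega> \<in> space \<Omega>. sqrt (t * real m / real N) \<le> \<bar>U_stat N m h X \<omega>\<bar>}
        \<le> 2 * exp (- t / (2 * (1 + e) * proj1_variance \<Omega> m h X)))"
proof -
  define \<eta> where "\<eta> = e / 16"
  have \<eta>: "0 < \<eta>" "\<eta> < 1" using e by (auto simp: \<eta>_def)
  define Z where "Z = (5 + 2 * B\<^sup>2 / \<eta>\<^sup>2) / (4 * (e / (12 * B\<^sup>2)))"
  have Z0: "0 \<le> Z" using e by (simp add: Z_def)
  define K where "K = max K0 0 + 1 + 1 / (2 * s0) + Z"
  have KZ: "1 / (2 * s0) + Z \<le> K" by (simp add: K_def)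
  have "0 \<le> 1 / (2 * s0)" using s0 by simp
  then have K: "K0 \<le> K" "1 \<le> K" using Z0 unfolding K_def by linarith+
  \<comment> \<open>Chosen so that exp(a B/s0) = 1 + \<eta>/2. It serves as a bound on sqrt y with
    truncation at B, and as truncation level when only sqrt y \<le> B is known.\<close>
  define a where "a = s0 * ln (1 + \<eta> / 2) / B"
  have a0: "0 < a" using s0 B \<eta> by (simp add: a_def)
  define e0 where "e0 = exp (B\<^sup>2 / s0)"
  \<comment> \<open>The Lindeberg bound 2(B + 1)/u times the worst factor \<open>e0\<close> is then
    exactly the permitted \<eta>/2 s0.\<close>
  define u where "u = 4 * e0 * (B + 1) / (\<eta> * s0)"
  have u0: "0 < u" using B \<eta> s0 by (simp add: u_def e0_def)
  define Q1 where "Q1 = 64 * K * (exp 1 * (384 * K * B\<^sup>2 / \<eta>\<^sup>2))\<^sup>2"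
  have Q10: "0 < Q1" using K B \<eta> by (simp add: Q1_def)
  define cY where "cY = min 1 (min (1 / Q1) (a\<^sup>2))"
  have cY: "0 < cY" "cY \<le> 1" "cY \<le> 1 / Q1" "cY \<le> a\<^sup>2" using Q10 a0 by (auto simp: cY_def)
  define \<kappa> where "\<kappa> = (2 powr \<gamma>)\<^sup>2"
  have \<kappa>0: "0 < \<kappa>" by (simp add: \<kappa>_def)
  \<comment> \<open>Each Z encodes one smallness condition: Z1 the variance term for y > cY, Z2 to
    Z4 the Lindeberg bound, Z5 the ratio r, Z6 the degrees beyond jmax.\<close>
  define Z1 where "Z1 = 768 * K * B\<^sup>2 * C1 * \<kappa> * (exp 1 * (6 / (\<eta>\<^sup>2 * cY)))"
  define Z2 where "Z2 = 4 * (36 * C1 * \<kappa> * (u\<^sup>2 * B\<^sup>2))"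
  define Z3 where "Z3 = u * B\<^sup>2 / a"
  define Z4 where "Z4 = 12 * (u\<^sup>2 * B\<^sup>2 * B\<^sup>2)"
  define Z5 where "Z5 = 48 * C1 * (exp 1 * (192 * C1 * K / \<eta>\<^sup>2 + 1))\<^sup>2"
  define Z6 where "Z6 = 192 * K * (exp 1 * (4 * K * B\<^sup>2 / \<eta>\<^sup>2))"
  have Zs: "0 \<le> Z1" "0 \<le> Z2" "0 \<le> Z3" "0 \<le> Z4" "0 \<le> Z5" "0 \<le> Z6"
    using K B C1 \<kappa>0 \<eta> cY u0 a0 by (auto simp: Z1_def Z2_def Z3_def Z4_def Z5_def Z6_def)
  define W where "W = 1 + Z1 + Z2 + Z3 + Z4 + Z5 + Z6"
  have W0: "0 < W" using Zs by (simp add: W_def)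
  define c where "c = 1 / W"
  have c0: "0 < c" using W0 by (simp add: c_def)
  have cZ: "c * z \<le> 1" if "z \<le> W" for z using that W0 by (simp add: c_def)
  have cle: "x * z \<le> 1" if "x \<le> c" "0 \<le> z" "z \<le> W" for x z
    using mult_right_mono[OF that(1,2)] cZ[OF that(3)] by linarith
  have ZW: "Z1 \<le> W" "Z2 \<le> W" "Z3 \<le> W" "Z4 \<le> W" "Z5 \<le> W" "Z6 \<le> W" using Zs by (auto simp: W_def)
  show ?thesis
  proof (rule exI[of _ K], rule exI[of _ cY], rule exI[of _ c], intro conjI allI impI)
    fix \<Omega> :: "'a measure" and X h N m jmax M t k r
    assume sm: "smooth_model \<Omega> X h N m B jmax C1 \<gamma> M"
      and sv: "s0 \<le> proj1_variance \<Omega> m h X" and t: "2 \<le> t" and k: "k = nat \<lceil>K * t\<rceil>"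
      and r: "r = real (2 * k) * (real (2 * k) powr \<gamma> * M)\<^sup>2 * real m / real N"
      and Nr: "real N * r ^ k \<le> 1" and rc: "r \<le> c"
      and H1: "t * real m / real N \<le> cY \<or> M\<^sup>2 \<le> c \<and> 1 \<le> c * real jmax"
      and H2: "K * t \<le> real jmax * ln (real N / real m) \<or> t * real m / real N \<le> cY \<and> t * (real m)\<^sup>2 \<le> c * (real N * real jmax)"
    interpret smooth_model \<Omega> X h N m B jmax C1 \<gamma> M by (rule sm)
    define y where "y = t * real m / real N"
    have y0: "0 < y" using t m by (simp add: y_def)
    have V: "s0 \<le> real m * msq 1" using sv by (simp add: proj1_variance_eq)
    have Kt1: "1 \<le> K * t" using K t mult_mono[of 1 K 1 t] by simp
    have kk: "K * t \<le> real k" "real k \<le> 2 * K * t"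
    proof -
      have "0 \<le> \<lceil>K * t\<rceil>" using Kt1 by linarith
      then have rk: "real k = of_int \<lceil>K * t\<rceil>" by (simp add: k)
      show "K * t \<le> real k" unfolding rk by (rule le_of_int_ceiling)
      have "real k \<le> K * t + 1" unfolding rk using ceiling_correct[of "K * t"] by linarith
      then show "real k \<le> 2 * K * t" using Kt1 by linarith
    qed
    have hb: "\<bar>h1 s\<bar> \<le> B" for s by (rule h1_bounded[OF m(1)])
    have "P.prob {z. sqrt y \<le> \<bar>ustat N z\<bar>} \<le> 2 * exp (- t / (2 * (1 + e) * (real m * msq 1)))"
    proof (cases "y \<le> B\<^sup>2")
      \<comment> \<open>A level above B is never reached.\<close>
      case False
      then have "sqrt (B\<^sup>2) < sqrt y" by (intro real_sqrt_less_mono) simp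
      then have "B < sqrt y" using B by simp
      then have "\<not> sqrt y \<le> \<bar>ustat N z\<bar>" for z using ustat_bounded[of z] by linarith
      then show ?thesis by simp
    next
      case yB: True
      have small_y: "64 * K * y * (exp 1 * (384 * K * B\<^sup>2 / \<eta>\<^sup>2))\<^sup>2 \<le> 1" if "y \<le> cY"
      proof -
        have "y \<le> 1 / Q1" using that cY by linarith
        then have "y * Q1 \<le> 1" using Q10 by (simp add: pos_le_divide_eq)
        then show ?thesis by (simp add: Q1_def mult_ac)
      qed
      have A: "64 * K * y * (exp 1 * (384 * K * B\<^sup>2 / \<eta>\<^sup>2))\<^sup>2 \<le> 1 \<or>
       (0 < cY \<and> cY \<le> 1 \<and> cY \<le> y \<and> y \<le> B\<^sup>2 \<and> 768 * K * B\<^sup>2 * C1 * (2 powr \<gamma> * M)\<^sup>2 * (exp 1 * (6 / (\<eta>\<^sup>2 * cY))) \<le> 1)"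
      proof (cases "y \<le> cY")
        case True then show ?thesis using small_y by simp
      next
        case False
        then have "M\<^sup>2 * Z1 \<le> 1" using H1 Zs ZW unfolding y_def[symmetric] by (intro cle) auto
        then have "768 * K * B\<^sup>2 * C1 * (2 powr \<gamma> * M)\<^sup>2 * (exp 1 * (6 / (\<eta>\<^sup>2 * cY))) \<le> 1"
          by (simp add: Z1_def \<kappa>_def power_mult_distrib mult_ac)
        then show ?thesis using False cY yB by simp
      qed
      have high: "K * t \<le> real jmax * ln (real N / real m) \<or>
        (64 * K * y * (exp 1 * (384 * K * B\<^sup>2 / \<eta>\<^sup>2))\<^sup>2 \<le> 1 \<and>
         96 * real k * (real m)\<^sup>2 / (real N * real jmax) * (exp 1 * (4 * K * B\<^sup>2 / \<eta>\<^sup>2)) \<le> 1)"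
      proof (cases "K * t \<le> real jmax * ln (real N / real m)")
        case False
        then have yc: "y \<le> cY" and tc: "t * (real m)\<^sup>2 \<le> c * (real N * real jmax)" using H2 by (auto simp: y_def)
        have Nj: "0 < real N * real jmax" using m jmax by simp
        have "96 * real k * (real m)\<^sup>2 / (real N * real jmax) \<le> 96 * (2 * K * t) * (real m)\<^sup>2 / (real N * real jmax)"
          using kk Nj by (intro divide_right_mono mult_right_mono) auto
        also have "\<dots> = 192 * K * (t * (real m)\<^sup>2 / (real N * real jmax))" by simp
        also have "\<dots> \<le> 192 * K * c" using tc Nj K by (intro mult_left_mono) (auto simp: pos_divide_le_eq)
        finally have "96 * real k * (real m)\<^sup>2 / (real N * real jmax) * (exp 1 * (4 * K * B\<^sup>2 / \<eta>\<^sup>2)) \<le> 192 * K * c * (exp 1 * (4 * K * B\<^sup>2 / \<eta>\<^sup>2))"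
          using K by (intro mult_right_mono) auto
        also have "\<dots> = c * Z6" by (simp add: Z6_def)
        also have "\<dots> \<le> 1" by (rule cZ[OF ZW(6)])
        finally show ?thesis using small_y[OF yc] by simp
      qed simp
      have rs: "48 * C1 * r * (exp 1 * (192 * C1 * K / \<eta>\<^sup>2 + 1))\<^sup>2 \<le> 1"
        using cle[OF rc Zs(5) ZW(5)] by (simp add: Z5_def mult_ac)
      obtain b where b: "0 < b" "exp (sqrt y / s0 * b) \<le> 1 + \<eta> / 2"
        "exp (sqrt y / s0 * B) * (real m * (\<integral>t. (h1 t)\<^sup>2 * indicator {t. b < \<bar>h1 t\<bar>} t \<partial>law)) \<le> \<eta> / 2 * s0"
      proof (cases "y \<le> cY")
        \<comment> \<open>With truncation at B the indicator is empty, and small y controls the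
          exponential.\<close>
        case True
        then have "sqrt y \<le> sqrt (a\<^sup>2)" using cY by (intro real_sqrt_le_mono) linarith
        then have "sqrt y \<le> a" using a0 by simp
        then have "sqrt y / s0 * B \<le> a / s0 * B" using s0 B by (intro mult_right_mono divide_right_mono) auto
        also have "\<dots> = ln (1 + \<eta> / 2)" using s0 B by (simp add: a_def)
        finally have "exp (sqrt y / s0 * B) \<le> exp (ln (1 + \<eta> / 2))" by simp
        then have 1: "exp (sqrt y / s0 * B) \<le> 1 + \<eta> / 2" using \<eta> by simp
        have "{t. B < \<bar>h1 t\<bar>} = {}" using hb by (auto simp: not_less)
        then have "(\<integral>t. (h1 t)\<^sup>2 * indicator {t. B < \<bar>h1 t\<bar>} t \<partial>law) = 0" by simp
        then show ?thesis using 1 B \<eta> s0 by (intro that[of B]) auto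
      next
        \<comment> \<open>Here t m/N is not small, and \<open>H1\<close> supplies the small M and
          large jmax for the tilting argument.\<close>
        case False
        then have Mc: "M\<^sup>2 \<le> c" and jc: "1 \<le> c * real jmax" using H1 by (auto simp: y_def)
        have Wj: "W \<le> real jmax" using jc W0 by (simp add: c_def field_simps)
        have sq: "sqrt y \<le> B" using real_sqrt_le_mono[OF yB] B by simp
        have "u * B\<^sup>2 \<le> a * real m"
        proof -
          have "Z3 \<le> real m" using ZW(3) Wj jmax by simp
          then show ?thesis using a0 by (simp add: Z3_def field_simps)
        qed
        moreover have "36 * C1 * (2 powr \<gamma> * M)\<^sup>2 * (u\<^sup>2 * B\<^sup>2) \<le> 1 / 4"
          using cle[OF Mc Zs(2) ZW(2)] by (simp add: Z2_def \<kappa>_def power_mult_distrib mult_ac)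
        moreover have "12 * (u\<^sup>2 * B\<^sup>2 * B\<^sup>2) \<le> real jmax" using ZW(4) Wj by (simp add: Z4_def)
        ultimately have L: "real m * (\<integral>t. (h1 t)\<^sup>2 * indicator {t. a < \<bar>h1 t\<bar>} t \<partial>law) \<le> 2 * (B + 1) / u"
          using u0 by (intro lindeberg_bound[OF m(1) a0 u0] lindeberg_sum_le) auto
        have "sqrt y / s0 * B \<le> B\<^sup>2 / s0"
          using sq s0 B mult_right_mono[OF sq, of B] by (simp add: divide_right_mono power2_eq_square)
        then have "exp (sqrt y / s0 * B) \<le> e0" by (simp add: e0_def)
        then have "exp (sqrt y / s0 * B) * (real m * (\<integral>t. (h1 t)\<^sup>2 * indicator {t. a < \<bar>h1 t\<bar>} t \<partial>law)) \<le> e0 * (2 * (B + 1) / u)"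
          using L by (intro mult_mono) (auto simp: e0_def)
        also have "e0 * (2 * (B + 1) / u) = u * (\<eta> / 2 * s0) / u" using \<eta> s0 by (simp add: u_def)
        also have "\<dots> = \<eta> / 2 * s0" using u0 by simp
        finally have 2: "exp (sqrt y / s0 * B) * (real m * (\<integral>t. (h1 t)\<^sup>2 * indicator {t. a < \<bar>h1 t\<bar>} t \<partial>law)) \<le> \<eta> / 2 * s0" .
        have "sqrt y / s0 * a \<le> B / s0 * a" using sq s0 a0 by (intro mult_right_mono divide_right_mono) auto
        also have "\<dots> = ln (1 + \<eta> / 2)" using s0 B by (simp add: a_def)
        finally have "exp (sqrt y / s0 * a) \<le> exp (ln (1 + \<eta> / 2))" by simp
        then show ?thesis using 2 a0 \<eta> by (intro that[of a]) auto
      qed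
      have "P.prob {z. sqrt y \<le> \<bar>ustat N z\<bar>} \<le>
        2 * exp (- ((1 - \<eta>)\<^sup>2 * t / (2 * (1 + \<eta>) * (real m * msq 1)))) + (5 + 2 * B\<^sup>2 / \<eta>\<^sup>2) * exp (- (K * t))"
        by (rule fixed_bound[OF t K(2) \<eta> y_def kk s0 V A r Nr rs b high])
      also have "\<dots> \<le> 2 * exp (- t / (2 * (1 + e) * (real m * msq 1)))"
        unfolding \<eta>_def using KZ unfolding Z_def \<eta>_def
        by (intro exp_absorb_remainder[OF e s0 V variance_le t])
      finally show ?thesis .
    qed
    then show "measure \<Omega> {\<omega> \<in> space \<Omega>. sqrt (t * real m / real N) \<le> \<bar>U_stat N m h X \<omega>\<bar>}
        \<le> 2 * exp (- t / (2 * (1 + e) * proj1_variance \<Omega> m h X))"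
      unfolding U_stat_tail proj1_variance_eq y_def .
  qed (use K cY c0 in auto)
qed

section \<open>Uniformity in the ratio N/m\<close>

lemma eventually_ratio_at_top:
  "eventually Q (ratio_at_top R) \<longleftrightarrow> (\<exists>T. \<forall>(N, m)\<in>R. T \<le> real N / real m \<longrightarrow> Q (N, m))"
  unfolding ratio_at_top_def eventually_inf_principal eventually_filtercomap_at_top_linorder
  by (intro arg_cong[where f=Ex] ext) auto

text \<open>The bound with a fixed \<open>e\<close> for all large \<open>N/m\<close> gives \<open>\<epsilon> \<rightarrow> 0\<close> by taking an infimum over \<open>e\<close>; the
  remaining pairs are covered because a large enough \<open>\<epsilon>\<close> makes the right-hand side at least 1.\<close>

lemma deviation_boundI:
  fixes R :: "(nat \<times> nat) set" and \<Omega> :: "nat \<Rightarrow> nat \<Rightarrow> 'a measure"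
    and X :: "nat \<Rightarrow> nat \<Rightarrow> nat \<Rightarrow> 'a \<Rightarrow> real" and h :: "nat \<Rightarrow> (nat \<Rightarrow> real) \<Rightarrow> real" and q :: "nat \<Rightarrow> nat \<Rightarrow> real"
  defines "bound e N m \<equiv> \<forall>t. 2 \<le> t \<and> t \<le> q N m \<longrightarrow>
      measure (\<Omega> N m) {\<omega> \<in> space (\<Omega> N m). \<bar>U_stat N m (h m) (X N m) \<omega>\<bar> \<ge> sqrt (t * real m / real N)}
        \<le> 2 * exp (- t / (2 * (1 + e) * proj1_variance (\<Omega> N m) m (h m) (X N m)))"
  assumes prob: "\<And>N m. (N, m) \<in> R \<Longrightarrow> prob_space (\<Omega> N m)"
    and pos: "\<And>N m. (N, m) \<in> R \<Longrightarrow> 0 < m \<and> m \<le> N"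
    and ev: "\<And>e. 0 < e \<Longrightarrow> e \<le> 1 \<Longrightarrow> eventually (\<lambda>(N, m). bound e N m) (ratio_at_top R)"
  shows "deviation_bound R \<Omega> X h q"
proof -
  let ?V = "\<lambda>N m. proj1_variance (\<Omega> N m) m (h m) (X N m)"
  have V0: "0 \<le> ?V N m" if "(N, m) \<in> R" for N m
  proof -
    interpret prob_space "\<Omega> N m" by (rule prob[OF that])
    show ?thesis unfolding proj1_variance_def by (rule variance_positive)
  qed
  have mono: "bound e' N m" if R: "(N, m) \<in> R" and e: "0 \<le> e" "e \<le> e'" and b: "bound e N m" for e e' N m
    unfolding bound_def
  proof (intro allI impI)
    fix t assume t: "2 \<le> t \<and> t \<le> q N m"
    have "- t / (2 * (1 + e) * ?V N m) \<le> - t / (2 * (1 + e') * ?V N m)"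
    proof (cases "?V N m = 0")
      case False
      then have "0 < ?V N m" using V0[OF R] by simp
      then have "t / (2 * (1 + e') * ?V N m) \<le> t / (2 * (1 + e) * ?V N m)"
        using t e by (intro divide_left_mono mult_right_mono mult_pos_pos) auto
      then show ?thesis by simp
    qed simp
    then have "2 * exp (- t / (2 * (1 + e) * ?V N m)) \<le> 2 * exp (- t / (2 * (1 + e') * ?V N m))" by simp
    then show "measure (\<Omega> N m) {\<omega> \<in> space (\<Omega> N m). \<bar>U_stat N m (h m) (X N m) \<omega>\<bar> \<ge> sqrt (t * real m / real N)}
        \<le> 2 * exp (- t / (2 * (1 + e') * ?V N m))"
      using b t unfolding bound_def by (meson order_trans)
  qed
  \<comment> \<open>With e = max 0 (q/V) the exponent is at least -1/2, so the right-hand side is at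
    least 2 (1 - 1/2). For V = 0, division by zero makes the exponent 0.\<close>
  have ex: "\<exists>e\<ge>0. bound e N m" if R: "(N, m) \<in> R" for N m
  proof (intro exI[of _ "max 0 (q N m / ?V N m)"] conjI)
    interpret prob_space "\<Omega> N m" by (rule prob[OF R])
    let ?e = "max 0 (q N m / ?V N m)"
    show "bound ?e N m" unfolding bound_def
    proof (intro allI impI)
      fix t assume t: "2 \<le> t \<and> t \<le> q N m"
      have "t / (2 * (1 + ?e) * ?V N m) \<le> 1 / 2"
      proof (cases "?V N m = 0")
        case False
        then have V: "0 < ?V N m" using V0[OF R] by simp
        have "t \<le> q N m / ?V N m * ?V N m" using V t by simp
        also have "\<dots> \<le> (1 + ?e) * ?V N m" using V by (intro mult_right_mono) auto
        finally have le: "t \<le> (1 + ?e) * ?V N m" .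
        have "0 < (1 + ?e) * ?V N m" using V by (intro mult_pos_pos add_pos_nonneg) auto
        then show ?thesis unfolding mult.assoc using le by (simp only: divide_simps) simp
      qed simp
      then have "1 / 2 \<le> 1 + - t / (2 * (1 + ?e) * ?V N m)" by simp
      also have "\<dots> \<le> exp (- t / (2 * (1 + ?e) * ?V N m))" by (rule exp_ge_add_one_self)
      finally have "1 \<le> 2 * exp (- t / (2 * (1 + ?e) * ?V N m))" by simp
      then show "measure (\<Omega> N m) {\<omega> \<in> space (\<Omega> N m). \<bar>U_stat N m (h m) (X N m) \<omega>\<bar> \<ge> sqrt (t * real m / real N)}
        \<le> 2 * exp (- t / (2 * (1 + ?e) * ?V N m))" using prob_le_1 by (meson order_trans)
    qed
  qed simp
  define I where "I N m = Inf {e. 0 \<le> e \<and> bound e N m}" for N m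
  \<comment> \<open>The summand m/N tends to 0 and keeps \<epsilon> strictly above the infimum,
    where monotonicity gives the bound.\<close>
  define \<epsilon> where "\<epsilon> N m = I N m + real m / real N" for N m
  have bdd: "bdd_below {e. 0 \<le> e \<and> bound e N m}" for N m by (rule bdd_belowI[of _ 0]) auto
  have I0: "0 \<le> I N m" if "(N, m) \<in> R" for N m
    unfolding I_def using ex[OF that] by (intro cInf_greatest) auto
  have \<epsilon>0: "0 < \<epsilon> N m" if "(N, m) \<in> R" for N m
    using I0[OF that] pos[OF that] by (simp add: \<epsilon>_def add_nonneg_pos)
  have b\<epsilon>: "bound (\<epsilon> N m) N m" if R: "(N, m) \<in> R" for N m
  proof -
    have "I N m < \<epsilon> N m" using pos[OF R] by (simp add: \<epsilon>_def)
    then obtain e where "0 \<le> e" "bound e N m" "e < \<epsilon> N m"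
      unfolding I_def using ex[OF R] by (subst (asm) cInf_less_iff[OF _ bdd]) auto
    then show ?thesis using mono[OF R, of e "\<epsilon> N m"] by simp
  qed
  have lim: "((\<lambda>(N, m). \<epsilon> N m) \<longlongrightarrow> 0) (ratio_at_top R)"
  proof (rule tendstoI)
    fix d :: real assume d: "0 < d"
    define e where "e = min 1 (d / 3)"
    have e: "0 < e" "e \<le> 1" "e \<le> d / 3" using d by (auto simp: e_def)
    obtain T where T: "\<forall>(N, m)\<in>R. T \<le> real N / real m \<longrightarrow> bound e N m"
      using ev[OF e(1,2)] by (auto simp: eventually_ratio_at_top)
    show "eventually (\<lambda>x. dist (case x of (N, m) \<Rightarrow> \<epsilon> N m) 0 < d) (ratio_at_top R)"
      unfolding eventually_ratio_at_top
    proof (intro exI[of _ "max T (3 / d)"] ballI, clarify)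
      fix N m assume R: "(N, m) \<in> R" and r: "max T (3 / d) \<le> real N / real m"
      then have "bound e N m" using T by auto
      then have "I N m \<le> e" unfolding I_def using e by (intro cInf_lower bdd) auto
      moreover have "real m / real N \<le> d / 3"
        using r pos[OF R] d by (auto simp: field_simps)
      ultimately have "\<epsilon> N m < d" using e d unfolding \<epsilon>_def by linarith
      then show "dist (\<epsilon> N m) 0 < d" using \<epsilon>0[OF R] by simp
    qed
  qed
  show ?thesis unfolding deviation_bound_def
  proof (intro exI[of _ \<epsilon>] conjI ballI lim)
    fix x assume x: "x \<in> R"
    show "case x of (N, m) \<Rightarrow> - 1 < \<epsilon> N m" using \<epsilon>0 x by (cases x) force
    show "case x of (N, m) \<Rightarrow> \<forall>t. 2 \<le> t \<and> t \<le> q N m \<longrightarrow>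
      measure (\<Omega> N m) {\<omega> \<in> space (\<Omega> N m). \<bar>U_stat N m (h m) (X N m) \<omega>\<bar> \<ge> sqrt (t * real m / real N)}
        \<le> 2 * exp (- t / (2 * (1 + \<epsilon> N m) * ?V N m))"
      using b\<epsilon> x unfolding bound_def by (cases x) auto
  qed
qed

text \<open>By ln x \<le> x^a/a with a = \<delta>/(4s) the left side is at most C x^(\<delta>/4);
  for large x the other half of the exponent absorbs C.\<close>

lemma log_power_bound:
  fixes s \<delta> :: real
  assumes "0 < s" "0 < \<delta>"
  obtains x0 where "1 \<le> x0" "\<And>x. x0 \<le> x \<Longrightarrow> (2 * ln x) powr s \<le> x powr (\<delta> / 2)"
proof -
  define a where "a = \<delta> / (4 * s)"
  define C where "C = (2 / a) powr s"
  have a: "0 < a" using assms by (simp add: a_def)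
  have C0: "0 < C" using a by (simp add: C_def)
  define x0 where "x0 = max 1 (C powr (4 / \<delta>))"
  have bound: "(2 * ln x) powr s \<le> x powr (\<delta> / 2)" if x: "x0 \<le> x" for x
  proof -
    have x1: "1 \<le> x" and xC: "C powr (4 / \<delta>) \<le> x" using x by (auto simp: x0_def)
    have "ln x \<le> x powr a / a" by (rule ln_powr_bound[OF x1 a])
    then have "(2 * ln x) powr s \<le> (2 / a * x powr a) powr s"
      using x1 assms by (intro powr_mono2) auto
    also have "\<dots> = C * x powr (\<delta> / 4)"
    proof -
      have "a * s = \<delta> / 4" using assms by (simp add: a_def)
      moreover have "(2 / a * x powr a) powr s = (2 / a) powr s * (x powr a) powr s"
        by (rule powr_mult)
      ultimately show ?thesis by (simp only: C_def powr_powr)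
    qed
    also have "C = (C powr (4 / \<delta>)) powr (\<delta> / 4)" using C0 assms by (simp add: powr_powr)
    also have "\<dots> \<le> x powr (\<delta> / 4)" using xC assms by (intro powr_mono2) auto
    also have "x powr (\<delta> / 4) * x powr (\<delta> / 4) = x powr (\<delta> / 2)" by (simp add: powr_add[symmetric])
    finally show ?thesis by (simp add: mult_right_mono)
  qed
  have "1 \<le> x0" by (simp add: x0_def)
  then show ?thesis using bound by (rule that)
qed

text \<open>For \<open>k < ln N\<close> the factor \<open>N\<close> is compensated by the power saving in assumption (iv).\<close>

lemma moment_ratio_small:
  fixes t K \<gamma> M A c' \<delta> :: real
  assumes N: "0 < N" and m: "0 < m" and M: "0 < M" and K: "1 \<le> K" "1 / \<delta> \<le> K" and t: "2 \<le> t" and \<gamma>: "0 \<le> \<gamma>" and \<delta>: "0 < \<delta>"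
    and k: "k = nat \<lceil>K * t\<rceil>" and r: "r = real (2 * k) * (real (2 * k) powr \<gamma> * M)\<^sup>2 * real m / real N"
    and A: "A = real N / (real m * M\<^sup>2)" and tA: "t \<le> c' * A powr (1 / (1 + 2 * \<gamma>))"
    and c': "0 < c'" "4 * K * c' \<le> exp (- 1)"
    and mM: "real m * M\<^sup>2 \<le> real N powr (1 - \<delta>)" and lnN: "(2 * ln (real N)) powr (1 + 2 * \<gamma>) \<le> real N powr (\<delta> / 2)"
  shows "real N * r ^ k \<le> 1" "r \<le> 4 * K * c'"
proof -
  define s where "s = 1 + 2 * \<gamma>"
  have s: "1 \<le> s" using \<gamma> by (simp add: s_def)
  have A0: "0 < A" using N m M by (simp add: A)
  have Kt1: "2 \<le> K * t" using K t mult_mono[of 1 K 2 t] by simp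
  have "0 \<le> \<lceil>K * t\<rceil>" using Kt1 by linarith
  then have rk: "real k = of_int \<lceil>K * t\<rceil>" by (simp add: k)
  have kl: "K * t \<le> real k" unfolding rk by (rule le_of_int_ceiling)
  have ku: "real k \<le> 2 * (K * t)" unfolding rk using ceiling_correct[of "K * t"] Kt1 by linarith
  have k0: "0 < real k" using kl Kt1 by linarith
  \<comment> \<open>k enters r once directly and with power 2\<gamma> through the moments, hence the
    exponent in \<open>tA\<close>.\<close>
  have r_eq: "r = real (2 * k) powr s / A"
  proof -
    have "real (2 * k) * (real (2 * k) powr \<gamma>)\<^sup>2 = real (2 * k) powr s"
      unfolding s_def powr_add using k0 by (simp add: powr_power mult.commute)
    then show ?thesis using N m M by (simp add: r A power_mult_distrib field_simps)
  qed
  have r0: "0 \<le> r" using A0 by (simp add: r_eq)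
  have "real (2 * k) powr s \<le> (4 * K * c' * A powr (1 / s)) powr s"
  proof (rule powr_mono2)
    have "real (2 * k) \<le> 4 * K * t" using ku by simp
    also have "\<dots> \<le> 4 * K * (c' * A powr (1 / s))" using tA K unfolding s_def by (intro mult_left_mono) auto
    finally show "real (2 * k) \<le> 4 * K * c' * A powr (1 / s)" by (simp only: mult.assoc)
  qed (use s in auto)
  also have "\<dots> = (4 * K * c') powr s * A"
    using K c' A0 s by (simp add: powr_mult powr_powr)
  also have "(4 * K * c') powr s \<le> (4 * K * c') powr 1"
  proof (rule powr_mono')
    have "exp (- 1 :: real) \<le> 1" by simp
    then show "4 * K * c' \<le> 1" using c' by linarith
  qed (use s K c' in auto)
  finally have "real (2 * k) powr s \<le> 4 * K * c' * A" using K c' A0 by (simp add: mult_right_mono)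
  then show rc: "r \<le> 4 * K * c'" using A0 by (simp add: r_eq pos_divide_le_eq)
  show "real N * r ^ k \<le> 1"
  proof (cases "ln (real N) \<le> real k")
    case True
    have "r ^ k \<le> exp (- 1) ^ k" using rc c' r0 by (intro power_mono) auto
    also have "\<dots> = exp (- real k)" by (simp add: exp_of_nat_mult[symmetric])
    finally have "real N * r ^ k \<le> real N * exp (- real k)" by (intro mult_left_mono) auto
    also have "\<dots> \<le> real N * exp (- ln (real N))" using True by (intro mult_left_mono) auto
    also have "\<dots> = 1" using N by (simp add: exp_minus)
    finally show ?thesis .
  next
    case False
    have "r \<le> (2 * ln (real N)) powr s / A"
      unfolding r_eq using False s A0 by (intro divide_right_mono powr_mono2) auto
    also have "\<dots> \<le> real N powr (\<delta> / 2) * (real m * M\<^sup>2 / real N)"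
      using lnN N m M by (simp add: A s_def divide_right_mono mult_right_mono)
    also have "\<dots> \<le> real N powr (\<delta> / 2) * (real N powr (1 - \<delta>) / real N)"
      using mM by (intro mult_left_mono divide_right_mono) auto
    also have "real N powr (1 - \<delta>) / real N = real N powr (- \<delta>)"
      using N by (simp add: powr_diff powr_minus divide_simps)
    also have "real N powr (\<delta> / 2) * real N powr (- \<delta>) = real N powr (- (\<delta> / 2))"
      by (simp add: powr_add[symmetric])
    finally have "r ^ k \<le> (real N powr (- (\<delta> / 2))) ^ k" using r0 by (intro power_mono)
    also have "\<dots> = real N powr (- (\<delta> / 2) * real k)"
      using N by (subst powr_realpow[symmetric]) (simp_all add: powr_powr)
    also have "\<dots> \<le> real N powr (- 1)"
    proof (rule powr_mono)
      \<comment> \<open>This gives \<delta>k/2 \<ge> 1, so that k factors N^(-\<delta>/2) compensate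
        N.\<close>
      have "1 / \<delta> * 2 \<le> K * t" using K t \<delta> by (intro mult_mono) auto
      then have "1 / \<delta> * 2 \<le> real k" using kl by linarith
      then have "2 \<le> \<delta> * real k" using \<delta> by (simp add: field_simps)
      then show "- (\<delta> / 2) * real k \<le> - 1" by simp
    qed (use N in simp)
    finally have "real N * r ^ k \<le> real N * real N powr (- 1)" by (intro mult_left_mono) auto
    then show ?thesis using N by (simp add: powr_minus)
  qed
qed

theorem corollary4p1:
  fixes R :: "(nat \<times> nat) set"
    and \<Omega> :: "nat \<Rightarrow> nat \<Rightarrow> 'a measure"
    and X :: "nat \<Rightarrow> nat \<Rightarrow> nat \<Rightarrow> 'a \<Rightarrow> real"
    and h :: "nat \<Rightarrow> (nat \<Rightarrow> real) \<Rightarrow> real"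
    and jmax :: "nat \<Rightarrow> nat \<Rightarrow> nat"
    and M q :: "nat \<Rightarrow> nat \<Rightarrow> real"
    and C1 \<gamma>2 \<delta> :: real
  assumes m_le_N: "\<And>N m. (N, m) \<in> R \<Longrightarrow> m \<le> N"
    and jmax: "\<And>N m. (N, m) \<in> R \<Longrightarrow> 2 \<le> jmax N m \<and> jmax N m \<le> m"
    and prob: "\<And>N m. (N, m) \<in> R \<Longrightarrow> prob_space (\<Omega> N m)"
    and indep: "\<And>N m. (N, m) \<in> R \<Longrightarrow>
        prob_space.indep_vars (\<Omega> N m) (\<lambda>_. borel) (X N m) {1..N}"
    and ident: "\<And>N m i. (N, m) \<in> R \<Longrightarrow> i \<in> {1..N} \<Longrightarrow>
        distr (\<Omega> N m) borel (X N m i) = distr (\<Omega> N m) borel (X N m 1)"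
    and kernel: "\<And>N m. (N, m) \<in> R \<Longrightarrow> symmetric_kernel m (h m)"
    and square_integrable: "\<And>N m. (N, m) \<in> R \<Longrightarrow>
        integrable (\<Omega> N m) (\<lambda>\<omega>. (scaled_kernel m (h m) (\<lambda>i. X N m i \<omega>))\<^sup>2)"
    and centered: "\<And>N m. (N, m) \<in> R \<Longrightarrow>
        prob_space.expectation (\<Omega> N m) (\<lambda>\<omega>. scaled_kernel m (h m) (\<lambda>i. X N m i \<omega>)) = 0"
    and nondegenerate: "\<And>N m. (N, m) \<in> R \<Longrightarrow>
        measure (\<Omega> N m) {\<omega> \<in> space (\<Omega> N m).
          hoeffding_proj1 (\<Omega> N m) m (h m) (X N m) (X N m 1 \<omega>) \<noteq> 0} > 0"
    and constants: "C1 > 0" "\<gamma>2 \<ge> 0" "\<delta> > 0"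
    and M_pos: "\<And>N m. (N, m) \<in> R \<Longrightarrow> M N m > 0"
    \<comment> \<open>(i)\<close>
    and smooth: "\<And>N m j. (N, m) \<in> R \<Longrightarrow> 2 \<le> j \<Longrightarrow> j \<le> jmax N m \<Longrightarrow>
        mixed_partials_exist j (kernel_mean (\<Omega> N m) m (h m) (X N m) j)"
    and deriv_bound: "\<And>N m j x. (N, m) \<in> R \<Longrightarrow> 2 \<le> j \<Longrightarrow> j \<le> jmax N m \<Longrightarrow>
        \<bar>mixed_partial 1 j (kernel_mean (\<Omega> N m) m (h m) (X N m) j) x\<bar>
          \<le> (C1 / real m) powr (real j / 2) * real j powr (real j / 2)"
    and integrable_X: "\<And>N m. (N, m) \<in> R \<Longrightarrow> integrable (\<Omega> N m) (X N m 1)"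
    and integrable_moments: "\<And>N m k. (N, m) \<in> R \<Longrightarrow> 2 \<le> k \<Longrightarrow>
        integrable (\<Omega> N m)
          (\<lambda>\<omega>. \<bar>X N m 1 \<omega> - prob_space.expectation (\<Omega> N m) (X N m 1)\<bar> ^ k)"
    and moment_bound: "\<And>N m k. (N, m) \<in> R \<Longrightarrow> 2 \<le> k \<Longrightarrow>
        prob_space.expectation (\<Omega> N m)
          (\<lambda>\<omega>. \<bar>X N m 1 \<omega> - prob_space.expectation (\<Omega> N m) (X N m 1)\<bar> ^ k)
          powr (1 / real k) \<le> real k powr \<gamma>2 * M N m"
    \<comment> \<open>(ii)\<close>
    and bounded: "\<exists>B. \<forall>(N, m)\<in>R. \<forall>x \<in> {1..m} \<rightarrow>\<^sub>E UNIV. \<bar>h m x\<bar> \<le> B"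
    \<comment> \<open>(iii)\<close>
    and liminf_variance:
        "Liminf (ratio_at_top R)
           (\<lambda>(N, m). ereal (proj1_variance (\<Omega> N m) m (h m) (X N m))) > 0"
    \<comment> \<open>(iv)\<close>
    and mM2: "(\<lambda>(N, m). real m * (M N m)\<^sup>2) \<in> o[ratio_at_top R](\<lambda>(N, m). real N powr (1 - \<delta>))"
    and q_increasing: "\<And>N N' m. m \<le> N \<Longrightarrow> N \<le> N' \<Longrightarrow> q N m \<le> q N' m"
  shows
    "((\<lambda>(N, m). q N m) \<in> o[ratio_at_top R](\<lambda>(N, m).
         min ((real N / (real m * (M N m)\<^sup>2)) powr (1 / (1 + 2 * \<gamma>2)))
             (real (jmax N m) * ln (real N / real m)))
        \<longrightarrow> deviation_bound R \<Omega> X h q) \<and>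
     ((\<lambda>(N, m). real m) \<in> o[ratio_at_top R](\<lambda>(N, m). real N powr (1 / 2) / ln (real N)) \<and>
      (\<lambda>(N, m). q N m) \<in> o[ratio_at_top R](\<lambda>(N, m).
         min ((real N / (real m * (M N m)\<^sup>2)) powr (1 / (1 + 2 * \<gamma>2)))
             (real N * real (jmax N m) / (real m)\<^sup>2))
        \<longrightarrow> deviation_bound R \<Omega> X h q)"
proof -
  obtain B0 where B0: "\<forall>(N, m)\<in>R. \<forall>x \<in> {1..m} \<rightarrow>\<^sub>E UNIV. \<bar>h m x\<bar> \<le> B0" using bounded by blast
  define B where "B = max B0 1"
  have B1: "1 \<le> B" by (simp add: B_def)
  obtain s0 where s0: "ereal 0 < ereal s0"
    "ereal s0 < Liminf (ratio_at_top R) (\<lambda>(N, m). ereal (proj1_variance (\<Omega> N m) m (h m) (X N m)))"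
    using ereal_dense2[OF liminf_variance] by (auto simp: zero_ereal_def)
  have s0_pos: "0 < s0" using s0(1) by simp
  have ev_var: "eventually (\<lambda>(N, m). s0 \<le> proj1_variance (\<Omega> N m) m (h m) (X N m)) (ratio_at_top R)"
    using less_LiminfD[OF s0(2)] by eventually_elim auto
  have pos: "0 < m \<and> m \<le> N \<and> 0 < N" if "(N, m) \<in> R" for N m
    using jmax[OF that] m_le_N[OF that] by auto
  have model: "smooth_model (\<Omega> N m) (X N m) (h m) N m B (jmax N m) C1 \<gamma>2 (M N m)" if R: "(N, m) \<in> R" for N m
  proof -
    show ?thesis
    proof (intro smooth_model.intro ustat_model.intro ustat_model_axioms.intro smooth_model_axioms.intro)
      show "\<bar>h m x\<bar> \<le> B" if "x \<in> {1..m} \<rightarrow>\<^sub>E UNIV" for x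
        using bspec[OF B0 R] that by (force simp: B_def le_max_iff_disj)
      show "distr (\<Omega> N m) borel (X N m i) = distr (\<Omega> N m) borel (X N m 1)" if "i \<in> {1..N}" for i
        by (rule ident[OF R that])
      show "mixed_partials_exist j (kernel_mean (\<Omega> N m) m (h m) (X N m) j)" if "2 \<le> j" "j \<le> jmax N m" for j
        by (rule smooth[OF R that])
      show "\<bar>mixed_partial 1 j (kernel_mean (\<Omega> N m) m (h m) (X N m) j) x\<bar> \<le> (C1 / real m) powr (real j / 2) * real j powr (real j / 2)"
        if "2 \<le> j" "j \<le> jmax N m" for j x by (rule deriv_bound[OF R that])
      show "1 \<le> m" "m \<le> N" using pos[OF R] by auto
    qed (rule prob[OF R] indep[OF R] kernel[OF R] centered[OF R] constants B1 M_pos[OF R] integrable_moments[OF R] moment_bound[OF R]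
        conjunct1[OF jmax[OF R]] conjunct2[OF jmax[OF R]] | assumption)+
  qed
  define A where "A N m = real N / (real m * (M N m)\<^sup>2)" for N m
  \<comment> \<open>One claim for both ranges of q: the second bound may take either form, even pair
    by pair. The quantifier over c' replaces the Landau symbol.\<close>
  have core: "deviation_bound R \<Omega> X h q"
    if q: "\<And>c'. 0 < c' \<Longrightarrow> eventually (\<lambda>(N, m). q N m \<le> c' * A N m powr (1 / (1 + 2 * \<gamma>2)) \<and>
        (q N m \<le> c' * (real (jmax N m) * ln (real N / real m)) \<or> q N m \<le> c' * (real N * real (jmax N m) / (real m)\<^sup>2)))
        (ratio_at_top R)"
  proof (rule deviation_boundI)
    fix e :: real assume e: "0 < e" "e \<le> 1"
    obtain K cY c where K: "1 / \<delta> \<le> K" "1 \<le> K" and c: "0 < cY" "0 < c" and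
      main0: "\<forall>(\<Omega> :: 'a measure) X h N m jmax M t k r. smooth_model \<Omega> X h N m B jmax C1 \<gamma>2 M \<longrightarrow>
        s0 \<le> proj1_variance \<Omega> m h X \<longrightarrow> 2 \<le> t \<longrightarrow> k = nat \<lceil>K * t\<rceil> \<longrightarrow>
        r = real (2 * k) * (real (2 * k) powr \<gamma>2 * M)\<^sup>2 * real m / real N \<longrightarrow> real N * r ^ k \<le> 1 \<longrightarrow> r \<le> c \<longrightarrow>
        t * real m / real N \<le> cY \<or> M\<^sup>2 \<le> c \<and> 1 \<le> c * real jmax \<longrightarrow>
        K * t \<le> real jmax * ln (real N / real m) \<or> t * real m / real N \<le> cY \<and> t * (real m)\<^sup>2 \<le> c * (real N * real jmax) \<longrightarrow>
        measure \<Omega> {\<omega> \<in> space \<Omega>. sqrt (t * real m / real N) \<le> \<bar>U_stat N m h X \<omega>\<bar>}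
          \<le> 2 * exp (- t / (2 * (1 + e) * proj1_variance \<Omega> m h X))"
      using uniform_bound[OF B1 s0_pos constants(1,2) e, of "1 / \<delta>", where 'a='a]
      by (elim exE conjE) (rule that; assumption)
    note main = main0[rule_format]
    \<comment> \<open>c/(4K) and exp(-1)/(4K) control r, c cY the bounds on M^2 and jmax, 1/K and c
      the degrees beyond jmax, cY the case of small y; 1 permits lowering an exponent.\<close>
    let ?C = "{1, c / (4 * K), exp (- 1) / (4 * K), c * cY, 1 / K, cY, c}"
    define c' where "c' = Min ?C"
    have "\<forall>x\<in>?C. 0 < x" using K c by auto
    then have "0 < c'" unfolding c'_def by (intro Min_gr_iff[THEN iffD2]) simp_all
    moreover have "c' \<le> x" if "x \<in> ?C" for x unfolding c'_def using that by (intro Min_le) simp_all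
    ultimately have c': "0 < c'" "c' \<le> 1" "c' \<le> c / (4 * K)" "c' \<le> exp (- 1) / (4 * K)" "c' \<le> c * cY" "c' \<le> 1 / K" "c' \<le> cY" "c' \<le> c"
      by blast+
    obtain x0 where x0: "1 \<le> x0" "\<And>x. x0 \<le> x \<Longrightarrow> (2 * ln x) powr (1 + 2 * \<gamma>2) \<le> x powr (\<delta> / 2)"
      using log_power_bound[of "1 + 2 * \<gamma>2" \<delta>] constants by auto
    have ev_N: "eventually (\<lambda>(N, m). (N, m) \<in> R \<and> x0 \<le> real N / real m) (ratio_at_top R)"
      unfolding eventually_ratio_at_top by (rule exI[of _ x0]) auto
    have ev_M: "eventually (\<lambda>(N, m). real m * (M N m)\<^sup>2 \<le> real N powr (1 - \<delta>)) (ratio_at_top R)"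
      using landau_o.smallD[OF mM2, of 1] by (rule eventually_mono) (auto simp: abs_mult)
    show "eventually (\<lambda>(N, m). \<forall>t. 2 \<le> t \<and> t \<le> q N m \<longrightarrow>
      measure (\<Omega> N m) {\<omega> \<in> space (\<Omega> N m). \<bar>U_stat N m (h m) (X N m) \<omega>\<bar> \<ge> sqrt (t * real m / real N)}
        \<le> 2 * exp (- t / (2 * (1 + e) * proj1_variance (\<Omega> N m) m (h m) (X N m)))) (ratio_at_top R)"
      using ev_N ev_M ev_var q[OF c'(1)]
    proof eventually_elim
      case (elim x)
      obtain N m where x: "x = (N, m)" by (cases x)
      have R: "(N, m) \<in> R" and Nm: "x0 \<le> real N / real m" and mM: "real m * (M N m)\<^sup>2 \<le> real N powr (1 - \<delta>)"
        and var: "s0 \<le> proj1_variance (\<Omega> N m) m (h m) (X N m)"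
        and qA: "q N m \<le> c' * A N m powr (1 / (1 + 2 * \<gamma>2))"
        and qj: "q N m \<le> c' * (real (jmax N m) * ln (real N / real m)) \<or> q N m \<le> c' * (real N * real (jmax N m) / (real m)\<^sup>2)"
        using elim by (auto simp: x)
      have mN: "0 < m" "m \<le> N" "0 < N" using pos[OF R] by auto
      have M0: "0 < M N m" by (rule M_pos[OF R])
      have jm: "2 \<le> jmax N m" "jmax N m \<le> m" using jmax[OF R] by auto
      have A0: "0 < A N m" using mN M0 by (simp add: A_def)
      have "real N / real m \<le> real N / 1" using mN by (intro divide_left_mono) auto
      then have xN: "x0 \<le> real N" using Nm by simp
      have ratio1: "1 \<le> real N / real m" using mN by simp
      have "measure (\<Omega> N m) {\<omega> \<in> space (\<Omega> N m). sqrt (t * real m / real N) \<le> \<bar>U_stat N m (h m) (X N m) \<omega>\<bar>}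
        \<le> 2 * exp (- t / (2 * (1 + e) * proj1_variance (\<Omega> N m) m (h m) (X N m)))" if t: "2 \<le> t" "t \<le> q N m" for t
      proof -
        define y where "y = t * real m / real N"
        have tA: "t \<le> c' * A N m powr (1 / (1 + 2 * \<gamma>2))" using t qA by simp
        have c4: "4 * K * c' \<le> exp (- 1)" "4 * K * c' \<le> c" using c'(3,4) K by (auto simp: field_simps)
        note r = moment_ratio_small[OF mN(3,1) M0 K(2,1) t(1) constants(2,3) refl refl A_def tA c'(1) c4(1) mM x0(2)[OF xN]]
        \<comment> \<open>As t \<ge> 1, t \<le> t^(1 + 2\<gamma>2), so the first bound on q yields t
          \<le> c' A.\<close>
        have yA: "y * (M N m)\<^sup>2 \<le> c'"
        proof -
          have "t powr 1 \<le> t powr (1 + 2 * \<gamma>2)" using t constants by (intro powr_mono) auto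
          also have "\<dots> \<le> (c' * A N m powr (1 / (1 + 2 * \<gamma>2))) powr (1 + 2 * \<gamma>2)"
            using tA t constants by (intro powr_mono2) auto
          also have "\<dots> = c' powr (1 + 2 * \<gamma>2) * A N m"
            using c' A0 constants by (simp add: powr_mult powr_powr)
          also have "\<dots> \<le> c' powr 1 * A N m"
            using c' A0 constants by (intro mult_right_mono powr_mono') auto
          finally have "t \<le> c' * A N m" using t c' by simp
          then show ?thesis using mN M0 by (simp add: y_def A_def field_simps)
        qed
        have alt: "t \<le> c' * (real (jmax N m) * ln (real N / real m)) \<or> t \<le> c' * (real N * real (jmax N m) / (real m)\<^sup>2)"
          using t qj by linarith
        \<comment> \<open>jmax \<le> m turns the second form of the bound into y \<le> c'.\<close>
        have y_small: "y \<le> cY" if "t \<le> c' * (real N * real (jmax N m) / (real m)\<^sup>2)"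
        proof -
          have "y \<le> c' * (real N * real (jmax N m) / (real m)\<^sup>2) * real m / real N"
            unfolding y_def using that by (intro divide_right_mono mult_right_mono) auto
          also have "\<dots> = c' * (real (jmax N m) / real m)" using mN by (simp add: power2_eq_square)
          also have "\<dots> \<le> c' * 1" using c' jm mN by (intro mult_left_mono) auto
          finally show ?thesis using c' by simp
        qed
        \<comment> \<open>If y exceeds cY, then y M^2 \<le> c' makes M small, and the logarithmic
          form with ln x \<le> x gives y \<le> c' jmax, so jmax is large.\<close>
        have H1: "y \<le> cY \<or> (M N m)\<^sup>2 \<le> c \<and> 1 \<le> c * real (jmax N m)"
        proof (cases "y \<le> cY")
          case False
          have "cY * (M N m)\<^sup>2 \<le> y * (M N m)\<^sup>2" using False by (intro mult_right_mono) auto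
          then have "cY * (M N m)\<^sup>2 \<le> cY * c" using yA c'(5) unfolding mult.commute[of c cY] by linarith
          then have 1: "(M N m)\<^sup>2 \<le> c" using c by (simp only: mult_le_cancel_left_pos)
          have "t \<le> c' * (real (jmax N m) * ln (real N / real m))" using alt y_small False by auto
          also have "\<dots> \<le> c' * (real (jmax N m) * (real N / real m))"
            using c' ratio1 ln_le_minus_one[of "real N / real m"] by (intro mult_left_mono) auto
          finally have "y \<le> c' * (real (jmax N m) * (real N / real m)) * real m / real N"
            unfolding y_def by (intro divide_right_mono mult_right_mono) auto
          also have "\<dots> = c' * real (jmax N m)" using mN by simp
          also have "\<dots> \<le> (c * cY) * real (jmax N m)" using c' by (intro mult_right_mono) auto
          finally have "cY * 1 \<le> cY * (c * real (jmax N m))" using False by (simp add: mult_ac)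
          then have "1 \<le> c * real (jmax N m)" using c by (subst (asm) mult_le_cancel_left_pos) auto
          then show ?thesis using 1 by simp
        qed simp
        have H2: "K * t \<le> real (jmax N m) * ln (real N / real m) \<or>
          y \<le> cY \<and> t * (real m)\<^sup>2 \<le> c * (real N * real (jmax N m))"
          using alt
        proof
          assume "t \<le> c' * (real (jmax N m) * ln (real N / real m))"
          also have "\<dots> \<le> 1 / K * (real (jmax N m) * ln (real N / real m))"
            using c' ratio1 by (intro mult_right_mono mult_nonneg_nonneg) auto
          finally have "K * t \<le> real (jmax N m) * ln (real N / real m)" using K by (simp add: field_simps)
          then show ?thesis ..
        next
          assume tj: "t \<le> c' * (real N * real (jmax N m) / (real m)\<^sup>2)"
          then have "t * (real m)\<^sup>2 \<le> c' * (real N * real (jmax N m) / (real m)\<^sup>2) * (real m)\<^sup>2"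
            by (intro mult_right_mono) auto
          also have "\<dots> = c' * (real N * real (jmax N m))" using mN by simp
          also have "\<dots> \<le> c * (real N * real (jmax N m))" using c' by (intro mult_right_mono) auto
          finally show ?thesis using y_small[OF tj] by simp
        qed
        show ?thesis
          by (rule main[OF model[OF R] var t(1) refl refl r(1) order_trans[OF r(2) c4(2)] H1[unfolded y_def] H2[unfolded y_def]])
      qed
      then show ?case by (simp add: x)
    qed
  qed (use prob pos in auto)
  have small: "eventually (\<lambda>(N, m). q N m \<le> c' * u N m \<and> q N m \<le> c' * w N m) (ratio_at_top R)"
    if o: "(\<lambda>(N, m). q N m) \<in> o[ratio_at_top R](\<lambda>(N, m). min (u N m) (w N m))"
      and nonneg: "\<And>N m. (N, m) \<in> R \<Longrightarrow> 0 \<le> u N m \<and> 0 \<le> w N m" and c': "0 < c'" for u w :: "nat \<Rightarrow> nat \<Rightarrow> real" and c'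
  proof -
    have ev_R: "eventually (\<lambda>(N, m). (N, m) \<in> R) (ratio_at_top R)"
      unfolding eventually_ratio_at_top by auto
    show ?thesis using landau_o.smallD[OF o c'] ev_R
    proof eventually_elim
      case (elim x)
      obtain N m where x: "x = (N, m)" by (cases x)
      have nn: "0 \<le> u N m" "0 \<le> w N m" using nonneg elim(2) by (auto simp: x)
      have "\<bar>q N m\<bar> \<le> c' * \<bar>min (u N m) (w N m)\<bar>" using elim(1) by (simp add: x)
      also have "\<bar>min (u N m) (w N m)\<bar> = min (u N m) (w N m)" using nn by simp
      finally have "q N m \<le> c' * min (u N m) (w N m)" by simp
      moreover have "c' * min (u N m) (w N m) \<le> c' * u N m" "c' * min (u N m) (w N m) \<le> c' * w N m"
        using c' by (auto intro!: mult_left_mono)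
      ultimately show ?case by (simp add: x)
    qed
  qed
  have ln_nonneg: "0 \<le> ln (real N / real m)" if "(N, m) \<in> R" for N m
    using pos[OF that] by (intro ln_ge_zero) auto
  show ?thesis
  proof (intro conjI impI)
    assume o: "(\<lambda>(N, m). q N m) \<in> o[ratio_at_top R](\<lambda>(N, m).
         min ((real N / (real m * (M N m)\<^sup>2)) powr (1 / (1 + 2 * \<gamma>2)))
             (real (jmax N m) * ln (real N / real m)))"
    show "deviation_bound R \<Omega> X h q"
    proof (rule core)
      fix c' :: real assume "0 < c'"
      from small[OF o _ this] ln_nonneg
      have "eventually (\<lambda>(N, m). q N m \<le> c' * (real N / (real m * (M N m)\<^sup>2)) powr (1 / (1 + 2 * \<gamma>2)) \<and>
          q N m \<le> c' * (real (jmax N m) * ln (real N / real m))) (ratio_at_top R)" by auto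
      then show "eventually (\<lambda>(N, m). q N m \<le> c' * A N m powr (1 / (1 + 2 * \<gamma>2)) \<and>
        (q N m \<le> c' * (real (jmax N m) * ln (real N / real m)) \<or> q N m \<le> c' * (real N * real (jmax N m) / (real m)\<^sup>2)))
        (ratio_at_top R)" by (rule eventually_mono) (auto simp: A_def)
    qed
  next
    assume o: "(\<lambda>(N, m). real m) \<in> o[ratio_at_top R](\<lambda>(N, m). real N powr (1 / 2) / ln (real N)) \<and>
      (\<lambda>(N, m). q N m) \<in> o[ratio_at_top R](\<lambda>(N, m).
         min ((real N / (real m * (M N m)\<^sup>2)) powr (1 / (1 + 2 * \<gamma>2)))
             (real N * real (jmax N m) / (real m)\<^sup>2))"
    show "deviation_bound R \<Omega> X h q"
    proof (rule core)
      fix c' :: real assume "0 < c'"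
      from small[OF conjunct2[OF o] _ this]
      have "eventually (\<lambda>(N, m). q N m \<le> c' * (real N / (real m * (M N m)\<^sup>2)) powr (1 / (1 + 2 * \<gamma>2)) \<and>
          q N m \<le> c' * (real N * real (jmax N m) / (real m)\<^sup>2)) (ratio_at_top R)" by auto
      then show "eventually (\<lambda>(N, m). q N m \<le> c' * A N m powr (1 / (1 + 2 * \<gamma>2)) \<and>
        (q N m \<le> c' * (real (jmax N m) * ln (real N / real m)) \<or> q N m \<le> c' * (real N * real (jmax N m) / (real m)\<^sup>2)))
        (ratio_at_top R)" by (rule eventually_mono) (auto simp: A_def)
    qed
  qed
qed

end
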